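(* Let $d\in\mathbb{N}$, $\sigma\in(0,1]$ with $\sigma<d/2$ if $d\in\{1,2\}$, $\alpha\in(\sigma,d/2)$ and $\alpha_0=\frac{d/2+\sigma}{2}$. The weight $w_{\sigma,\alpha}=\kappa_{\sigma-\alpha}/\kappa_{-\alpha}$ is a positive critical Hardy weight for $\Delta^\sigma$ on $\mathbb{Z}^d$ if and only if $\alpha<\alpha_0$.
   Context: For $f:\mathbb{Z}^d\to\mathbb{R}$ let $\Delta f(x)=\sum_{y:|y-x|=1}(f(x)-f(y))$ ($|\cdot|$ Euclidean norm), with heat semigroup $e^{-t\Delta}$ on $\ell^2(\mathbb{Z}^d)$; $1_0$ is the indicator of $\{0\}$. For $\sigma\in(0,1)$, $\Delta^\sigma$ is defined on $\ell^2$ by the spectral theorem, $\Delta^1=\Delta$. For $\beta\in(-d/2,1]$ the Riesz kernel $\kappa_\beta:\mathbb{Z}^d\to[0,\infty)$ is given by $\kappa_0=1_0$, $\kappa_1(x)=1_{\{|x|=1\}}$, $\kappa_\beta(0)=0$ if $\beta\in(0,1)$, and otherwise $\kappa_\beta(x)=\frac{1}{|\Gamma(-\beta)|}\int_0^\infty e^{-t\Delta}1_0(x)\,\frac{dt}{t^{1+\beta}}$. Let $Q^\sigma(f)=\frac12\sum_{x,y}\kappa_\sigma(x-y)(f(x)-f(y))^2$ (equal to $\langle\Delta^\sigma\varphi,\varphi\rangle$ for finitely supported $\varphi$), and let $\mathcal{D}_0^\sigma$ be the closure of finitely supported functions $C_c(\mathbb{Z}^d)$ under $\|\varphi\|=\sqrt{Q^\sigma(\varphi)+|\varphi(0)|^2}$.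 A function $w:\mathbb{Z}^d\to[0,\infty)$ is a Hardy weight if $Q^\sigma(\varphi)\ge\sum_xw(x)\varphi(x)^2$ for all $\varphi\in C_c(\mathbb{Z}^d)$ (then also for all $\varphi\in\mathcal{D}_0^\sigma$). A Hardy weight $w$ is critical if every Hardy weight $w'\ge w$ equals $w$ (subcritical otherwise). A critical Hardy weight $w$ is positive critical if there is a nonzero $v\in\mathcal{D}_0^\sigma$ with $Q^\sigma(v)=\sum_xw(x)v(x)^2$, and null-critical otherwise. *)

theory Defs
  imports "HOL-Analysis.Analysis"
begin

definition sqnorm :: "int ^ 'd \<Rightarrow> int" where
  "sqnorm z = (\<Sum>i\<in>UNIV. (z $ i)^2)"

definition lap :: "(int ^ 'd \<Rightarrow> real) \<Rightarrow> (int ^ 'd \<Rightarrow> real)" where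
  "lap f x = (\<Sum>y\<in>{y. sqnorm (y - x) = 1}. f x - f y)"

definition delta0 :: "int ^ 'd \<Rightarrow> real" where
  "delta0 x = (if x = 0 then 1 else 0)"

text \<open>Heat kernel e^{-t Delta} 1_0 (x): Delta is bounded on l^2, so the semigroup is the
  exponential series of the bounded operator -t Delta, applied to 1_0.\<close>
definition heat :: "real \<Rightarrow> int ^ 'd \<Rightarrow> real" where
  "heat t x = (\<Sum>n. ((- t) ^ n / fact n) * (lap ^^ n) delta0 x)"

text \<open>Riesz kernel kappa_beta (meant for beta in (-d/2, 1]).\<close>
definition kappa :: "real \<Rightarrow> int ^ 'd \<Rightarrow> real" where
  "kappa \<beta> x =
     (if \<beta> = 0 then delta0 x
      else if \<beta> = 1 then (if sqnorm x = 1 then 1 else 0)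
      else if 0 < \<beta> \<and> \<beta> < 1 \<and> x = 0 then 0
      else (1 / \<bar>Gamma (- \<beta>)\<bar>) * integral {0<..} (\<lambda>t. heat t x / t powr (1 + \<beta>)))"

definition Qform :: "real \<Rightarrow> (int ^ 'd \<Rightarrow> real) \<Rightarrow> ennreal" where
  "Qform \<sigma> f = (\<integral>\<^sup>+ x. \<integral>\<^sup>+ y. ennreal (kappa \<sigma> (x - y) * (f x - f y)^2)
                    \<partial>count_space UNIV \<partial>count_space UNIV) / 2"

definition wsum :: "(int ^ 'd \<Rightarrow> real) \<Rightarrow> (int ^ 'd \<Rightarrow> real) \<Rightarrow> ennreal" where
  "wsum w f = (\<integral>\<^sup>+ x. ennreal (w x * (f x)^2) \<partial>count_space UNIV)"

definition fin_supp :: "(int ^ 'd \<Rightarrow> real) \<Rightarrow> bool" where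
  "fin_supp f \<longleftrightarrow> finite {x. f x \<noteq> 0}"

definition D0 :: "real \<Rightarrow> (int ^ 'd \<Rightarrow> real) set" where
  "D0 \<sigma> = {f. \<exists>\<phi> :: nat \<Rightarrow> int ^ 'd \<Rightarrow> real. (\<forall>n. fin_supp (\<phi> n)) \<and>
        ((\<lambda>n. Qform \<sigma> (\<lambda>x. \<phi> n x - f x) + ennreal ((\<phi> n 0 - f 0)^2)) \<longlongrightarrow> 0) sequentially}"

definition hardy_weight :: "real \<Rightarrow> (int ^ 'd \<Rightarrow> real) \<Rightarrow> bool" where
  "hardy_weight \<sigma> w \<longleftrightarrow> (\<forall>x. 0 \<le> w x) \<and>
     (\<forall>\<phi>. fin_supp \<phi> \<longrightarrow> wsum w \<phi> \<le> Qform \<sigma> \<phi>)"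

definition critical_hardy :: "real \<Rightarrow> (int ^ 'd \<Rightarrow> real) \<Rightarrow> bool" where
  "critical_hardy \<sigma> w \<longleftrightarrow> hardy_weight \<sigma> w \<and>
     (\<forall>w'. hardy_weight \<sigma> w' \<and> (\<forall>x. w x \<le> w' x) \<longrightarrow> w' = w)"

definition positive_critical :: "real \<Rightarrow> (int ^ 'd \<Rightarrow> real) \<Rightarrow> bool" where
  "positive_critical \<sigma> w \<longleftrightarrow> critical_hardy \<sigma> w \<and>
     (\<exists>v\<in>D0 \<sigma>. v \<noteq> (\<lambda>_. 0) \<and> Qform \<sigma> v = wsum w v)"

end

theory Submission
  imports Defs
begin

text \<open>Write \<open>u = kappa (- \<alpha>)\<close> and \<open>m = kappa (\<sigma> - \<alpha>)\<close>. Both are integrals of the heat kernel against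
  powers of time, and comparing these integrals shows that the fractional Laplacian maps \<open>u\<close> to \<open>m\<close>.
  Hence \<open>u\<close> is a positive ground state for the weight \<open>m / u\<close>, and the ground state representation
  writes the form minus the weight as the energy of \<open>\<phi> / u\<close> for a jump kernel that connects the lattice.
  So the Hardy inequality holds, and an optimiser in the form domain must be a multiple of \<open>u\<close>,
  which requires \<open>m u\<close> to be summable. Conversely, if \<open>m u\<close> is summable, then the truncations of \<open>u\<close>
  converge to \<open>u\<close> in the form domain, and testing a larger weight with \<open>u\<close> gives criticality.
  By the semigroup property the sum of \<open>m u\<close> is a multiple of \<open>\<integral> heat t 0 * t powr (2 * \<alpha> - \<sigma> - 1) dt\<close>.
  The heat kernel factorises over the coordinates and \<open>heat t 0\<close> is of order \<open>t powr (- d / 2)\<close>,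
  so this integral is finite exactly when \<open>2 * \<alpha> - \<sigma> < d / 2\<close>.\<close>

section \<open>Walks on the lattice\<close>

text \<open>The kernel \<open>kappa \<sigma>\<close> with \<sigma> < 1 has no diagonal:
  \<open>heat t 0\<close> tends to 1 at time 0, where \<open>t powr (- \<sigma> - 1)\<close> is not
  integrable. The operator is therefore \<open>K\<close> times \<open>u\<close> minus the
  convolution of \<open>kappa \<sigma>\<close> with \<open>u\<close>, where \<open>K\<close> is the
  total mass of the kernel, and the equation for \<open>u\<close> is kept in additive form, so that
  no extended sums have to be subtracted.

  For \<sigma> < 1 this equation comes down to a scalar integral. Applying the heat semigroup at
  time \<open>s\<close> to the potential replaces \<open>t\<close> by \<open>t - s\<close> in its
  power of time. Integrating the difference against \<open>s powr (- \<sigma> - 1)\<close> leaves a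
  homogeneous function of \<open>t\<close>, namely a Gamma quotient times
  \<open>t powr (\<alpha> - \<sigma> - 1)\<close>, and the quotient matches the normalisations of
  the three kernels. For \<sigma> = 1 the kernel is a neighbour indicator instead of a time
  integral, and integration by parts in time takes over.

  The series defining \<open>heat\<close> alternates. Its positivity comes from splitting
  \<open>lap\<close> into a multiple of the identity and the adjacency operator, whose powers count
  walks.

  For large \<alpha> no optimiser exists, which refutes positive criticality whether or not the
  weight is critical.\<close>

definition uvec :: "(int ^ 'd::finite) set" where
  "uvec = {z. sqnorm z = 1}"

lemma sqnorm_minus [simp]: "sqnorm (- z) = sqnorm z"
  by (simp add: sqnorm_def)

lemma sqnorm_axis [simp]: "sqnorm (axis i c) = c\<^sup>2"
proof -
  have "sqnorm (axis i c) = (\<Sum>j\<in>UNIV. if j = i then c\<^sup>2 else 0)"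
    unfolding sqnorm_def by (intro sum.cong) (auto simp: axis_def)
  then show ?thesis by simp
qed

text \<open>A nonzero integer coordinate already contributes at least 1 to the sum of squares, so
  nothing is left for the other coordinates.\<close>

lemma uvec_cases:
  assumes "z \<in> uvec"
  obtains i s where "z = axis i s" "s \<in> {1, -1}"
proof -
  have s: "(\<Sum>i\<in>UNIV. (z $ i)\<^sup>2) = 1" using assms by (simp add: uvec_def sqnorm_def)
  obtain i where i: "z $ i \<noteq> 0"
    using s by (metis (no_types, lifting) power_zero_numeral sum.neutral zero_neq_one)
  have eq: "(\<Sum>j\<in>UNIV. (z $ j)\<^sup>2) = (z $ i)\<^sup>2 + (\<Sum>j\<in>UNIV - {i}. (z $ j)\<^sup>2)"
    by (simp add: sum.remove)
  have ge: "(z $ i)\<^sup>2 \<ge> 1" using i by (simp add: int_one_le_iff_zero_less)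
  have nn: "(\<Sum>j\<in>UNIV - {i}. (z $ j)\<^sup>2) \<ge> 0" by (intro sum_nonneg) auto
  have 1: "(z $ i)\<^sup>2 = 1" and 0: "(\<Sum>j\<in>UNIV - {i}. (z $ j)\<^sup>2) = 0"
    using s eq ge nn by linarith+
  from 0 have "\<forall>j\<in>UNIV - {i}. (z $ j)\<^sup>2 = 0" by (subst (asm) sum_nonneg_eq_0_iff) auto
  then have "z = axis i (z $ i)" by (auto simp: vec_eq_iff axis_def)
  moreover have "z $ i \<in> {1, -1}" using 1 by (auto simp: power2_eq_1_iff)
  ultimately show ?thesis using that by blast
qed

lemma axis_in_uvec [simp]: "axis i 1 \<in> uvec" "axis i (-1) \<in> uvec"
  by (auto simp: uvec_def)

lemma bij_betw_uvec: "bij_betw (\<lambda>(i, s). axis i s) (UNIV \<times> {1, -1}) (uvec :: (int ^ 'd::finite) set)"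
proof (rule bij_betwI')
  fix x y :: "'d \<times> int"
  assume "x \<in> UNIV \<times> {1, -1}" "y \<in> UNIV \<times> {1, -1}"
  then show "((case x of (i, s) \<Rightarrow> axis i s) = (case y of (i, s) \<Rightarrow> axis i s)) = (x = y)"
    by (auto simp: axis_eq_axis)
qed (auto elim: uvec_cases)

lemma finite_uvec [simp]: "finite uvec"
  using bij_betw_finite[OF bij_betw_uvec] by simp

lemma sum_uvec: "sum f uvec = (\<Sum>i\<in>UNIV. f (axis i 1) + f (axis i (-1)))"
  for f :: "int ^ 'd::finite \<Rightarrow> 'b::comm_monoid_add"
proof -
  have "sum f uvec = (\<Sum>(i, s)\<in>UNIV \<times> {1, -1}. f (axis i s))"
    by (subst sum.reindex_bij_betw[OF bij_betw_uvec, symmetric]) (simp add: case_prod_beta)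
  also have "\<dots> = (\<Sum>i\<in>UNIV. \<Sum>s\<in>{1, -1}. f (axis i s))"
    by (rule sum.cartesian_product[symmetric])
  finally show ?thesis by simp
qed

lemma uminus_in_uvec [simp]: "- e \<in> uvec \<longleftrightarrow> e \<in> uvec"
  by (simp add: uvec_def)

lemma sum_uvec_uminus: "(\<Sum>e\<in>uvec. f (- e)) = sum f uvec"
  by (rule sum.reindex_bij_witness[of _ uminus uminus]) auto

text \<open>Descent on the sum of the absolute coordinates: subtracting the sign of a nonzero
  coordinate moves to a neighbour nearer to the origin. Facts known at \<open>0\<close> spread over
  the lattice in this way: positivity of walk counts, pointwise convergence in the form domain,
  constancy of \<open>v / u\<close>.\<close>

lemma lattice_connected:
  fixes P :: "int ^ 'd::finite \<Rightarrow> bool"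
  assumes "P 0" and step: "\<And>x e. P x \<Longrightarrow> e \<in> uvec \<Longrightarrow> P (x + e)"
  shows "P x"
proof (induction "\<Sum>i\<in>UNIV. nat \<bar>x $ i\<bar>" arbitrary: x rule: less_induct)
  case less
  show ?case
  proof (cases "x = 0")
    case False
    then obtain i where i: "x $ i \<noteq> 0" by (auto simp: vec_eq_iff)
    define e :: "int ^ 'd" where "e = axis i (sgn (x $ i))"
    have e: "e \<in> uvec" using i by (auto simp: e_def uvec_def sgn_if)
    have "(\<Sum>j\<in>UNIV. nat \<bar>(x - e) $ j\<bar>) < (\<Sum>j\<in>UNIV. nat \<bar>x $ j\<bar>)"
    proof (rule sum_strict_mono_ex1)
      show "\<forall>j\<in>UNIV. nat \<bar>(x - e) $ j\<bar> \<le> nat \<bar>x $ j\<bar>"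
        by (auto simp: e_def axis_def sgn_if)
      show "\<exists>j\<in>UNIV. nat \<bar>(x - e) $ j\<bar> < nat \<bar>x $ j\<bar>"
        using i by (intro bexI[of _ i]) (auto simp: e_def axis_def sgn_if)
    qed simp
    then have "P (x - e)" by (rule less)
    from step[OF this e] show ?thesis by simp
  qed (use assms(1) in simp)
qed

lemma lap_eq: "lap f x = (\<Sum>e\<in>uvec. f x - f (x + e))"
  unfolding lap_def
  by (rule sum.reindex_bij_witness[of _ "\<lambda>e. x + e" "\<lambda>y. y - x"]) (auto simp: uvec_def)

text \<open>The number of nearest neighbour paths of length \<open>n\<close> between
  \<open>x\<close> and the origin, that is, the \<open>n\<close>-th power of the adjacency operator
  at \<open>delta0\<close>.\<close>

primrec walk :: "nat \<Rightarrow> int ^ 'd::finite \<Rightarrow> real" where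
  "walk 0 = delta0"
| "walk (Suc n) = (\<lambda>x. \<Sum>e\<in>uvec. walk n (x + e))"

lemma walk_nonneg [simp]: "walk n x \<ge> 0"
  by (induction n arbitrary: x) (auto simp: delta0_def intro: sum_nonneg)

lemma walk_minus [simp]: "walk n (- x) = walk n x"
proof (induction n arbitrary: x)
  case (Suc n)
  have "walk (Suc n) (- x) = (\<Sum>e\<in>uvec. walk n (- x + - e))"
    using sum_uvec_uminus[of "\<lambda>e. walk n (- x + e)"] by simp
  also have "\<dots> = (\<Sum>e\<in>uvec. walk n (x + e))"
    by (intro sum.cong) (simp_all only: Suc flip: minus_add_distrib)
  finally show ?case by simp
qed (simp add: delta0_def)

lemma nn_integral_count_space_shift:
  fixes a :: "'a::group_add"
  shows "(\<integral>\<^sup>+x. f (x + a) \<partial>count_space UNIV) = (\<integral>\<^sup>+x. f x \<partial>count_space UNIV)"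
  by (rule nn_integral_bij_count_space, rule bij_betwI[of _ _ _ "\<lambda>x. x - a"]) auto

lemma nn_integral_count_space_reflect:
  fixes a :: "'a::ab_group_add"
  shows "(\<integral>\<^sup>+x. f (a - x) \<partial>count_space UNIV) = (\<integral>\<^sup>+x. f x \<partial>count_space UNIV)"
  by (rule nn_integral_bij_count_space, rule bij_betwI[of _ _ _ "\<lambda>x. a - x"]) auto

lemma nn_integral_count_space_delta0:
  fixes f :: "int ^ 'd::finite \<Rightarrow> ennreal"
  shows "(\<integral>\<^sup>+x. ennreal (delta0 (a - x)) * f x \<partial>count_space UNIV) = f a"
proof -
  have "(\<integral>\<^sup>+x. ennreal (delta0 (a - x)) * f x \<partial>count_space UNIV)
      = (\<integral>\<^sup>+x. f a * indicator {a} x \<partial>count_space UNIV)"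
    by (intro nn_integral_cong) (auto simp: delta0_def indicator_def)
  then show ?thesis by (simp add: one_ennreal_def[symmetric])
qed

lemma nn_integral_walk:
  "(\<integral>\<^sup>+x. ennreal (walk n (x :: int ^ 'd::finite)) \<partial>count_space UNIV)
    = ennreal (real (card (uvec :: (int ^ 'd) set)) ^ n)"
proof (induction n)
  case 0
  show ?case
    using nn_integral_count_space_delta0[of "0 :: int ^ 'd" "\<lambda>_. 1"]
      nn_integral_count_space_reflect[of "\<lambda>x. ennreal (delta0 x)" "0 :: int ^ 'd"] by simp
next
  case (Suc n)
  have "(\<integral>\<^sup>+x. ennreal (walk (Suc n) (x :: int ^ 'd)) \<partial>count_space UNIV)
     = (\<Sum>e\<in>uvec. \<integral>\<^sup>+x. ennreal (walk n (x + e :: int ^ 'd)) \<partial>count_space UNIV)"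
    by (simp add: nn_integral_sum flip: sum_ennreal)
  also have "\<dots> = ennreal (real (card (uvec :: (int ^ 'd) set)) ^ Suc n)"
    by (simp only: nn_integral_count_space_shift[of "\<lambda>x. ennreal (walk n x)"] Suc)
       (simp add: ennreal_mult' ennreal_of_nat_eq_real_of_nat)
  finally show ?case .
qed

lemma walk_le: "walk n (x :: int ^ 'd::finite) \<le> real (card (uvec :: (int ^ 'd) set)) ^ n"
proof (induction n arbitrary: x)
  case (Suc n)
  have "walk (Suc n) x \<le> (\<Sum>e\<in>(uvec :: (int ^ 'd) set). real (card (uvec :: (int ^ 'd) set)) ^ n)"
    unfolding walk.simps using Suc by (intro sum_mono)
  then show ?case by simp
qed (simp add: delta0_def)

text \<open>Paths of length \<open>m + n\<close> are sorted by the point reached after the first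
  \<open>m\<close> steps.\<close>

lemma walk_conv:
  "(\<integral>\<^sup>+y. ennreal (walk m (x - y)) * ennreal (walk n y) \<partial>count_space UNIV) = ennreal (walk (m + n) x)"
  for x :: "int ^ 'd::finite"
proof (induction m arbitrary: x)
  case 0
  then show ?case using nn_integral_count_space_delta0[of x "\<lambda>y. ennreal (walk n y)"] by simp
next
  case (Suc m)
  have "(\<integral>\<^sup>+y. ennreal (walk (Suc m) (x - y)) * ennreal (walk n y) \<partial>count_space UNIV)
     = (\<integral>\<^sup>+y. (\<Sum>e\<in>uvec. ennreal (walk m ((x + e) - y)) * ennreal (walk n y)) \<partial>count_space UNIV)"
    by (intro nn_integral_cong) (simp add: algebra_simps sum_distrib_left flip: sum_ennreal)
  also have "\<dots> = (\<Sum>e\<in>uvec. ennreal (walk (m + n) (x + e)))"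
    by (simp add: nn_integral_sum Suc)
  finally show ?case by simp
qed

lemma walk_pos: "\<exists>n. walk n x > 0"
proof (rule lattice_connected[of "\<lambda>x. \<exists>n. walk n x > 0" x])
  show "\<exists>n. walk n (0 :: int ^ 'a) > 0" by (intro exI[of _ 0]) (simp add: delta0_def)
next
  fix x e :: "int ^ 'a" assume "\<exists>n. walk n x > 0" and e: "e \<in> uvec"
  then obtain n where n: "walk n x > 0" by blast
  have "walk n (x + e + - e) \<le> walk (Suc n) (x + e)"
    unfolding walk.simps using e by (intro member_le_sum[of "- e" uvec "\<lambda>e'. walk n (x + e + e')"]) auto
  with n have "walk (Suc n) (x + e) > 0" by simp
  then show "\<exists>n. walk n (x + e) > 0" by blast
qed

text \<open>\<open>lap\<close> is the number of neighbours times the identity minus the adjacency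
  operator. The two commute, so this is the binomial theorem; the induction step is Pascal's
  rule.\<close>

lemma lap_power_delta0:
  "(lap ^^ n) delta0 x =
     (\<Sum>k\<le>n. real (n choose k) * real (card (uvec :: (int ^ 'd::finite) set)) ^ (n - k) * (-1) ^ k * walk k x)"
  for x :: "int ^ 'd"
proof (induction n arbitrary: x)
  case (Suc n)
  let ?N = "real (card (uvec :: (int ^ 'd) set))"
  let ?g = "\<lambda>k. ?N ^ (Suc n - k) * (-1) ^ k * walk k x"
  have "(lap ^^ Suc n) delta0 x = ?N * (lap ^^ n) delta0 x - (\<Sum>e\<in>uvec. (lap ^^ n) delta0 (x + e))"
    by (simp add: lap_eq sum_subtractf)
  also have "?N * (lap ^^ n) delta0 x = (\<Sum>k\<le>n. real (n choose k) * ?g k)"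
    unfolding Suc sum_distrib_left by (intro sum.cong) (auto simp: Suc_diff_le)
  also have "(\<Sum>e\<in>uvec. (lap ^^ n) delta0 (x + e)) = - (\<Sum>k\<le>n. real (n choose k) * ?g (Suc k))"
    unfolding Suc
    by (subst sum.swap) (simp add: sum_distrib_left sum_negf algebra_simps)
  also have "(\<Sum>k\<le>n. real (n choose k) * ?g k) - - (\<Sum>k\<le>n. real (n choose k) * ?g (Suc k))
      = (\<Sum>k\<le>Suc n. real (Suc n choose k) * ?g k)"
  proof -
    have "(\<Sum>k\<le>n. real (n choose k) * ?g k) = (\<Sum>k\<le>Suc n. real (n choose k) * ?g k)"
      by simp
    also have "\<dots> = ?g 0 + (\<Sum>k\<le>n. real (n choose Suc k) * ?g (Suc k))"
      by (subst sum.atMost_Suc_shift) simp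
    finally have 1: "(\<Sum>k\<le>n. real (n choose k) * ?g k) = \<dots>" .
    have "(\<Sum>k\<le>Suc n. real (Suc n choose k) * ?g k)
        = ?g 0 + (\<Sum>k\<le>n. real (Suc n choose Suc k) * ?g (Suc k))"
      by (subst sum.atMost_Suc_shift) simp
    then show ?thesis unfolding 1 by (simp add: sum.distrib[symmetric] algebra_simps)
  qed
  finally show ?case by (simp only: mult.assoc)
qed simp

section \<open>The heat kernel\<close>

text \<open>The exponential of \<open>t\<close> times the adjacency operator, at
  \<open>delta0\<close>. In contrast to the series for \<open>heat\<close>, all its terms are
  nonnegative when \<open>t \<ge> 0\<close>.\<close>

definition path_series :: "real \<Rightarrow> int ^ 'd::finite \<Rightarrow> real" where
  "path_series t x = (\<Sum>n. t ^ n / fact n * walk n x)"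

lemma summable_path_series:
  "summable (\<lambda>n. norm (t ^ n / fact n * walk n (x :: int ^ 'd::finite)))"
proof (rule summable_comparison_test'[where N = 0])
  let ?N = "real (card (uvec :: (int ^ 'd) set))"
  have "summable (\<lambda>n. inverse (fact n) * (\<bar>t\<bar> * ?N) ^ n)"
    by (rule summable_exp)
  moreover have "(\<lambda>n. inverse (fact n) * (\<bar>t\<bar> * ?N) ^ n) = (\<lambda>n. \<bar>t\<bar> ^ n / fact n * ?N ^ n)"
    by (simp add: power_mult_distrib divide_inverse mult_ac)
  ultimately show "summable (\<lambda>n. \<bar>t\<bar> ^ n / fact n * ?N ^ n)" by (simp only:)
  show "norm (norm (t ^ n / fact n * walk n x)) \<le> \<bar>t\<bar> ^ n / fact n * ?N ^ n" for n
  proof -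
    have "norm (norm (t ^ n / fact n * walk n x)) = \<bar>t\<bar> ^ n / fact n * walk n x"
      by (simp add: abs_mult power_abs)
    also have "\<dots> \<le> \<bar>t\<bar> ^ n / fact n * ?N ^ n"
      by (intro mult_left_mono walk_le) auto
    finally show ?thesis .
  qed
qed

lemma sums_path_series: "(\<lambda>n. t ^ n / fact n * walk n x) sums path_series t x"
  unfolding path_series_def by (intro summable_sums summable_norm_cancel[OF summable_path_series])

text \<open>The exponential of a sum of two commuting operators, read off from the Cauchy product of
  the two series. Positivity, symmetry, total mass and semigroup property of \<open>heat\<close> are
  all derived from this form.\<close>

lemma heat_eq_path_series:
  "heat t (x :: int ^ 'd::finite) = exp (- real (card (uvec :: (int ^ 'd) set)) * t) * path_series t x"
proof -
  let ?N = "real (card (uvec :: (int ^ 'd) set))"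
  let ?a = "\<lambda>n. t ^ n / fact n * walk n x" and ?b = "\<lambda>n. (- ?N * t) ^ n / fact n"
  have b: "?b sums exp (- ?N * t)"
    using exp_converges[of "- ?N * t"] by (simp add: divide_inverse mult.commute)
  have b': "summable (\<lambda>n. norm (?b n))"
    using summable_norm_exp[of "- ?N * t"] by (simp add: divide_inverse mult.commute)
  have eq: "(- t) ^ n / fact n * (lap ^^ n) delta0 x = (\<Sum>k\<le>n. ?a k * ?b (n - k))" for n
  proof -
    have "(- t) ^ n / fact n * (real (n choose k) * ?N ^ (n - k) * (-1) ^ k * walk k x)
       = ?a k * ?b (n - k)" if "k \<le> n" for k
    proof -
      have "(- t) ^ n = (- t) ^ k * (- t) ^ (n - k)"
        using that by (simp flip: power_add)
      moreover have "(- t) ^ k * (-1) ^ k = t ^ k" by (simp flip: power_mult_distrib)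
      moreover have "(- ?N * t) ^ (n - k) = ?N ^ (n - k) * (- t) ^ (n - k)"
        by (simp flip: power_mult_distrib)
      ultimately show ?thesis
        using that by (simp add: binomial_fact field_simps)
    qed
    then show ?thesis by (simp add: lap_power_delta0 sum_distrib_left)
  qed
  have "(\<lambda>n. \<Sum>k\<le>n. ?a k * ?b (n - k)) sums ((\<Sum>n. ?a n) * (\<Sum>n. ?b n))"
    by (rule Cauchy_product_sums[OF summable_path_series b'])
  then have "heat t x = (\<Sum>n. ?a n) * (\<Sum>n. ?b n)"
    unfolding heat_def eq by (simp add: sums_iff)
  also have "(\<Sum>n. ?a n) = path_series t x" by (simp add: path_series_def)
  also have "(\<Sum>n. ?b n) = exp (- ?N * t)" using b by (simp add: sums_iff)
  finally show ?thesis by simp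
qed

lemma path_series_nonneg: "t \<ge> 0 \<Longrightarrow> path_series t x \<ge> 0"
  unfolding path_series_def
  by (intro suminf_nonneg sums_summable[OF sums_path_series]) auto

lemma path_series_pos: "t > 0 \<Longrightarrow> path_series t x > 0"
proof -
  assume t: "t > 0"
  obtain n where n: "walk n x > 0" using walk_pos by blast
  show "path_series t x > 0"
    unfolding path_series_def
    by (rule suminf_pos2[where i = n, OF sums_summable[OF sums_path_series]]) (use t n in auto)
qed

lemma heat_nonneg [simp]: "t \<ge> 0 \<Longrightarrow> heat t x \<ge> 0"
  by (simp add: heat_eq_path_series path_series_nonneg)

lemma heat_pos: "t > 0 \<Longrightarrow> heat t x > 0"
  by (simp add: heat_eq_path_series path_series_pos)

lemma heat_minus [simp]: "heat t (- x) = heat t (x :: int ^ 'd::finite)"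
  by (simp add: heat_eq_path_series path_series_def)

lemma heat_0: "heat 0 x = delta0 (x :: int ^ 'd::finite)"
proof -
  have "(\<lambda>n. 0 ^ n / fact n * walk n x) sums (walk 0 x)"
    using sums_finite[of "{0}" "\<lambda>n. 0 ^ n / fact n * walk n x"] by simp
  then show ?thesis using sums_unique2[OF sums_path_series[of 0 x]] by (simp add: heat_eq_path_series)
qed

text \<open>Only the term of the path that never moves is kept. The bound makes
  \<open>1 - heat s 0\<close> at most linear in \<open>s\<close>, which is what gives the jump
  kernel finite mass.\<close>

lemma exp_le_heat_0:
  assumes "t \<ge> 0"
  shows "exp (- real (card (uvec :: (int ^ 'd::finite) set)) * t) \<le> heat t (0 :: int ^ 'd)"
proof -
  have "(\<Sum>n\<in>{0}. t ^ n / fact n * walk n (0 :: int ^ 'd)) \<le> path_series t (0 :: int ^ 'd)"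
    unfolding path_series_def using assms
    by (intro sum_le_suminf sums_summable[OF sums_path_series]) auto
  then show ?thesis by (simp add: heat_eq_path_series delta0_def)
qed

lemma has_real_derivative_path_series:
  "((\<lambda>t. path_series t x) has_real_derivative (\<Sum>e\<in>uvec. path_series t (x + e))) (at t)"
proof -
  let ?c = "\<lambda>n. walk n x / fact n"
  have "((\<lambda>t. \<Sum>n. ?c n * t ^ n) has_field_derivative (\<Sum>n. diffs ?c n * t ^ n)) (at t)"
  proof (rule termdiffs_strong_converges_everywhere)
    fix y :: real
    have "(\<lambda>n. ?c n * y ^ n) = (\<lambda>n. y ^ n / fact n * walk n x)" by auto
    then show "summable (\<lambda>n. ?c n * y ^ n)" using sums_summable[OF sums_path_series[of y x]] by (simp only:)
  qed
  moreover have "(\<Sum>n. diffs ?c n * t ^ n) = (\<Sum>e\<in>uvec. path_series t (x + e))"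
  proof -
    have "(\<Sum>e\<in>uvec. path_series t (x + e)) = (\<Sum>n. \<Sum>e\<in>uvec. t ^ n / fact n * walk n (x + e))"
      unfolding path_series_def
      by (intro suminf_sum[symmetric] sums_summable[OF sums_path_series])
    also have "\<dots> = (\<Sum>n. diffs ?c n * t ^ n)"
    proof (rule suminf_cong)
      fix n
      have "diffs ?c n = walk (Suc n) x / fact n"
        by (simp add: diffs_def del: walk.simps of_nat_Suc)
      then show "(\<Sum>e\<in>uvec. t ^ n / fact n * walk n (x + e)) = diffs ?c n * t ^ n"
        by (simp add: sum_distrib_left sum_distrib_right sum_divide_distrib mult_ac)
    qed
    finally show ?thesis by simp
  qed
  ultimately show ?thesis by (simp add: path_series_def mult.commute)
qed

lemma has_real_derivative_heat:
  "((\<lambda>t. heat t x) has_real_derivative (\<Sum>e\<in>uvec. heat t (x + e) - heat t x)) (at t)"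
proof -
  let ?N = "real (card (uvec :: (int ^ 'a) set))"
  have "((\<lambda>t. exp (- ?N * t) * path_series t x) has_real_derivative
      exp (- ?N * t) * (\<Sum>e\<in>uvec. path_series t (x + e)) + exp (- ?N * t) * (- ?N) * path_series t x) (at t)"
    by (rule derivative_eq_intros has_real_derivative_path_series refl)+ (simp add: mult_ac)
  then show ?thesis
    unfolding heat_eq_path_series sum_subtractf sum_distrib_left by (simp add: mult_ac)
qed

lemma continuous_on_heat: "continuous_on A (\<lambda>t. heat t x)"
  by (intro continuous_at_imp_continuous_on ballI DERIV_isCont[OF has_real_derivative_heat])

lemma heat_measurable [measurable]: "(\<lambda>t. heat t x) \<in> borel_measurable borel"
  by (intro borel_measurable_continuous_onI continuous_on_heat)

section \<open>Total mass, semigroup property and maximum of the heat kernel\<close>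

lemma ennreal_path_series:
  "t \<ge> 0 \<Longrightarrow> ennreal (path_series t x) = (\<Sum>n. ennreal (t ^ n / fact n) * ennreal (walk n x))"
proof -
  assume t: "t \<ge> 0"
  have "(\<Sum>n. ennreal (t ^ n / fact n * walk n x)) = ennreal (path_series t x)"
    by (rule suminf_ennreal_eq[OF _ sums_path_series]) (use t in simp)
  moreover have "ennreal (t ^ n / fact n * walk n x) = ennreal (t ^ n / fact n) * ennreal (walk n x)" for n
    by (rule ennreal_mult) (use t in auto)
  ultimately show "ennreal (path_series t x) = (\<Sum>n. ennreal (t ^ n / fact n) * ennreal (walk n x))"
    by simp
qed

lemma nn_integral_heat:
  assumes "t \<ge> 0"
  shows "(\<integral>\<^sup>+x. ennreal (heat t (x :: int ^ 'd::finite)) \<partial>count_space UNIV) = 1"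
proof -
  let ?N = "real (card (uvec :: (int ^ 'd) set))"
  have "(\<integral>\<^sup>+x. ennreal (heat t (x :: int ^ 'd)) \<partial>count_space UNIV)
     = ennreal (exp (- ?N * t)) * (\<Sum>n. ennreal (t ^ n / fact n) * ennreal (?N ^ n))"
    using assms
    by (simp add: heat_eq_path_series ennreal_mult' ennreal_path_series nn_integral_cmult
        nn_integral_suminf nn_integral_walk del: ennreal_power)
  also have "(\<Sum>n. ennreal (t ^ n / fact n) * ennreal (?N ^ n)) = (\<Sum>n. ennreal ((t * ?N) ^ n / fact n))"
    using assms by (simp add: power_mult_distrib flip: ennreal_mult)
  also have "\<dots> = ennreal (exp (t * ?N))"
    using exp_converges[of "t * ?N"] assms
    by (intro suminf_ennreal_eq) (auto simp: divide_inverse mult.commute)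
  also have "ennreal (exp (- ?N * t)) * ennreal (exp (t * ?N)) = 1"
    by (simp add: mult.commute flip: ennreal_mult exp_add)
  finally show ?thesis .
qed

text \<open>Tonelli along antidiagonals. Padding the inner series with zeros below \<open>m\<close>
  lets both indices run over all natural numbers before the sums are exchanged.\<close>

lemma suminf_ennreal_Cauchy:
  fixes g :: "nat \<Rightarrow> nat \<Rightarrow> ennreal"
  shows "(\<Sum>m. \<Sum>n. g m n) = (\<Sum>n. \<Sum>m\<le>n. g m (n - m))"
proof -
  have "(\<Sum>n. g m n) = (\<Sum>n. if m \<le> n then g m (n - m) else 0)" for m
  proof -
    have "(\<lambda>n. (if m \<le> n + m then g m (n + m - m) else 0)) sums (\<Sum>n. g m n)"
      by (simp add: summable_sums)
    moreover have "strict_mono (\<lambda>n. n + m)" by (auto simp: strict_mono_def)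
    moreover have "(if m \<le> n then g m (n - m) else 0) = 0" if "n \<notin> range (\<lambda>n. n + m)" for n
      using that rangeI[of "\<lambda>n. n + m" "n - m"] by (cases "m \<le> n") simp_all
    ultimately have "(\<lambda>n. if m \<le> n then g m (n - m) else 0) sums (\<Sum>n. g m n)"
      using sums_mono_reindex[of "\<lambda>n. n + m" "\<lambda>n. if m \<le> n then g m (n - m) else 0"] by blast
    then show ?thesis by (simp add: sums_iff)
  qed
  then have "(\<Sum>m. \<Sum>n. g m n) = (\<Sum>m. \<Sum>n. if m \<le> n then g m (n - m) else 0)" by simp
  also have "\<dots> = (\<integral>\<^sup>+m. (\<Sum>n. if m \<le> n then g m (n - m) else 0) \<partial>count_space UNIV)"
    by (simp add: nn_integral_count_space_nat)
  also have "\<dots> = (\<Sum>n. \<Sum>m. if m \<le> n then g m (n - m) else 0)"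
    by (subst nn_integral_suminf) (simp_all add: nn_integral_count_space_nat)
  also have "\<dots> = (\<Sum>n. \<Sum>m\<le>n. g m (n - m))"
    by (intro suminf_cong, subst suminf_finite[where N="{..n}" for n]) auto
  finally show ?thesis .
qed

text \<open>The product of the two path series is regrouped by total path length.
  \<open>walk_conv\<close> evaluates the sum over \<open>y\<close>, and the binomial theorem
  collects the coefficients.\<close>

lemma heat_semigroup:
  fixes x :: "int ^ 'd::finite"
  assumes "s \<ge> 0" "t \<ge> 0"
  shows "(\<integral>\<^sup>+y. ennreal (heat s (x - y)) * ennreal (heat t y) \<partial>count_space UNIV) = ennreal (heat (s + t) x)"
proof -
  let ?N = "real (card (uvec :: (int ^ 'd) set))"
  let ?a = "\<lambda>m. ennreal (s ^ m / fact m)" and ?b = "\<lambda>n. ennreal (t ^ n / fact n)"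
  have "(\<integral>\<^sup>+y. ennreal (path_series s (x - y)) * ennreal (path_series t y) \<partial>count_space UNIV)
     = (\<integral>\<^sup>+y. (\<Sum>m. \<Sum>n. ?a m * ?b n * (ennreal (walk m (x - y)) * ennreal (walk n y))) \<partial>count_space UNIV)"
    using assms by (simp add: ennreal_path_series mult_ac flip: ennreal_suminf_cmult ennreal_suminf_multc)
  also have "\<dots> = (\<Sum>m. \<Sum>n. ?a m * ?b n * ennreal (walk (m + n) x))"
    by (simp add: nn_integral_suminf nn_integral_cmult walk_conv)
  also have "\<dots> = (\<Sum>n. \<Sum>m\<le>n. ?a m * ?b (n - m) * ennreal (walk (m + (n - m)) x))"
    by (rule suminf_ennreal_Cauchy)
  also have "\<dots> = (\<Sum>n. ennreal ((s + t) ^ n / fact n) * ennreal (walk n x))"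
  proof (intro suminf_cong)
    fix n
    have "(\<Sum>m\<le>n. s ^ m / fact m * (t ^ (n - m) / fact (n - m))) = (s + t) ^ n / fact n"
      unfolding binomial_ring sum_divide_distrib by (intro sum.cong) (auto simp: binomial_fact)
    then have "ennreal ((s + t) ^ n / fact n) = (\<Sum>m\<le>n. ?a m * ?b (n - m))"
      using assms by (simp add: sum_nonneg flip: ennreal_mult)
    then show "(\<Sum>m\<le>n. ?a m * ?b (n - m) * ennreal (walk (m + (n - m)) x))
      = ennreal ((s + t) ^ n / fact n) * ennreal (walk n x)"
      by (simp add: sum_distrib_right)
  qed
  also have "\<dots> = ennreal (path_series (s + t) x)"
    using assms by (simp add: ennreal_path_series)
  finally have *: "(\<integral>\<^sup>+y. ennreal (path_series s (x - y)) * ennreal (path_series t y) \<partial>count_space UNIV)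
     = ennreal (path_series (s + t) x)" .
  have "(\<integral>\<^sup>+y. ennreal (heat s (x - y)) * ennreal (heat t y) \<partial>count_space UNIV)
     = (\<integral>\<^sup>+y. ennreal (exp (- ?N * s)) * ennreal (exp (- ?N * t)) *
          (ennreal (path_series s (x - y)) * ennreal (path_series t y)) \<partial>count_space UNIV)"
    by (intro nn_integral_cong) (simp add: heat_eq_path_series ennreal_mult path_series_nonneg assms mult_ac)
  also have "\<dots> = ennreal (exp (- ?N * s)) * ennreal (exp (- ?N * t)) * ennreal (path_series (s + t) x)"
    by (simp only: nn_integral_cmult borel_measurable_count_space *)
  also have "\<dots> = ennreal (exp (- ?N * s) * exp (- ?N * t) * path_series (s + t) x)"
    using assms by (simp only: ennreal_mult path_series_nonneg exp_ge_zero add_nonneg_nonneg mult_nonneg_nonneg)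
  also have "exp (- ?N * s) * exp (- ?N * t) = exp (- ?N * (s + t))"
    by (simp add: distrib_left flip: exp_add)
  also have "exp (- ?N * (s + t)) * path_series (s + t) x = heat (s + t) x"
    by (simp only: heat_eq_path_series)
  finally show ?thesis .
qed

lemma heat_le_1:
  assumes "t \<ge> 0" shows "heat t (x :: int ^ 'd::finite) \<le> 1"
proof -
  have "ennreal (heat t x) = (\<integral>\<^sup>+y. ennreal (heat t y) * indicator {x} y \<partial>count_space UNIV)"
    by (simp add: one_ennreal_def[symmetric])
  also have "\<dots> \<le> (\<integral>\<^sup>+y. ennreal (heat t (y :: int ^ 'd)) \<partial>count_space UNIV)"
    by (intro nn_integral_mono) (auto simp: indicator_def)
  also have "\<dots> = 1" by (rule nn_integral_heat[OF assms])
  finally show ?thesis by simp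
qed

text \<open>By the semigroup property \<open>heat t\<close> is the convolution of
  \<open>heat (t / 2)\<close> with itself, and Cauchy-Schwarz bounds it by the squared norm of
  \<open>heat (t / 2)\<close>, which is \<open>heat t 0\<close> by symmetry. As both factors have
  the same norm, \<open>2 * a * b \<le> a^2 + b^2\<close> under the sum is enough.\<close>

lemma heat_le_heat_0:
  assumes "t \<ge> 0" shows "heat t (x :: int ^ 'd::finite) \<le> heat t (0 :: int ^ 'd)"
proof -
  let ?p = "heat (t / 2) :: int ^ 'd \<Rightarrow> real"
  have t: "t / 2 \<ge> 0" using assms by simp
  have diag: "(\<integral>\<^sup>+y. ennreal ((?p y)\<^sup>2) \<partial>count_space UNIV) = ennreal (heat t (0 :: int ^ 'd))"
    using heat_semigroup[OF t t, of "0 :: int ^ 'd"] t by (simp add: power2_eq_square ennreal_mult')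
  have "2 * ennreal (heat t x)
      = (\<integral>\<^sup>+y. 2 * (ennreal (?p (x - y)) * ennreal (?p y)) \<partial>count_space UNIV)"
    using heat_semigroup[OF t t, of x] by (simp add: nn_integral_cmult)
  also have "\<dots> \<le> (\<integral>\<^sup>+y. ennreal ((?p (x - y))\<^sup>2) + ennreal ((?p y)\<^sup>2) \<partial>count_space UNIV)"
  proof (intro nn_integral_mono)
    fix y
    have "2 * (?p (x - y) * ?p y) \<le> (?p (x - y))\<^sup>2 + (?p y)\<^sup>2"
      using sum_squares_bound[of "?p (x - y)" "?p y"] by (simp add: mult.assoc)
    then have "ennreal (2 * (?p (x - y) * ?p y)) \<le> ennreal ((?p (x - y))\<^sup>2 + (?p y)\<^sup>2)"
      by (rule ennreal_leI)
    then show "2 * (ennreal (?p (x - y)) * ennreal (?p y)) \<le> ennreal ((?p (x - y))\<^sup>2) + ennreal ((?p y)\<^sup>2)"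
      using t by (simp add: ennreal_mult' ennreal_plus)
  qed
  also have "\<dots> = ennreal (heat t (0 :: int ^ 'd)) + ennreal (heat t (0 :: int ^ 'd))"
    using nn_integral_count_space_reflect[of "\<lambda>y. ennreal ((?p y)\<^sup>2)" x]
    by (simp add: nn_integral_add diag)
  also have "\<dots> = 2 * ennreal (heat t (0 :: int ^ 'd))" by (simp add: mult_2)
  finally have "ennreal (heat t x) \<le> ennreal (heat t (0 :: int ^ 'd))"
    by (simp add: ennreal_mult_le_mult_iff)
  then show ?thesis using assms by simp
qed

section \<open>On-diagonal decay of the heat kernel\<close>

text \<open>The heat kernel of the integers by Fourier inversion:
  \<open>2 * (1 - cos \<theta>)\<close> is the symbol of the one-dimensional Laplacian.\<close>

definition heat1 :: "real \<Rightarrow> int \<Rightarrow> real" where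
  "heat1 t n = integral {-pi..pi} (\<lambda>\<theta>. exp (- 2 * t * (1 - cos \<theta>)) * cos (of_int n * \<theta>)) / (2 * pi)"

lemma has_real_derivative_heat1:
  "((\<lambda>t. heat1 t n) has_real_derivative heat1 t (n + 1) + heat1 t (n - 1) - 2 * heat1 t n) (at t)"
proof -
  let ?g = "\<lambda>t n \<theta>. exp (- 2 * t * (1 - cos \<theta>)) * cos (of_int n * \<theta>) :: real"
  let ?g' = "\<lambda>t \<theta>. exp (- 2 * t * (1 - cos \<theta>)) * (- 2 * (1 - cos \<theta>)) * cos (of_int n * \<theta>) :: real"
  have int: "?g t m integrable_on {-pi..pi}" for m
    by (intro integrable_continuous_real continuous_intros)
  have "((\<lambda>t. integral (cbox (- pi) pi) (?g t n)) has_field_derivative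
      integral (cbox (- pi) pi) (?g' t)) (at t within UNIV)"
  proof (rule leibniz_rule_field_derivative)
    show "((\<lambda>x. ?g x n \<theta>) has_field_derivative ?g' x \<theta>) (at x within UNIV)" for x \<theta>
      by (auto intro!: derivative_eq_intros)
    show "?g x n integrable_on cbox (- pi) pi" for x
      by (intro integrable_continuous continuous_intros)
    show "continuous_on (UNIV \<times> cbox (- pi) pi) (\<lambda>(x, t). ?g' x t)"
      by (auto simp: case_prod_beta intro!: continuous_intros)
  qed auto
  \<comment> \<open>The product \<open>2 * cos \<theta> * cos (n * \<theta>)\<close> is the sum of
    the cosines with frequencies \<open>n + 1\<close> and \<open>n - 1\<close>, so the symbol acts
    as a second difference in \<open>n\<close>.\<close>
  moreover have "?g' t = (\<lambda>\<theta>. ?g t (n + 1) \<theta> + ?g t (n - 1) \<theta> - 2 * ?g t n \<theta>)"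
    by (auto simp: cos_add cos_diff ring_distribs)
  moreover have "integral (cbox (- pi) pi) (\<lambda>\<theta>. ?g t (n + 1) \<theta> + ?g t (n - 1) \<theta> - 2 * ?g t n \<theta>)
      = integral {-pi..pi} (?g t (n + 1)) + integral {-pi..pi} (?g t (n - 1)) - 2 * integral {-pi..pi} (?g t n)"
    unfolding cbox_interval integral_mult_right[symmetric]
    by (subst integral_diff; (intro integrable_add integrable_on_mult_right int)?)
       (subst integral_add; (intro int)?; simp)
  ultimately have "((\<lambda>t. integral {-pi..pi} (?g t n)) has_real_derivative
      integral {-pi..pi} (?g t (n + 1)) + integral {-pi..pi} (?g t (n - 1)) - 2 * integral {-pi..pi} (?g t n)) (at t)"
    by (simp only: cbox_interval)
  from DERIV_cdivide[OF this, of "2 * pi"] show ?thesis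
    unfolding heat1_def by (simp only: add_divide_distrib diff_divide_distrib times_divide_eq_right)
qed

lemma heat1_0: "heat1 0 n = (if n = 0 then 1 else 0)"
proof (cases "n = 0")
  case False
  have "((\<lambda>\<theta>. cos (of_int n * \<theta>)) has_integral sin (of_int n * pi) / of_int n - sin (of_int n * - pi) / of_int n) {-pi..pi}"
    using False by (intro fundamental_theorem_of_calculus)
      (auto intro!: derivative_eq_intros simp flip: has_real_derivative_iff_has_vector_derivative)
  then show ?thesis using False by (simp add: heat1_def has_integral_iff sin_npi_int mult.commute[of _ pi])
qed (simp add: heat1_def)

lemma abs_heat1_le_1:
  assumes "t \<ge> 0" shows "\<bar>heat1 t n\<bar> \<le> 1"
proof -
  let ?g = "\<lambda>\<theta>. exp (- 2 * t * (1 - cos \<theta>)) * cos (of_int n * \<theta>)"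
  have "norm (integral {-pi..pi} ?g) \<le> integral {-pi..pi} (\<lambda>_. 1)"
  proof (rule integral_norm_bound_integral)
    show "?g integrable_on {-pi..pi}" by (intro integrable_continuous_real continuous_intros)
    show "norm (?g \<theta>) \<le> 1" if "\<theta> \<in> {-pi..pi}" for \<theta>
      unfolding norm_mult using assms
      by (intro mult_le_one) (auto simp: mult_nonneg_nonneg)
  qed (intro integrable_continuous_real continuous_intros)
  then show ?thesis by (simp add: heat1_def)
qed

text \<open>Iterating the equation bounds the difference by the terms of an exponential series.\<close>
lemma heat_equation_unique:
  fixes f g :: "real \<Rightarrow> int ^ 'd::finite \<Rightarrow> real"
  assumes f': "\<And>t x. ((\<lambda>t. f t x) has_real_derivative (\<Sum>e\<in>uvec. f t (x + e) - f t x)) (at t)"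
    and g': "\<And>t x. ((\<lambda>t. g t x) has_real_derivative (\<Sum>e\<in>uvec. g t (x + e) - g t x)) (at t)"
    and bd: "\<And>t x. t \<ge> 0 \<Longrightarrow> \<bar>f t x - g t x\<bar> \<le> C"
    and init: "\<And>x. f 0 x = g 0 x" and "t \<ge> 0"
  shows "f t x = g t x"
proof -
  \<comment> \<open>Twice the number of neighbours bounds the norm of the Laplacian on bounded
    functions.\<close>
  define N where "N = 2 * real (card (uvec :: (int ^ 'd) set))"
  let ?h = "\<lambda>t x. f t x - g t x"
  have h': "((\<lambda>t. ?h t x) has_real_derivative (\<Sum>e\<in>uvec. ?h t (x + e) - ?h t x)) (at t)" for t x
    using DERIV_diff[OF f'[of x t] g'[of x t]] by (simp add: sum_subtractf[symmetric] algebra_simps)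
  have key: "\<bar>?h t x\<bar> \<le> C * (N * t) ^ n / fact n" if "t \<ge> 0" for n t x
    using that
  proof (induction n arbitrary: t x)
    case 0
    then show ?case using bd by simp
  next
    case (Suc n)
    let ?B = "\<lambda>s. C * (N * s) ^ Suc n / fact (Suc n)"
    have B': "(?B has_real_derivative N * (C * (N * s) ^ n / fact n)) (at s)" for s
    proof -
      have "((\<lambda>s. (N * s) ^ Suc n) has_real_derivative real (Suc n) * (N * s) ^ n * N) (at s)"
        using DERIV_power[OF DERIV_cmult[OF DERIV_ident, of N s UNIV], of "Suc n"] by (simp add: mult_ac)
      from DERIV_cmult[OF this, of "C / fact (Suc n)"] show ?thesis
        by (simp add: mult_ac del: power_Suc of_nat_Suc)
    qed
    have h'_bd: "\<bar>\<Sum>e\<in>uvec. ?h s (x + e) - ?h s x\<bar> \<le> N * (C * (N * s) ^ n / fact n)" if "s \<ge> 0" for s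
    proof -
      have "\<bar>\<Sum>e\<in>uvec. ?h s (x + e) - ?h s x\<bar> \<le> (\<Sum>e\<in>uvec. \<bar>?h s (x + e)\<bar> + \<bar>?h s x\<bar>)"
        by (rule order.trans[OF sum_abs]) (intro sum_mono abs_triangle_ineq4)
      also have "\<dots> \<le> (\<Sum>e\<in>(uvec :: (int ^ 'd) set). C * (N * s) ^ n / fact n + C * (N * s) ^ n / fact n)"
        by (intro sum_mono add_mono Suc.IH that)
      finally show ?thesis by (simp add: N_def mult_ac)
    qed
    \<comment> \<open>The derivative of \<open>?B\<close> dominates that of \<open>?h\<close> in
      absolute value, and both functions vanish at time 0. The two values of \<open>c\<close> give
      the two halves of the bound on the absolute value.\<close>
    have mono: "?B 0 - c * ?h 0 x \<le> ?B t - c * ?h t x" if c: "c = 1 \<or> c = -1" for c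
    proof (rule DERIV_nonneg_imp_nondecreasing[OF Suc.prems])
      fix s assume s: "0 \<le> s" "s \<le> t"
      have "((\<lambda>s. ?B s - c * ?h s x) has_real_derivative
          N * (C * (N * s) ^ n / fact n) - c * (\<Sum>e\<in>uvec. ?h s (x + e) - ?h s x)) (at s)"
        by (intro DERIV_diff B' DERIV_cmult h')
      moreover have "N * (C * (N * s) ^ n / fact n) - c * (\<Sum>e\<in>uvec. ?h s (x + e) - ?h s x) \<ge> 0"
        using h'_bd[OF s(1)] c by auto
      ultimately show "\<exists>y. ((\<lambda>s. ?B s - c * ?h s x) has_real_derivative y) (at s) \<and> 0 \<le> y" by blast
    qed
    from mono[of 1] mono[of "-1"] show ?case by (simp add: init abs_le_iff)
  qed
  have "(\<lambda>n. inverse (fact n) * (N * t) ^ n) \<longlonglongrightarrow> 0"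
    by (intro summable_LIMSEQ_zero summable_exp)
  from tendsto_mult_right[OF this, of C] have "(\<lambda>n. C * (N * t) ^ n / fact n) \<longlonglongrightarrow> 0"
    by (simp add: divide_inverse mult_ac)
  then have "\<bar>?h t x\<bar> \<le> 0"
    by (rule Lim_bounded2[OF _ ]) (use key[OF \<open>t \<ge> 0\<close>] in auto)
  then show ?thesis by simp
qed

text \<open>Both sides solve the heat equation with initial value \<open>delta0\<close>, since a
  step along one axis changes a single factor of the product. Each side is at most 1 in absolute
  value, so their difference is bounded by 2 and uniqueness applies.\<close>

lemma heat_eq_prod:
  fixes x :: "int ^ 'd::finite"
  assumes "t \<ge> 0"
  shows "heat t x = (\<Prod>i\<in>UNIV. heat1 t (x $ i))"
proof (rule heat_equation_unique[where f = heat and C = 2])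
  fix t :: real and x :: "int ^ 'd"
  have upd: "(\<Prod>j\<in>UNIV. heat1 t ((x + axis i c) $ j))
      = heat1 t (x $ i + c) * (\<Prod>j\<in>UNIV - {i}. heat1 t (x $ j))" for i c
    by (subst prod.remove[of _ i]) (auto simp: axis_def intro!: prod.cong)
  have upd0: "(\<Prod>j\<in>UNIV. heat1 t (x $ j)) = heat1 t (x $ i) * (\<Prod>j\<in>UNIV - {i}. heat1 t (x $ j))" for i
    by (subst prod.remove[of _ i]) auto
  have eq: "(\<Sum>e\<in>uvec. (\<Prod>i\<in>UNIV. heat1 t ((x + e) $ i)) - (\<Prod>i\<in>UNIV. heat1 t (x $ i)))
    = (\<Sum>i\<in>UNIV. (heat1 t (x $ i + 1) + heat1 t (x $ i - 1) - 2 * heat1 t (x $ i)) *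
         (\<Prod>j\<in>UNIV - {i}. heat1 t (x $ j)))"
    unfolding sum_uvec upd
  proof (rule sum.cong[OF refl])
    fix i
    show "heat1 t (x $ i + 1) * (\<Prod>j\<in>UNIV - {i}. heat1 t (x $ j)) - (\<Prod>j\<in>UNIV. heat1 t (x $ j)) +
        (heat1 t (x $ i + - 1) * (\<Prod>j\<in>UNIV - {i}. heat1 t (x $ j)) - (\<Prod>j\<in>UNIV. heat1 t (x $ j)))
      = (heat1 t (x $ i + 1) + heat1 t (x $ i - 1) - 2 * heat1 t (x $ i)) * (\<Prod>j\<in>UNIV - {i}. heat1 t (x $ j))"
      unfolding upd0[of i] by (simp add: algebra_simps)
  qed
  show "((\<lambda>t. \<Prod>i\<in>UNIV. heat1 t (x $ i)) has_real_derivative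
      (\<Sum>e\<in>uvec. (\<Prod>i\<in>UNIV. heat1 t ((x + e) $ i)) - (\<Prod>i\<in>UNIV. heat1 t (x $ i)))) (at t)"
    unfolding eq by (intro has_field_derivative_prod has_real_derivative_heat1)
next
  fix t :: real and x :: "int ^ 'd"
  assume t: "t \<ge> 0"
  have "\<bar>\<Prod>i\<in>UNIV. heat1 t (x $ i)\<bar> \<le> 1"
    unfolding abs_prod using abs_heat1_le_1[OF t] by (intro prod_le_1) auto
  moreover have "\<bar>heat t x\<bar> \<le> 1" using heat_le_1[OF t, of x] t by simp
  ultimately show "\<bar>heat t x - (\<Prod>i\<in>UNIV. heat1 t (x $ i))\<bar> \<le> 2" by linarith
next
  fix x :: "int ^ 'd"
  show "heat 0 x = (\<Prod>i\<in>UNIV. heat1 0 (x $ i))"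
    by (auto simp: heat_0 delta0_def heat1_0 vec_eq_iff)
qed (use assms has_real_derivative_heat in auto)

section \<open>Size of the one-dimensional kernel at the origin\<close>

lemma one_minus_cos_eq: "1 - cos \<theta> = 2 * (sin (\<theta> / 2))\<^sup>2" for \<theta> :: real
  using cos_double_sin[of "\<theta> / 2"] by simp

lemma one_minus_cos_le: "1 - cos \<theta> \<le> \<theta>\<^sup>2 / 2" for \<theta> :: real
  using power_mono[OF abs_sin_x_le_abs_x[of "\<theta> / 2"], of 2]
  by (simp add: one_minus_cos_eq power_divide)

text \<open>For \<open>y = \<bar>\<theta>\<bar> / 2\<close>, which is at most 2, the cubic Taylor
  bound gives \<open>sin y \<ge> y - 2 * y / 3\<close>, weakened to \<open>y / 4\<close>. Then
  \<open>2 * (y / 4)^2\<close> is \<theta> squared over 32.\<close>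

lemma one_minus_cos_ge:
  fixes \<theta> :: real
  assumes "\<bar>\<theta>\<bar> \<le> pi"
  shows "1 - cos \<theta> \<ge> \<theta>\<^sup>2 / 32"
proof -
  define y where "y = \<bar>\<theta> / 2\<bar>"
  have y: "0 \<le> y" "y \<le> 2" using assms pi_less_4 by (auto simp: y_def)
  have "\<bar>sin y - (\<Sum>m<3. sin_coeff m * y ^ m)\<bar> \<le> inverse (fact 3) * \<bar>y\<bar> ^ 3"
    by (rule Maclaurin_sin_bound)
  moreover have "(\<Sum>m<3. sin_coeff m * y ^ m) = y"
    by (simp add: numeral_3_eq_3 sin_coeff_def)
  moreover have "\<bar>y\<bar> ^ 3 \<le> 4 * y"
    using y mult_mono[of y 2 y 2] mult_right_mono[of "y * y" 4 y]
    by (simp add: power3_eq_cube)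
  moreover have "inverse (fact 3) = (1 / 6 :: real)" by (simp add: fact_numeral)
  ultimately have "\<bar>sin y - y\<bar> \<le> 1 / 6 * (4 * y)" by simp
  then have "sin y \<ge> y / 4" using y by linarith
  then have "(y / 4)\<^sup>2 \<le> (sin y)\<^sup>2" using y by (intro power_mono) auto
  moreover have "(sin y)\<^sup>2 = (sin (\<theta> / 2))\<^sup>2" by (auto simp: y_def abs_if)
  ultimately show ?thesis by (simp add: one_minus_cos_eq y_def power_divide)
qed

text \<open>A Gaussian bound on the integrand is relaxed to
  \<open>1 / (1 + (a * \<theta>)^2)\<close>, whose primitive is an arctangent. Estimating the
  arctangent by \<open>pi\<close> leaves \<open>1 / a\<close>.\<close>

lemma heat1_0_upper:
  assumes "t > 0"
  shows "heat1 t 0 \<le> 4 / sqrt t"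
proof -
  \<comment> \<open>Chosen so that \<open>a^2 = 2 * t / 32\<close>, with the 32 of
    \<open>one_minus_cos_ge\<close>.\<close>
  define a where "a = sqrt t / 4"
  have a: "a > 0" using assms by (simp add: a_def)
  have a2: "a\<^sup>2 = t / 16" using assms by (simp add: a_def power_divide)
  have "((\<lambda>\<theta>. arctan (a * \<theta>) / a) has_real_derivative 1 / (1 + (a * \<theta>)\<^sup>2)) (at \<theta> within S)" for \<theta> S
  proof -
    have "((\<lambda>\<theta>. arctan (a * \<theta>)) has_real_derivative inverse (1 + (a * \<theta>)\<^sup>2) * a) (at \<theta> within S)"
      by (auto intro!: derivative_eq_intros)
    from DERIV_cdivide[OF this, of a] a show ?thesis by (simp add: inverse_eq_divide)
  qed
  then have "((\<lambda>\<theta>. 1 / (1 + (a * \<theta>)\<^sup>2)) has_integral arctan (a * pi) / a - arctan (a * - pi) / a) {-pi..pi}"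
    by (intro fundamental_theorem_of_calculus) (simp_all flip: has_real_derivative_iff_has_vector_derivative)
  then have I: "((\<lambda>\<theta>. 1 / (1 + (a * \<theta>)\<^sup>2)) has_integral 2 * arctan (a * pi) / a) {-pi..pi}"
    by (simp add: arctan_minus)
  have "integral {-pi..pi} (\<lambda>\<theta>. exp (- 2 * t * (1 - cos \<theta>)) * cos (of_int 0 * \<theta>))
      \<le> integral {-pi..pi} (\<lambda>\<theta>. 1 / (1 + (a * \<theta>)\<^sup>2))"
  proof (rule integral_le)
    fix \<theta> assume "\<theta> \<in> {-pi..pi}"
    then have "\<theta>\<^sup>2 / 32 \<le> 1 - cos \<theta>" by (intro one_minus_cos_ge) auto
    then have "2 * t * (\<theta>\<^sup>2 / 32) \<le> 2 * t * (1 - cos \<theta>)"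
      using assms by (intro mult_left_mono) auto
    then have "(a * \<theta>)\<^sup>2 \<le> 2 * t * (1 - cos \<theta>)"
      by (simp add: power_mult_distrib a2)
    then have "1 + (a * \<theta>)\<^sup>2 \<le> exp (2 * t * (1 - cos \<theta>))"
      using exp_ge_add_one_self[of "2 * t * (1 - cos \<theta>)"] by linarith
    then have "inverse (exp (2 * t * (1 - cos \<theta>))) \<le> inverse (1 + (a * \<theta>)\<^sup>2)"
      by (intro le_imp_inverse_le) (auto intro: add_pos_nonneg)
    then show "exp (- 2 * t * (1 - cos \<theta>)) * cos (of_int 0 * \<theta>) \<le> 1 / (1 + (a * \<theta>)\<^sup>2)"
      by (simp add: exp_minus[symmetric] divide_inverse)
  qed (use I in \<open>auto intro!: integrable_continuous_real continuous_intros simp: has_integral_iff\<close>)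
  also have "\<dots> = 2 * arctan (a * pi) / a" using I by (rule integral_unique)
  also have "\<dots> \<le> 2 * pi / a"
  proof (rule divide_right_mono)
    show "2 * arctan (a * pi) \<le> 2 * pi" using arctan_ubound[of "a * pi"] pi_gt_zero by linarith
  qed (use a in simp)
  finally show ?thesis by (simp add: heat1_def a_def field_simps)
qed

text \<open>The integrand is positive, so the integral may be restricted to
  \<open>\<bar>\<theta>\<bar> \<le> 1 / sqrt t\<close>, where the exponent is at least -1. For
  \<open>t \<ge> 1\<close> this interval lies inside \<open>{-pi..pi}\<close>.\<close>

lemma heat1_0_lower:
  assumes "t \<ge> 1"
  shows "heat1 t 0 \<ge> exp (-1) / (pi * sqrt t)"
proof -
  let ?r = "1 / sqrt t"
  have r: "0 < ?r" "?r \<le> pi"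
  proof -
    show "0 < ?r" using assms by simp
    have "?r \<le> 1" using assms by simp
    then show "?r \<le> pi" using pi_gt3 by linarith
  qed
  have "2 * ?r * exp (-1) = integral {-?r..?r} (\<lambda>\<theta>. exp (-1 :: real))"
    using r by simp
  also have "\<dots> \<le> integral {-?r..?r} (\<lambda>\<theta>. exp (- 2 * t * (1 - cos \<theta>)) * cos (of_int 0 * \<theta>))"
  proof (rule integral_le)
    fix \<theta> assume "\<theta> \<in> {-?r..?r}"
    then have "\<bar>\<theta>\<bar> \<le> ?r" by auto
    then have "\<theta>\<^sup>2 \<le> ?r\<^sup>2" by (rule abs_le_square_iff[THEN iffD1, OF order.trans]) (use r in auto)
    then have "t * \<theta>\<^sup>2 \<le> 1" using assms by (simp add: power_divide field_simps)
    moreover have "2 * t * (1 - cos \<theta>) \<le> 2 * t * (\<theta>\<^sup>2 / 2)"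
      using assms by (intro mult_left_mono one_minus_cos_le) auto
    ultimately show "exp (-1) \<le> exp (- 2 * t * (1 - cos \<theta>)) * cos (of_int 0 * \<theta>)"
      by simp
  qed (auto intro!: integrable_continuous_real continuous_intros)
  also have "\<dots> \<le> integral {-pi..pi} (\<lambda>\<theta>. exp (- 2 * t * (1 - cos \<theta>)) * cos (of_int 0 * \<theta>))"
    using r by (intro integral_subset_le integrable_continuous_real continuous_intros) auto
  finally have "2 * ?r * exp (-1) / (2 * pi) \<le> heat1 t 0"
    unfolding heat1_def by (intro divide_right_mono) auto
  then show ?thesis by (simp add: field_simps)
qed

lemma sqrt_power_eq_powr: "t > 0 \<Longrightarrow> sqrt t ^ n = t powr (real n / 2)"
  by (simp add: powr_half_sqrt[symmetric] powr_powr flip: powr_realpow)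

lemma heat_0_upper:
  obtains C where "C > 0" "\<And>t. t > 0 \<Longrightarrow> heat t (0 :: int ^ 'd::finite) \<le> C * t powr (- (real CARD('d) / 2))"
proof
  show "(4 :: real) ^ CARD('d) > 0" by simp
  fix t :: real assume t: "t > 0"
  have nn: "0 \<le> heat1 t 0" unfolding heat1_def
    by (intro divide_nonneg_pos integral_nonneg integrable_continuous_real continuous_intros) auto
  have "heat t (0 :: int ^ 'd) = heat1 t 0 ^ CARD('d)"
    using t by (simp add: heat_eq_prod)
  also have "\<dots> \<le> (4 / sqrt t) ^ CARD('d)"
    by (intro power_mono heat1_0_upper t nn)
  finally show "heat t (0 :: int ^ 'd) \<le> 4 ^ CARD('d) * t powr (- (real CARD('d) / 2))"
    using t by (simp add: power_divide sqrt_power_eq_powr powr_minus_divide)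
qed

lemma heat_0_lower:
  obtains c where "c > 0" "\<And>t. t \<ge> 1 \<Longrightarrow> heat t (0 :: int ^ 'd::finite) \<ge> c * t powr (- (real CARD('d) / 2))"
proof
  show "(exp (-1) / pi) ^ CARD('d) > 0" by simp
  fix t :: real assume t: "t \<ge> 1"
  have "(exp (-1) / (pi * sqrt t)) ^ CARD('d) \<le> heat1 t 0 ^ CARD('d)"
    using t by (intro power_mono heat1_0_lower) auto
  also have "\<dots> = heat t (0 :: int ^ 'd)"
    using t by (simp add: heat_eq_prod)
  finally show "(exp (-1) / pi) ^ CARD('d) * t powr (- (real CARD('d) / 2)) \<le> heat t (0 :: int ^ 'd)"
    using t by (simp add: power_divide power_mult_distrib sqrt_power_eq_powr powr_minus_divide)
qed

section \<open>Ground states and criticality\<close>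

lemma liminf_add_le_ennreal:
  fixes a b :: "nat \<Rightarrow> ennreal"
  shows "liminf a + liminf b \<le> liminf (\<lambda>n. a n + b n)"
proof -
  have "liminf a + liminf b = (SUP n. (INF m\<in>{n..}. a m) + (INF m\<in>{n..}. b m))"
    unfolding liminf_SUP_INF
    by (intro ennreal_SUP_add[symmetric]) (auto simp: incseq_def intro!: INF_superset_mono)
  also have "\<dots> \<le> (SUP n. INF m\<in>{n..}. a m + b m)"
    by (intro SUP_mono' INF_greatest add_mono INF_lower)
  finally show ?thesis by (simp add: liminf_SUP_INF)
qed

lemma square_add_le:
  fixes a b \<epsilon> :: real
  assumes "\<epsilon> > 0"
  shows "(a + b)\<^sup>2 \<le> (1 + \<epsilon>) * a\<^sup>2 + (1 + 1 / \<epsilon>) * b\<^sup>2"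
proof -
  have "0 \<le> (\<epsilon> * a - b)\<^sup>2 / \<epsilon>" using assms by simp
  also have "\<dots> = \<epsilon> * a\<^sup>2 - 2 * a * b + b\<^sup>2 / \<epsilon>"
    using assms by (simp add: power2_eq_square field_simps)
  finally show ?thesis by (simp add: power2_sum algebra_simps)
qed

lemma ennreal_mult_2_divide_2: "2 * (a :: ennreal) / 2 = a"
  using mult_divide_eq_ennreal[of 2 a] by (simp add: mult.commute)

lemma ennreal_divide_2_mult_2: "2 * (a / 2) = (a :: ennreal)"
  by (simp add: ennreal_times_divide ennreal_mult_2_divide_2)

lemma tendsto_0_le_ennreal:
  fixes f g :: "'a \<Rightarrow> ennreal"
  assumes "(g \<longlongrightarrow> 0) F" "\<And>x. f x \<le> g x"
  shows "(f \<longlongrightarrow> 0) F"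
  using assms by (intro tendsto_sandwich[OF _ _ tendsto_const assms(1)]) auto

lemma tendsto_ennreal_square_0:
  assumes "((\<lambda>n. ennreal ((f n)\<^sup>2)) \<longlongrightarrow> 0) F"
  shows "(f \<longlongrightarrow> 0) F"
proof -
  have "((\<lambda>n. (f n)\<^sup>2) \<longlongrightarrow> 0) F"
    by (rule tendsto_ennrealD) (use assms in auto)
  from tendsto_real_sqrt[OF this] have "((\<lambda>n. \<bar>f n\<bar>) \<longlongrightarrow> 0) F" by simp
  then show ?thesis by (simp add: tendsto_rabs_zero_iff)
qed

lemma nn_integral_count_space_ge:
  fixes f :: "'a \<Rightarrow> ennreal"
  shows "f a \<le> (\<integral>\<^sup>+x. f x \<partial>count_space UNIV)"
proof -
  have "f a = (\<integral>\<^sup>+x. f a * indicator {a} x \<partial>count_space UNIV)"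
    by (simp add: one_ennreal_def[symmetric])
  also have "\<dots> \<le> (\<integral>\<^sup>+x. f x \<partial>count_space UNIV)"
    by (intro nn_integral_mono) (auto simp: indicator_def)
  finally show ?thesis .
qed

lemma nn_integral_count_space_finite_support:
  fixes f :: "'a \<Rightarrow> ennreal"
  assumes "finite {x. f x \<noteq> 0}" "\<And>x. f x < top"
  shows "(\<integral>\<^sup>+x. f x \<partial>count_space UNIV) < top"
  using assms by (subst nn_integral_count_space'[of "{x. f x \<noteq> 0}"]) auto

lemma nn_integral_count_space_swap:
  fixes f :: "'a \<Rightarrow> 'b \<Rightarrow> ennreal"
  shows "(\<integral>\<^sup>+x. \<integral>\<^sup>+y. f x y \<partial>count_space UNIV \<partial>count_space UNIV)
    = (\<integral>\<^sup>+y. \<integral>\<^sup>+x. f x y \<partial>count_space UNIV \<partial>count_space UNIV)"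
  using nn_integral_fst_count_space[of "\<lambda>(x, y). f x y"] nn_integral_snd_count_space[of "\<lambda>(x, y). f x y"]
  by simp

lemma nn_integral_count_space_liminf2:
  fixes f :: "nat \<Rightarrow> 'a \<Rightarrow> 'b \<Rightarrow> ennreal"
  assumes "\<And>x y. (\<lambda>n. f n x y) \<longlonglongrightarrow> g x y"
  shows "(\<integral>\<^sup>+x. \<integral>\<^sup>+y. g x y \<partial>count_space UNIV \<partial>count_space UNIV)
    \<le> liminf (\<lambda>n. \<integral>\<^sup>+x. \<integral>\<^sup>+y. f n x y \<partial>count_space UNIV \<partial>count_space UNIV)"
proof -
  have "g x y = liminf (\<lambda>n. f n x y)" for x y
    using lim_imp_Liminf[OF _ assms] by simp
  then have "(\<integral>\<^sup>+x. \<integral>\<^sup>+y. g x y \<partial>count_space UNIV \<partial>count_space UNIV)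
      \<le> (\<integral>\<^sup>+x. liminf (\<lambda>n. \<integral>\<^sup>+y. f n x y \<partial>count_space UNIV) \<partial>count_space UNIV)"
    by (auto intro!: nn_integral_mono nn_integral_liminf)
  also have "\<dots> \<le> liminf (\<lambda>n. \<integral>\<^sup>+x. \<integral>\<^sup>+y. f n x y \<partial>count_space UNIV \<partial>count_space UNIV)"
    by (rule nn_integral_liminf) simp
  finally show ?thesis .
qed

lemma wsum_liminf:
  assumes "\<And>x. (\<lambda>n. \<phi> n x) \<longlonglongrightarrow> f x"
  shows "wsum w f \<le> liminf (\<lambda>n. wsum w (\<phi> n))"
proof -
  have "(\<lambda>n. ennreal (w x * (\<phi> n x)\<^sup>2)) \<longlonglongrightarrow> ennreal (w x * (f x)\<^sup>2)" for x
    by (intro tendsto_ennrealI tendsto_intros assms)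
  then have "ennreal (w x * (f x)\<^sup>2) = liminf (\<lambda>n. ennreal (w x * (\<phi> n x)\<^sup>2))" for x
    using lim_imp_Liminf[OF sequentially_bot] by metis
  then show ?thesis unfolding wsum_def by (simp add: nn_integral_liminf)
qed

text \<open>\<open>potential_eq\<close> says that the operator with jump kernel
  \<open>kappa \<sigma>\<close> maps \<open>u\<close> to \<open>m\<close>, with the convolution
  moved to the left. \<open>superlevel_finite\<close> expresses that \<open>u\<close> vanishes at
  infinity and will make its truncations finitely supported; \<open>kappa_uvec\<close> provides the
  connectedness. Both the case \<sigma> = 1 and the case \<sigma> < 1 are instances.\<close>

locale ground_state =
  fixes \<sigma> :: real and u m :: "int ^ 'd::finite \<Rightarrow> real" and K :: real
  assumes kappa_nonneg: "\<And>z :: int ^ 'd. kappa \<sigma> z \<ge> 0"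
    and kappa_sym: "\<And>z :: int ^ 'd. kappa \<sigma> (- z) = kappa \<sigma> z"
    and kappa_sum: "(\<integral>\<^sup>+z. ennreal (kappa \<sigma> (z :: int ^ 'd)) \<partial>count_space UNIV) = ennreal K"
    and kappa_uvec: "\<And>e :: int ^ 'd. e \<in> uvec \<Longrightarrow> kappa \<sigma> e > 0"
    and u_pos: "\<And>x. u x > 0"
    and m_pos: "\<And>x. m x > 0"
    and superlevel_finite: "\<And>\<epsilon>. \<epsilon> > 0 \<Longrightarrow> finite {x. u x > \<epsilon>}"
    and potential_eq: "\<And>x. (\<integral>\<^sup>+y. ennreal (kappa \<sigma> (x - y)) * ennreal (u y) \<partial>count_space UNIV)
           + ennreal (m x) = ennreal K * ennreal (u x)"
begin

lemma u_neq_0: "u x \<noteq> 0"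
  using u_pos[of x] by simp

abbreviation weight :: "int ^ 'd \<Rightarrow> real" where "weight x \<equiv> m x / u x"

definition dbl :: "(int ^ 'd \<Rightarrow> int ^ 'd \<Rightarrow> ennreal) \<Rightarrow> ennreal" where
  "dbl F = (\<integral>\<^sup>+x. \<integral>\<^sup>+y. ennreal (kappa \<sigma> (x - y)) * F x y \<partial>count_space UNIV \<partial>count_space UNIV)"

lemma dbl_add: "dbl (\<lambda>x y. F x y + G x y) = dbl F + dbl G"
  by (simp add: dbl_def distrib_left nn_integral_add)

lemma dbl_cmult: "dbl (\<lambda>x y. c * F x y) = c * dbl F"
  by (simp add: dbl_def nn_integral_cmult mult.left_commute)

lemma dbl_mono: "(\<And>x y. F x y \<le> G x y) \<Longrightarrow> dbl F \<le> dbl G"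
  unfolding dbl_def by (intro nn_integral_mono mult_left_mono) auto

lemma dbl_swap: "dbl (\<lambda>x y. F y x) = dbl F"
proof -
  have sym: "kappa \<sigma> (y - x) = kappa \<sigma> (x - y)" for x y :: "int ^ 'd"
    using kappa_sym[of "x - y"] by simp
  have "dbl (\<lambda>x y. F y x)
     = (\<integral>\<^sup>+y. \<integral>\<^sup>+x. ennreal (kappa \<sigma> (x - y)) * F y x \<partial>count_space UNIV \<partial>count_space UNIV)"
    unfolding dbl_def by (rule nn_integral_count_space_swap)
  also have "\<dots> = dbl F"
    unfolding dbl_def by (simp only: sym)
  finally show ?thesis .
qed

lemma dbl_fst: "dbl (\<lambda>x y. F x) = ennreal K * (\<integral>\<^sup>+x. F x \<partial>count_space UNIV)"
  using nn_integral_count_space_reflect[of "\<lambda>z :: int ^ 'd. ennreal (kappa \<sigma> z)"]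
  by (simp add: dbl_def nn_integral_multc nn_integral_cmult kappa_sum)

text \<open>The equation for \<open>u\<close> paired with \<open>g\<close>. It is applied to
  \<open>g = \<phi>^2 / u\<close>, which gives the ground state representation, and to a truncation
  of \<open>u\<close>, which gives the energy bound.\<close>

lemma dbl_potential:
  assumes "\<And>x. g x \<ge> 0"
  shows "dbl (\<lambda>x y. ennreal (g x * u y)) + (\<integral>\<^sup>+x. ennreal (g x * m x) \<partial>count_space UNIV)
    = ennreal K * (\<integral>\<^sup>+x. ennreal (g x * u x) \<partial>count_space UNIV)"
proof -
  have nn: "0 \<le> u x" "0 \<le> m x" for x using u_pos[of x] m_pos[of x] by simp_all
  have "dbl (\<lambda>x y. ennreal (g x * u y)) + (\<integral>\<^sup>+x. ennreal (g x * m x) \<partial>count_space UNIV)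
    = (\<integral>\<^sup>+x. ennreal (g x) * ((\<integral>\<^sup>+y. ennreal (kappa \<sigma> (x - y)) * ennreal (u y) \<partial>count_space UNIV)
        + ennreal (m x)) \<partial>count_space UNIV)"
    using assms nn by (simp add: dbl_def ennreal_mult mult.left_commute nn_integral_cmult distrib_left nn_integral_add)
  also have "\<dots> = ennreal K * (\<integral>\<^sup>+x. ennreal (g x * u x) \<partial>count_space UNIV)"
    using assms nn by (simp add: potential_eq ennreal_mult mult.left_commute nn_integral_cmult)
  finally show ?thesis .
qed

lemma Qform_eq_dbl: "Qform \<sigma> f = dbl (\<lambda>x y. ennreal ((f x - f y)\<^sup>2)) / 2"
  by (simp add: Qform_def dbl_def ennreal_mult kappa_nonneg)

definition residual :: "(int ^ 'd \<Rightarrow> real) \<Rightarrow> ennreal" where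
  "residual f = dbl (\<lambda>x y. ennreal (u x * u y * (f x / u x - f y / u y)\<^sup>2)) / 2"

text \<open>All terms are moved to the side on which they are nonnegative, so that the identity
  can be summed in the extended nonnegative reals.\<close>
lemma ground_state_representation:
  assumes fin: "(\<integral>\<^sup>+x. ennreal ((\<phi> x)\<^sup>2) \<partial>count_space UNIV) < top"
  shows "Qform \<sigma> \<phi> = residual \<phi> + wsum weight \<phi>"
proof -
  define g where "g x = (\<phi> x)\<^sup>2 / u x" for x
  define D where "D = dbl (\<lambda>x y. ennreal ((\<phi> x - \<phi> y)\<^sup>2))"
  define E where "E = dbl (\<lambda>x y. ennreal (u x * u y * (\<phi> x / u x - \<phi> y / u y)\<^sup>2))"
  define A where "A = dbl (\<lambda>x y. ennreal (g x * u y))"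
  define W where "W = wsum weight \<phi>"
  have g: "g x \<ge> 0" for x using u_pos[of x] by (simp add: g_def)
  have u0: "u x \<noteq> 0" "0 \<le> u x" for x using u_pos[of x] by simp_all
  have "W = (\<integral>\<^sup>+x. ennreal (g x * m x) \<partial>count_space UNIV)"
    by (simp add: W_def wsum_def g_def mult.commute)
  moreover have "(\<integral>\<^sup>+x. ennreal (g x * u x) \<partial>count_space UNIV) = (\<integral>\<^sup>+x. ennreal ((\<phi> x)\<^sup>2) \<partial>count_space UNIV)"
    using u0 by (simp add: g_def)
  ultimately have AW: "A + W = ennreal K * (\<integral>\<^sup>+x. ennreal ((\<phi> x)\<^sup>2) \<partial>count_space UNIV)"
    using dbl_potential[of g, OF g] by (simp add: A_def)
  \<comment> \<open>Square summability enters here: it makes \<open>A\<close> finite, so that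
    \<open>A + A\<close> can be cancelled at the end.\<close>
  then have "A + W < top" using fin by (simp add: ennreal_mult_less_top)
  then have A: "A \<noteq> top" by auto
  \<comment> \<open>Expanding the weighted square gives
    \<open>g x * u y + g y * u x - 2 * \<phi> x * \<phi> y\<close>; its mixed term is that of the
    plain square on the left.\<close>
  have pt: "ennreal ((\<phi> x - \<phi> y)\<^sup>2) + (ennreal (g x * u y) + ennreal (g y * u x))
      = ennreal (u x * u y * (\<phi> x / u x - \<phi> y / u y)\<^sup>2) + (ennreal ((\<phi> x)\<^sup>2) + ennreal ((\<phi> y)\<^sup>2))" for x y
  proof -
    have "(\<phi> x - \<phi> y)\<^sup>2 + (g x * u y + g y * u x)
        = u x * u y * (\<phi> x / u x - \<phi> y / u y)\<^sup>2 + ((\<phi> x)\<^sup>2 + (\<phi> y)\<^sup>2)"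
      using u0 by (simp add: g_def power2_eq_square field_simps)
    then show ?thesis using g u0 by (simp flip: ennreal_plus)
  qed
  have "D + (A + A) = D + (A + dbl (\<lambda>x y. ennreal (g y * u x)))"
    using dbl_swap[of "\<lambda>x y. ennreal (g x * u y)"] by (simp add: A_def)
  also have "\<dots> = dbl (\<lambda>x y. ennreal ((\<phi> x - \<phi> y)\<^sup>2) + (ennreal (g x * u y) + ennreal (g y * u x)))"
    by (simp add: D_def A_def dbl_add)
  also have "\<dots> = E + (dbl (\<lambda>x y. ennreal ((\<phi> x)\<^sup>2)) + dbl (\<lambda>x y. ennreal ((\<phi> y)\<^sup>2)))"
    unfolding pt by (simp add: E_def dbl_add)
  also have "dbl (\<lambda>x y. ennreal ((\<phi> y)\<^sup>2)) = dbl (\<lambda>x y. ennreal ((\<phi> x)\<^sup>2))"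
    by (rule dbl_swap)
  also have "dbl (\<lambda>x y. ennreal ((\<phi> x)\<^sup>2)) = A + W"
    by (simp add: dbl_fst AW)
  finally have "(A + A) + D = (A + A) + (E + (W + W))" by (simp add: ac_simps)
  then have "D = E + (W + W)"
    using A by (simp add: ennreal_add_left_cancel)
  then show ?thesis
    unfolding Qform_eq_dbl residual_def D_def[symmetric] E_def[symmetric] W_def[symmetric]
    by (simp only: add_divide_distrib_ennreal[of E] mult_2[symmetric] ennreal_mult_2_divide_2)
qed

lemma sum_squares_finite: "fin_supp \<phi> \<Longrightarrow> (\<integral>\<^sup>+x. ennreal ((\<phi> x)\<^sup>2) \<partial>count_space UNIV) < top"
  by (rule nn_integral_count_space_finite_support) (auto simp: fin_supp_def elim: rev_finite_subset)

lemma hardy_weight_weight: "hardy_weight \<sigma> weight"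
  unfolding hardy_weight_def
proof (intro conjI allI impI)
  show "0 \<le> weight x" for x using u_pos[of x] m_pos[of x] by simp
  show "wsum weight \<phi> \<le> Qform \<sigma> \<phi>" if "fin_supp \<phi>" for \<phi>
    using ground_state_representation[OF sum_squares_finite[OF that]] by simp
qed

lemma Qform_finite:
  fixes \<phi> :: "int ^ 'd \<Rightarrow> real"
  assumes "fin_supp \<phi>"
  shows "Qform \<sigma> \<phi> < top"
proof -
  have "dbl (\<lambda>x y. ennreal ((\<phi> x - \<phi> y)\<^sup>2)) \<le> dbl (\<lambda>x y. 2 * ennreal ((\<phi> x)\<^sup>2) + 2 * ennreal ((\<phi> y)\<^sup>2))"
  proof (rule dbl_mono)
    fix x y
    have "0 \<le> (\<phi> x + \<phi> y)\<^sup>2" by simp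
    then have "(\<phi> x - \<phi> y)\<^sup>2 \<le> 2 * (\<phi> x)\<^sup>2 + 2 * (\<phi> y)\<^sup>2"
      by (simp add: power2_eq_square algebra_simps)
    from ennreal_leI[OF this] show "ennreal ((\<phi> x - \<phi> y)\<^sup>2) \<le> 2 * ennreal ((\<phi> x)\<^sup>2) + 2 * ennreal ((\<phi> y)\<^sup>2)"
      by (simp add: ennreal_mult')
  qed
  also have "\<dots> = 2 * (2 * (ennreal K * (\<integral>\<^sup>+x. ennreal ((\<phi> x)\<^sup>2) \<partial>count_space UNIV)))"
    using dbl_swap[of "\<lambda>x y. ennreal ((\<phi> x)\<^sup>2)"] by (simp add: dbl_add dbl_cmult dbl_fst mult_2)
  also have "\<dots> < top" using sum_squares_finite[OF assms] by (simp add: ennreal_mult_less_top)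
  finally show ?thesis by (simp add: Qform_eq_dbl ennreal_divide_eq_top_iff flip: less_top)
qed

section \<open>The form domain and passage to the limit in it\<close>

lemma Qform_minus: "Qform \<sigma> (\<lambda>x. f x - g x) = Qform \<sigma> (\<lambda>x. g x - f x)" for f g :: "int ^ 'd \<Rightarrow> real"
proof -
  have "(f x - g x - (f y - g y))\<^sup>2 = (g x - f x - (g y - f y))\<^sup>2" for x y
    by (simp add: power2_eq_square algebra_simps)
  then show ?thesis by (simp add: Qform_eq_dbl)
qed

text \<open>Young's inequality for the form. A free \<open>\<epsilon>\<close> brings the factor of
  \<open>Qform \<sigma> g\<close> as close to 1 as desired, and the large factor
  \<open>1 + 1 / \<epsilon>\<close> multiplies a term that will tend to zero.\<close>

lemma Qform_le_Qform_diff: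
  fixes f g :: "int ^ 'd \<Rightarrow> real"
  assumes "\<epsilon> > 0"
  shows "Qform \<sigma> f \<le> ennreal (1 + \<epsilon>) * Qform \<sigma> g + ennreal (1 + 1 / \<epsilon>) * Qform \<sigma> (\<lambda>x. f x - g x)"
proof -
  have "dbl (\<lambda>x y. ennreal ((f x - f y)\<^sup>2))
    \<le> dbl (\<lambda>x y. ennreal (1 + \<epsilon>) * ennreal ((g x - g y)\<^sup>2) + ennreal (1 + 1 / \<epsilon>) * ennreal ((f x - g x - (f y - g y))\<^sup>2))"
  proof (rule dbl_mono)
    fix x y
    let ?a = "g x - g y" and ?b = "f x - g x - (f y - g y)"
    have "(?a + ?b)\<^sup>2 \<le> (1 + \<epsilon>) * ?a\<^sup>2 + (1 + 1 / \<epsilon>) * ?b\<^sup>2"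
      by (rule square_add_le[OF assms])
    then have "ennreal ((f x - f y)\<^sup>2) \<le> ennreal ((1 + \<epsilon>) * ?a\<^sup>2 + (1 + 1 / \<epsilon>) * ?b\<^sup>2)"
      by (intro ennreal_leI) (simp add: algebra_simps)
    also have "\<dots> = ennreal (1 + \<epsilon>) * ennreal (?a\<^sup>2) + ennreal (1 + 1 / \<epsilon>) * ennreal (?b\<^sup>2)"
      using assms by (simp add: ennreal_mult)
    finally show "ennreal ((f x - f y)\<^sup>2) \<le> \<dots>" .
  qed
  also have "\<dots> = ennreal (1 + \<epsilon>) * dbl (\<lambda>x y. ennreal ((g x - g y)\<^sup>2))
      + ennreal (1 + 1 / \<epsilon>) * dbl (\<lambda>x y. ennreal ((f x - g x - (f y - g y))\<^sup>2))"
    by (simp only: dbl_add dbl_cmult)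
  finally show ?thesis
    unfolding Qform_eq_dbl
    by (metis (no_types, lifting) add_divide_distrib_ennreal divide_right_mono_ennreal ennreal_times_divide)
qed

lemma kappa_square_le_Qform:
  fixes f :: "int ^ 'd \<Rightarrow> real"
  shows "ennreal (kappa \<sigma> (x - y)) * ennreal ((f x - f y)\<^sup>2) \<le> 2 * Qform \<sigma> f"
proof -
  have "ennreal (kappa \<sigma> (x - y)) * ennreal ((f x - f y)\<^sup>2)
      \<le> (\<integral>\<^sup>+y. ennreal (kappa \<sigma> (x - y)) * ennreal ((f x - f y)\<^sup>2) \<partial>count_space UNIV)"
    by (rule nn_integral_count_space_ge)
  also have "\<dots> \<le> dbl (\<lambda>x y. ennreal ((f x - f y)\<^sup>2))"
    unfolding dbl_def by (rule nn_integral_count_space_ge)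
  also have "\<dots> = 2 * Qform \<sigma> f"
    unfolding Qform_eq_dbl
    by (simp only: ennreal_divide_2_mult_2)
  finally show ?thesis .
qed

text \<open>The norm of the form domain controls only the value at \<open>0\<close> and the
  increments. Every edge carries a positive jump weight, so convergence passes from a point to its
  neighbours and thus to the whole lattice.\<close>

lemma D0_approx:
  assumes "v \<in> D0 \<sigma>"
  obtains \<phi> where "\<And>n. fin_supp (\<phi> n)" "(\<lambda>n. Qform \<sigma> (\<lambda>x. \<phi> n x - v x)) \<longlonglongrightarrow> 0"
    "\<And>x :: int ^ 'd. (\<lambda>n. \<phi> n x) \<longlonglongrightarrow> v x"
proof -
  from assms obtain \<phi> where \<phi>: "\<And>n. fin_supp (\<phi> n)"
    and lim: "(\<lambda>n. Qform \<sigma> (\<lambda>x. \<phi> n x - v x) + ennreal ((\<phi> n 0 - v 0)\<^sup>2)) \<longlonglongrightarrow> 0"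
    unfolding D0_def by blast
  have Q: "(\<lambda>n. Qform \<sigma> (\<lambda>x. \<phi> n x - v x)) \<longlonglongrightarrow> 0"
    by (rule tendsto_0_le_ennreal[OF lim]) simp
  have "(\<lambda>n. \<phi> n x - v x) \<longlonglongrightarrow> 0" for x
  proof (rule lattice_connected[of "\<lambda>x. (\<lambda>n. \<phi> n x - v x) \<longlonglongrightarrow> 0"])
    show "(\<lambda>n. \<phi> n 0 - v 0) \<longlonglongrightarrow> 0"
      by (intro tendsto_ennreal_square_0 tendsto_0_le_ennreal[OF lim]) simp
  next
    fix x e :: "int ^ 'd"
    assume x: "(\<lambda>n. \<phi> n x - v x) \<longlonglongrightarrow> 0" and e: "e \<in> uvec"
    let ?d = "\<lambda>n. (\<phi> n (x + e) - v (x + e)) - (\<phi> n x - v x)"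
    have k: "kappa \<sigma> e > 0" using e by (rule kappa_uvec)
    have "(\<lambda>n. ennreal ((sqrt (kappa \<sigma> e) * ?d n)\<^sup>2)) \<longlonglongrightarrow> 0"
    proof (rule tendsto_0_le_ennreal)
      show "(\<lambda>n. 2 * Qform \<sigma> (\<lambda>x. \<phi> n x - v x)) \<longlonglongrightarrow> 0"
        using ennreal_tendsto_cmult[OF _ Q, of 2] by simp
      show "ennreal ((sqrt (kappa \<sigma> e) * ?d n)\<^sup>2) \<le> 2 * Qform \<sigma> (\<lambda>x. \<phi> n x - v x)" for n
        using kappa_square_le_Qform[of "x + e" x "\<lambda>x. \<phi> n x - v x"] k
        by (simp add: power_mult_distrib ennreal_mult)
    qed
    then have "(\<lambda>n. sqrt (kappa \<sigma> e) * ?d n) \<longlonglongrightarrow> 0" by (rule tendsto_ennreal_square_0)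
    then have "?d \<longlonglongrightarrow> 0"
      using k by (subst (asm) tendsto_mult_left_iff[of "sqrt (kappa \<sigma> e)" _ 0, simplified]) auto
    from tendsto_add[OF this x] show "(\<lambda>n. \<phi> n (x + e) - v (x + e)) \<longlonglongrightarrow> 0" by simp
  qed
  then have "(\<lambda>n. \<phi> n x) \<longlonglongrightarrow> v x" for x by (rule LIM_zero_cancel)
  with \<phi> Q show ?thesis using that by blast
qed

lemma Qform_D0_finite:
  assumes "v \<in> D0 \<sigma>"
  shows "Qform \<sigma> (v :: int ^ 'd \<Rightarrow> real) < top"
proof -
  obtain \<phi> where \<phi>: "\<And>n. fin_supp (\<phi> n)" "(\<lambda>n. Qform \<sigma> (\<lambda>x. \<phi> n x - v x)) \<longlonglongrightarrow> 0"
    and "\<And>x. (\<lambda>n. \<phi> n x) \<longlonglongrightarrow> v x"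
    using D0_approx[OF assms] by blast
  obtain n where n: "Qform \<sigma> (\<lambda>x. \<phi> n x - v x) < 1"
    using eventually_happens'[OF sequentially_bot order_tendstoD(2)[OF \<phi>(2), of 1]] by auto
  have "Qform \<sigma> v \<le> 2 * Qform \<sigma> (\<phi> n) + 2 * Qform \<sigma> (\<lambda>x. v x - \<phi> n x)"
    using Qform_le_Qform_diff[of 1 v "\<phi> n"] by simp
  also have "\<dots> < top"
    using Qform_finite[OF \<phi>(1)[of n]] order.strict_trans[OF n, of top]
    by (simp add: Qform_minus[of v] ennreal_mult_less_top)
  finally show ?thesis .
qed

text \<open>A bound by the form on finitely supported functions extends to \<open>D0\<close> for
  every functional that is lower semicontinuous under pointwise convergence. It serves for the Hardy
  inequality itself and for its refinement by \<open>residual\<close>.\<close>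

lemma D0_limit_le:
  assumes v: "v \<in> D0 \<sigma>"
    and le: "\<And>\<phi>. fin_supp \<phi> \<Longrightarrow> \<Phi> \<phi> \<le> Qform \<sigma> \<phi>"
    and lsc: "\<And>\<phi>. (\<And>x :: int ^ 'd. (\<lambda>n. \<phi> n x) \<longlonglongrightarrow> v x) \<Longrightarrow> \<Phi> v \<le> liminf (\<lambda>n. \<Phi> (\<phi> n))"
  shows "\<Phi> v \<le> Qform \<sigma> v"
proof (rule ennreal_le_epsilon)
  fix \<delta> :: real assume fin: "Qform \<sigma> v < top" and \<delta>: "\<delta> > 0"
  obtain \<phi> where \<phi>: "\<And>n. fin_supp (\<phi> n)" and Q: "(\<lambda>n. Qform \<sigma> (\<lambda>x. \<phi> n x - v x)) \<longlonglongrightarrow> 0"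
    and lim: "\<And>x. (\<lambda>n. \<phi> n x) \<longlonglongrightarrow> v x"
    using D0_approx[OF v] by blast
  define q where "q = enn2real (Qform \<sigma> v)"
  have q: "Qform \<sigma> v = ennreal q" "q \<ge> 0" using fin by (auto simp: q_def)
  \<comment> \<open>This makes \<open>\<epsilon> * q\<close> at most \<open>\<delta>\<close>; the
    summand 1 covers the case \<open>q = 0\<close>.\<close>
  define \<epsilon> where "\<epsilon> = \<delta> / (q + 1)"
  have \<epsilon>: "\<epsilon> > 0" "\<epsilon> * q \<le> \<delta>"
    using \<delta> q(2) by (auto simp: \<epsilon>_def field_simps)
  have "\<Phi> v \<le> liminf (\<lambda>n. \<Phi> (\<phi> n))" by (rule lsc) (rule lim)
  also have "\<dots> \<le> liminf (\<lambda>n. ennreal (1 + \<epsilon>) * Qform \<sigma> v + ennreal (1 + 1 / \<epsilon>) * Qform \<sigma> (\<lambda>x. \<phi> n x - v x))"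
    by (intro Liminf_mono always_eventually allI order.trans[OF le Qform_le_Qform_diff] \<phi> \<epsilon>)
  also have "\<dots> = ennreal (1 + \<epsilon>) * Qform \<sigma> v"
  proof (rule lim_imp_Liminf)
    have "(\<lambda>n. ennreal (1 + 1 / \<epsilon>) * Qform \<sigma> (\<lambda>x. \<phi> n x - v x)) \<longlonglongrightarrow> ennreal (1 + 1 / \<epsilon>) * 0"
      by (intro ennreal_tendsto_cmult Q) simp
    from tendsto_add[OF tendsto_const[of "ennreal (1 + \<epsilon>) * Qform \<sigma> v"] this]
    show "(\<lambda>n. ennreal (1 + \<epsilon>) * Qform \<sigma> v + ennreal (1 + 1 / \<epsilon>) * Qform \<sigma> (\<lambda>x. \<phi> n x - v x))
      \<longlonglongrightarrow> ennreal (1 + \<epsilon>) * Qform \<sigma> v" by simp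
  qed simp
  also have "\<dots> = ennreal ((1 + \<epsilon>) * q)"
    using q \<epsilon> by (simp add: ennreal_mult)
  also have "\<dots> \<le> ennreal (q + \<delta>)"
    using \<epsilon> by (intro ennreal_leI) (simp add: algebra_simps)
  also have "\<dots> = Qform \<sigma> v + ennreal \<delta>"
    using q \<delta> by simp
  finally show "\<Phi> v \<le> Qform \<sigma> v + ennreal \<delta>" .
qed

lemma hardy_D0:
  assumes "hardy_weight \<sigma> w" "v \<in> D0 \<sigma>"
  shows "wsum w v \<le> Qform \<sigma> (v :: int ^ 'd \<Rightarrow> real)"
  by (rule D0_limit_le[OF assms(2)]) (use assms(1) wsum_liminf in \<open>auto simp: hardy_weight_def\<close>)

lemma dbl_liminf:
  assumes "\<And>x y. (\<lambda>n. F n x y) \<longlonglongrightarrow> F' x y"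
  shows "dbl (\<lambda>x y. ennreal (F' x y)) / 2 \<le> liminf (\<lambda>n. dbl (\<lambda>x y. ennreal (F n x y)) / 2)"
proof -
  have "(\<integral>\<^sup>+x. \<integral>\<^sup>+y. ennreal (kappa \<sigma> (x - y)) * ennreal (F' x y) / 2 \<partial>count_space UNIV \<partial>count_space UNIV)
    \<le> liminf (\<lambda>n. \<integral>\<^sup>+x. \<integral>\<^sup>+y. ennreal (kappa \<sigma> (x - y)) * ennreal (F n x y) / 2 \<partial>count_space UNIV \<partial>count_space UNIV)"
  proof (rule nn_integral_count_space_liminf2)
    fix x y :: "int ^ 'd"
    have "ennreal (kappa \<sigma> (x - y)) / 2 < top"
      by (simp add: ennreal_divide_eq_top_iff flip: less_top)
    from ennreal_tendsto_cmult[OF this tendsto_ennrealI[OF assms[of x y]]]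
    show "(\<lambda>n. ennreal (kappa \<sigma> (x - y)) * ennreal (F n x y) / 2)
        \<longlonglongrightarrow> ennreal (kappa \<sigma> (x - y)) * ennreal (F' x y) / 2"
      by (simp add: ennreal_divide_times ennreal_times_divide mult.commute)
  qed
  then show ?thesis
    by (simp add: dbl_def nn_integral_divide)
qed

text \<open>An element of \<open>D0\<close> need not be square summable, so the ground state
  representation is transferred from finitely supported functions by Fatou's lemma, which turns the
  identity into an inequality.\<close>

lemma residual_add_wsum_le_Qform:
  assumes "v \<in> D0 \<sigma>"
  shows "residual v + wsum weight v \<le> Qform \<sigma> v"
proof (rule D0_limit_le[OF assms])
  fix \<phi> assume lim: "\<And>x :: int ^ 'd. (\<lambda>n. \<phi> n x) \<longlonglongrightarrow> v x"
  have "residual v \<le> liminf (\<lambda>n. residual (\<phi> n))"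
    unfolding residual_def
    by (intro dbl_liminf tendsto_intros lim) (rule u_neq_0)+
  from add_mono[OF this wsum_liminf[OF lim, of weight]]
  show "residual v + wsum weight v \<le> liminf (\<lambda>n. residual (\<phi> n) + wsum weight (\<phi> n))"
    by (rule order.trans[OF _ liminf_add_le_ennreal])
qed (simp add: ground_state_representation sum_squares_finite)

section \<open>Optimisers and criticality\<close>

lemma wsum_ground_state: "wsum weight u = (\<integral>\<^sup>+x. ennreal (m x * u x) \<partial>count_space UNIV)"
  unfolding wsum_def using u_pos less_imp_neq[OF u_pos]
  by (intro nn_integral_cong) (simp add: power2_eq_square)

text \<open>Each term of the sum vanishes, and on edges the jump weight and \<open>u\<close> are
  positive, so \<open>v / u\<close> takes equal values at neighbours.\<close>

lemma residual_eq_0_imp_const: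
  assumes "residual v = 0"
  obtains c where "\<And>x. v x = c * u x"
proof -
  have "dbl (\<lambda>x y. ennreal (u x * u y * (v x / u x - v y / u y)\<^sup>2)) = 0"
    using assms by (simp add: residual_def ennreal_divide_eq_0_iff)
  then have zero: "ennreal (kappa \<sigma> (x - y)) * ennreal (u x * u y * (v x / u x - v y / u y)\<^sup>2) = 0" for x y
    unfolding dbl_def by (simp add: nn_integral_0_iff_AE AE_count_space del: mult_eq_0_iff)
  have "v x / u x = v 0 / u 0" for x
  proof (rule lattice_connected[of "\<lambda>x. v x / u x = v 0 / u 0"])
    fix x e :: "int ^ 'd" assume IH: "v x / u x = v 0 / u 0" and e: "e \<in> uvec"
    have "kappa \<sigma> e * (u (x + e) * u x * (v (x + e) / u (x + e) - v x / u x)\<^sup>2) \<le> 0"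
      using zero[of "x + e" x] kappa_nonneg[of e] u_pos[of x] u_pos[of "x + e"]
      by (auto simp flip: ennreal_mult simp: ennreal_eq_0_iff)
    then have "(v (x + e) / u (x + e) - v x / u x)\<^sup>2 \<le> 0"
      using kappa_uvec[OF e] u_pos[of x] u_pos[of "x + e"]
      by (simp add: mult_le_0_iff)
    then show "v (x + e) / u (x + e) = v 0 / u 0" using IH by simp
  qed simp
  then have "v x = v 0 / u 0 * u x" for x
    using u_pos[of x] by (metis less_irrefl nonzero_eq_divide_eq)
  then show ?thesis using that by blast
qed

text \<open>Equality leaves no room for \<open>residual v\<close>: the weighted sum is finite
  because \<open>v\<close> lies in the form domain, hence it cancels. So \<open>v = c * u\<close>
  with \<open>c \<noteq> 0\<close>, and the finite sum is \<open>c^2\<close> times the sum of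
  \<open>m x * u x\<close>.\<close>

lemma ground_state_energy_finite:
  assumes "v \<in> D0 \<sigma>" "v \<noteq> (\<lambda>_. 0)" "Qform \<sigma> v = wsum weight v"
  shows "(\<integral>\<^sup>+x. ennreal (m x * u x) \<partial>count_space UNIV) < top"
proof -
  have fin: "wsum weight v < top" using Qform_D0_finite[OF assms(1)] assms(3) by simp
  have "wsum weight v + residual v \<le> wsum weight v + 0"
    using residual_add_wsum_le_Qform[OF assms(1)] assms(3) by (simp add: add.commute)
  then have "residual v = 0"
    using fin by (simp add: ennreal_add_left_cancel_le flip: less_top del: add_0_right)
  then obtain c where c: "\<And>x. v x = c * u x" using residual_eq_0_imp_const by blast
  then have "c \<noteq> 0" using assms(2) by auto
  have "wsum weight v = ennreal (c\<^sup>2) * wsum weight u"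
    unfolding wsum_def using u_pos m_pos
    by (subst nn_integral_cmult[symmetric])
      (auto intro!: nn_integral_cong simp: c power_mult_distrib less_imp_le simp flip: ennreal_mult)
  then show ?thesis
    using fin \<open>c \<noteq> 0\<close> by (auto simp: wsum_ground_state ennreal_mult_less_top)
qed

text \<open>The ground state need not be square summable, so its values are truncated instead of
  cutting it off in space.\<close>
lemma Qform_truncate_le:
  assumes "\<epsilon> > 0"
  shows "Qform \<sigma> (\<lambda>x. max (u x - \<epsilon>) 0) \<le> (\<integral>\<^sup>+x. ennreal (m x * u x) \<partial>count_space UNIV)"
proof -
  define g where "g x = max (u x - \<epsilon>) 0" for x
  have g: "g x \<ge> 0" "g x \<le> u x" for x using u_pos[of x] assms by (auto simp: g_def)
  have u0: "0 \<le> u x" "0 \<le> m x" for x using u_pos[of x] m_pos[of x] by simp_all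
  have "finite {x. u x > \<epsilon>}" by (rule superlevel_finite[OF assms])
  then have "(\<integral>\<^sup>+x. ennreal (g x * u x) \<partial>count_space UNIV) < top"
    by (intro nn_integral_count_space_finite_support) (auto simp: g_def max_def elim!: rev_finite_subset split: if_splits)
  define A where "A = dbl (\<lambda>x y. ennreal (g x * u y))"
  define M where "M = (\<integral>\<^sup>+x. ennreal (g x * m x) \<partial>count_space UNIV)"
  define S where "S = (\<integral>\<^sup>+x. ennreal (g x * u x) \<partial>count_space UNIV)"
  define D where "D = dbl (\<lambda>x y. ennreal ((g x - g y)\<^sup>2))"
  have S: "S < top" unfolding S_def by fact
  have AM: "A + M = ennreal K * S"
    unfolding A_def M_def S_def by (rule dbl_potential) (rule g)
  have "A + M < top" using S by (simp add: AM ennreal_mult_less_top)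
  then have A: "A \<noteq> top" by auto
  have "D + (A + A) = dbl (\<lambda>x y. ennreal ((g x - g y)\<^sup>2) + (ennreal (g x * u y) + ennreal (g y * u x)))"
    using dbl_swap[of "\<lambda>x y. ennreal (g x * u y)"] by (simp add: D_def A_def dbl_add)
  also have "\<dots> \<le> dbl (\<lambda>x y. ennreal (g x * u x) + ennreal (g y * u y))"
  proof (rule dbl_mono)
    fix x y
    \<comment> \<open>Truncation is monotone and contracts distances: an increment of
      \<open>g\<close> has the sign of the increment of \<open>u\<close> and is no larger in
      size.\<close>
    have "(g x - g y)\<^sup>2 \<le> (g x - g y) * (u x - u y)"
    proof -
      have "g x - g y \<le> u x - u y" if "g x > g y" using that by (auto simp: g_def max_def split: if_splits)
      moreover have "g x - g y \<ge> u x - u y" if "g x < g y" using that by (auto simp: g_def max_def split: if_splits)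
      ultimately have "0 \<le> (g x - g y) * ((u x - u y) - (g x - g y))"
        by (cases "g x" "g y" rule: linorder_cases) (auto intro: mult_nonneg_nonneg mult_nonpos_nonpos)
      then show ?thesis by (simp add: power2_eq_square algebra_simps)
    qed
    then have "(g x - g y)\<^sup>2 + (g x * u y + g y * u x) \<le> g x * u x + g y * u y"
      by (simp add: algebra_simps)
    from ennreal_leI[OF this]
    show "ennreal ((g x - g y)\<^sup>2) + (ennreal (g x * u y) + ennreal (g y * u x))
        \<le> ennreal (g x * u x) + ennreal (g y * u y)"
      using g u0 by (simp add: add_nonneg_nonneg)
  qed
  also have "\<dots> = (A + M) + (A + M)"
    using dbl_swap[of "\<lambda>x y. ennreal (g x * u x)"]
    by (simp add: dbl_add dbl_fst AM S_def)
  finally have "(A + A) + D \<le> (A + A) + (M + M)" by (simp add: ac_simps)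
  then have "D \<le> 2 * M"
    using A by (simp add: ennreal_add_left_cancel_le mult_2)
  then have "D / 2 \<le> 2 * M / 2" by (rule divide_right_mono_ennreal)
  also have "\<dots> = M"
    by (rule ennreal_mult_2_divide_2)
  also have "M \<le> (\<integral>\<^sup>+x. ennreal (m x * u x) \<partial>count_space UNIV)"
    unfolding M_def
    by (intro nn_integral_mono ennreal_leI, subst mult.commute) (intro mult_left_mono g u0)
  finally show ?thesis by (simp add: Qform_eq_dbl D_def g_def)
qed

lemma truncate_tendsto: "(\<lambda>n. max (u x - 1 / real (Suc n)) 0) \<longlonglongrightarrow> u x"
proof -
  have "(\<lambda>n. max (u x - 1 / real (Suc n)) 0) \<longlonglongrightarrow> max (u x - 0) 0"
    by (intro tendsto_intros LIMSEQ_Suc lim_1_over_n)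
  then show ?thesis using u_pos[of x] by simp
qed

text \<open>Fatou along the truncations bounds \<open>Qform \<sigma> u\<close> by the finite energy.
  The increments of \<open>u\<close> then dominate those of the differences, so the truncations
  converge in the form; once \<open>u\<close> is in \<open>D0\<close>, the Hardy inequality supplies
  the reverse bound.\<close>

lemma ground_state_in_D0:
  assumes fin: "(\<integral>\<^sup>+x. ennreal (m x * u x) \<partial>count_space UNIV) < top"
  shows "u \<in> D0 \<sigma>" "Qform \<sigma> u = wsum weight u"
proof -
  define g where "g n x = max (u x - 1 / real (Suc n)) 0" for n x
  have lim: "(\<lambda>n. g n x) \<longlonglongrightarrow> u x" for x
    unfolding g_def by (rule truncate_tendsto)
  have "Qform \<sigma> u \<le> liminf (\<lambda>n. Qform \<sigma> (g n))"
    unfolding Qform_eq_dbl by (intro dbl_liminf tendsto_intros lim)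
  also have "\<dots> \<le> liminf (\<lambda>n. \<integral>\<^sup>+x. ennreal (m x * u x) \<partial>count_space UNIV)"
    unfolding g_def by (intro Liminf_mono always_eventually allI Qform_truncate_le) simp
  also have "\<dots> = wsum weight u" by (simp add: wsum_ground_state Liminf_const)
  finally have upper: "Qform \<sigma> u \<le> wsum weight u" .
  have Qfin: "Qform \<sigma> u < top" using upper fin by (simp add: wsum_ground_state)
  define F where "F f p = ennreal (kappa \<sigma> (fst p - snd p)) * ennreal ((f (fst p) - f (snd p))\<^sup>2)"
    for f :: "int ^ 'd \<Rightarrow> real" and p
  have Q2: "Qform \<sigma> f = (\<integral>\<^sup>+p. F f p \<partial>count_space UNIV) / 2" for f :: "int ^ 'd \<Rightarrow> real"
    unfolding Qform_eq_dbl dbl_def by (simp add: F_def flip: nn_integral_fst_count_space)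
  have "(\<lambda>n. \<integral>\<^sup>+p. F (\<lambda>x. g n x - u x) p \<partial>count_space UNIV) \<longlonglongrightarrow> (\<integral>\<^sup>+p. 0 \<partial>count_space (UNIV :: ((int ^ 'd) \<times> (int ^ 'd)) set))"
  proof (rule nn_integral_dominated_convergence[where w = "F u"])
    show "(\<integral>\<^sup>+p. F u p \<partial>count_space UNIV) < \<infinity>"
      using Qfin unfolding Q2 by (simp add: ennreal_divide_eq_top_iff flip: less_top)
    show "AE p in count_space UNIV. F (\<lambda>x. g n x - u x) p \<le> F u p" for n
    proof (intro always_eventually allI)
      fix p :: "(int ^ 'd) \<times> (int ^ 'd)"
      obtain x y where p: "p = (x, y)" by (cases p)
      define r where "r = 1 / real (Suc n)"
      \<comment> \<open>\<open>u - g n\<close> is the minimum of \<open>u\<close> and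
        \<open>r\<close>, again a contraction of \<open>u\<close>.\<close>
      have "\<bar>(g n x - u x) - (g n y - u y)\<bar> \<le> \<bar>u x - u y\<bar>"
        using u_pos[of x] u_pos[of y] unfolding g_def r_def[symmetric] by (auto simp: max_def abs_if)
      then have "((g n x - u x) - (g n y - u y))\<^sup>2 \<le> (u x - u y)\<^sup>2" by (rule abs_le_square_iff[THEN iffD1])
      then show "F (\<lambda>x. g n x - u x) p \<le> F u p"
        by (auto simp: p F_def intro!: mult_left_mono ennreal_leI)
    qed
    show "AE p in count_space UNIV. (\<lambda>n. F (\<lambda>x. g n x - u x) p) \<longlonglongrightarrow> 0"
    proof (intro always_eventually allI)
      fix p :: "(int ^ 'd) \<times> (int ^ 'd)"
      obtain x y where p: "p = (x, y)" by (cases p)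
      have "(\<lambda>n. kappa \<sigma> (x - y) * ((g n x - u x) - (g n y - u y))\<^sup>2) \<longlonglongrightarrow> kappa \<sigma> (x - y) * ((u x - u x) - (u y - u y))\<^sup>2"
        by (intro tendsto_intros lim)
      then have "(\<lambda>n. ennreal (kappa \<sigma> (x - y) * ((g n x - u x) - (g n y - u y))\<^sup>2)) \<longlonglongrightarrow> ennreal 0"
        by (intro tendsto_ennrealI) simp
      then show "(\<lambda>n. F (\<lambda>x. g n x - u x) p) \<longlonglongrightarrow> 0"
        by (simp add: p F_def ennreal_mult kappa_nonneg)
    qed
  qed auto
  then have F0: "(\<lambda>n. \<integral>\<^sup>+p. F (\<lambda>x. g n x - u x) p \<partial>count_space UNIV) \<longlonglongrightarrow> 0" by simp
  have Q0: "(\<lambda>n. Qform \<sigma> (\<lambda>x. g n x - u x)) \<longlonglongrightarrow> 0"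
  proof (rule tendsto_0_le_ennreal[OF F0])
    show "Qform \<sigma> (\<lambda>x. g n x - u x) \<le> (\<integral>\<^sup>+p. F (\<lambda>x. g n x - u x) p \<partial>count_space UNIV)" for n
      unfolding Q2 by (rule divide_le_posI_ennreal) (auto simp: mult_2 add_increasing2)
  qed
  have "(\<lambda>n. (g n 0 - u 0)\<^sup>2) \<longlonglongrightarrow> (u 0 - u 0)\<^sup>2" by (intro tendsto_intros lim)
  then have "(\<lambda>n. ennreal ((g n 0 - u 0)\<^sup>2)) \<longlonglongrightarrow> ennreal 0" by (intro tendsto_ennrealI) simp
  from tendsto_add[OF Q0 this]
  have conv: "(\<lambda>n. Qform \<sigma> (\<lambda>x. g n x - u x) + ennreal ((g n 0 - u 0)\<^sup>2)) \<longlonglongrightarrow> 0" by simp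
  have "fin_supp (g n)" for n
    unfolding fin_supp_def
    by (rule finite_subset[OF _ superlevel_finite[of "1 / real (Suc n)"]]) (auto simp: g_def max_def split: if_splits)
  with conv show D: "u \<in> D0 \<sigma>" unfolding D0_def by blast
  show "Qform \<sigma> u = wsum weight u"
    using upper hardy_D0[OF hardy_weight_weight D] by (rule antisym)
qed

text \<open>With finite energy, \<open>u\<close> attains equality for \<open>weight\<close> and is
  admissible for any larger Hardy weight. The excess of the larger weight then has sum zero against
  \<open>u^2\<close>, which is positive everywhere, so the excess vanishes.\<close>

lemma positive_critical_iff:
  "positive_critical \<sigma> weight \<longleftrightarrow> (\<integral>\<^sup>+x. ennreal (m x * u x) \<partial>count_space UNIV) < top"
proof
  assume "positive_critical \<sigma> weight"
  then show "(\<integral>\<^sup>+x. ennreal (m x * u x) \<partial>count_space UNIV) < top"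
    using ground_state_energy_finite unfolding positive_critical_def by blast
next
  assume fin: "(\<integral>\<^sup>+x. ennreal (m x * u x) \<partial>count_space UNIV) < top"
  note u = ground_state_in_D0[OF fin]
  have "w' = weight" if w': "hardy_weight \<sigma> w'" and ge: "\<And>x. weight x \<le> w' x" for w'
  proof -
    have pt: "ennreal (w' x * (u x)\<^sup>2) = ennreal (weight x * (u x)\<^sup>2) + ennreal ((w' x - weight x) * (u x)\<^sup>2)" for x
    proof -
      have "0 \<le> weight x * (u x)\<^sup>2" using u_pos[of x] m_pos[of x] by simp
      moreover have "0 \<le> (w' x - weight x) * (u x)\<^sup>2" using ge[of x] by simp
      ultimately show ?thesis by (simp flip: ennreal_plus add: algebra_simps)
    qed
    have "wsum weight u + wsum (\<lambda>x. w' x - weight x) u \<le> wsum weight u + 0"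
      using hardy_D0[OF w' u(1)] u(2) by (simp add: wsum_def pt nn_integral_add)
    then have "wsum (\<lambda>x. w' x - weight x) u = 0"
      using fin by (simp add: ennreal_add_left_cancel_le wsum_ground_state flip: less_top del: add_0_right)
    then have "ennreal ((w' x - weight x) * (u x)\<^sup>2) = 0" for x
      unfolding wsum_def by (simp add: nn_integral_0_iff_AE AE_count_space)
    then have le: "(w' x - weight x) * (u x)\<^sup>2 \<le> 0" for x by (simp add: ennreal_eq_0_iff)
    have "w' x \<le> weight x" for x
      using le[of x] u_neq_0[of x] by (auto simp: mult_le_0_iff)
    with ge show ?thesis by (intro ext antisym) auto
  qed
  then have "critical_hardy \<sigma> weight"
    unfolding critical_hardy_def using hardy_weight_weight by blast
  moreover have "u \<noteq> (\<lambda>_. 0)" using u_pos by (metis less_irrefl)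
  ultimately show "positive_critical \<sigma> weight"
    unfolding positive_critical_def using u by blast
qed

end

section \<open>Heat potentials\<close>

text \<open>Extension by zero lets all time integrals run over the whole line, and a shifted power
  such as \<open>rpowr a (t - s)\<close> carries its own range of integration.\<close>

definition rpowr :: "real \<Rightarrow> real \<Rightarrow> real" where
  "rpowr a t = (if t > 0 then t powr a else 0)"

lemma rpowr_measurable [measurable]: "rpowr a \<in> borel_measurable borel"
  unfolding rpowr_def[abs_def] by measurable

lemma rpowr_nonneg [simp]: "rpowr a t \<ge> 0"
  by (simp add: rpowr_def)

lemma rpowr_mult_left: "r > 0 \<Longrightarrow> rpowr a (r * s) = r powr a * rpowr a s"
  by (simp add: rpowr_def powr_mult zero_less_mult_iff)

lemma rpowr_heat_nonneg [simp]: "rpowr a t * heat t x \<ge> 0"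
  by (simp add: rpowr_def)

text \<open>The Riesz integral without its Gamma factor and with values in the extended reals: a
  potential for \<open>a > 0\<close>, the jump kernel off the origin for
  \<open>a = - \<sigma>\<close>.\<close>

definition heat_potential :: "real \<Rightarrow> int ^ 'd::finite \<Rightarrow> ennreal" where
  "heat_potential a x = (\<integral>\<^sup>+t. ennreal (rpowr (a - 1) t * heat t x) \<partial>lborel)"

lemma uminus_notin_nonpos_Ints:
  fixes \<sigma> :: real
  assumes "0 < \<sigma>" "\<sigma> < 1"
  shows "- \<sigma> \<notin> \<int>\<^sub>\<le>\<^sub>0"
proof
  assume "- \<sigma> \<in> \<int>\<^sub>\<le>\<^sub>0"
  then obtain n where "- \<sigma> = of_int n" by (elim nonpos_Ints_cases)
  with assms have "real_of_int (- 1) < of_int n \<and> real_of_int n < of_int 0" by auto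
  then show False unfolding of_int_less_iff by linarith
qed

text \<open>The gauge integral in \<open>kappa\<close> returns a default value when its integrand is
  not integrable. Finiteness of the potential excludes this, and then the two notions of integral
  agree.\<close>

lemma kappa_eq_heat_potential:
  fixes x :: "int ^ 'd::finite"
  assumes \<beta>: "\<beta> < 0 \<or> 0 < \<beta> \<and> \<beta> < 1 \<and> x \<noteq> 0" and fin: "heat_potential (- \<beta>) x < top"
  shows "ennreal (\<bar>Gamma (- \<beta>)\<bar> * kappa \<beta> x) = heat_potential (- \<beta>) x"
proof -
  obtain I where I: "heat_potential (- \<beta>) x = ennreal I" "I \<ge> 0"
    using fin by (cases "heat_potential (- \<beta>) x") auto
  let ?f = "\<lambda>t. rpowr (- \<beta> - 1) t * heat t x"
  have f: "?f \<in> borel_measurable borel" by measurable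
  have "integrable lborel ?f"
    using f I(1) by (intro integrableI_nonneg) (auto simp: heat_potential_def)
  then have "(?f has_integral integral\<^sup>L lborel ?f) UNIV" by (rule has_integral_integral_lborel)
  moreover have "integral\<^sup>L lborel ?f = I"
    using I f by (intro integral_eq_nn_integral[THEN trans]) (auto simp: heat_potential_def)
  moreover have "?f = (\<lambda>t. if t \<in> {0<..} then heat t x / t powr (1 + \<beta>) else 0)"
  proof
    fix t :: real
    have "- \<beta> - 1 = - (1 + \<beta>)" by simp
    then have "t powr (- \<beta> - 1) = 1 / t powr (1 + \<beta>)"
      by (simp only: powr_minus_divide)
    then show "?f t = (if t \<in> {0<..} then heat t x / t powr (1 + \<beta>) else 0)"
      by (simp add: rpowr_def)
  qed
  ultimately have "((\<lambda>t. if t \<in> {0<..} then heat t x / t powr (1 + \<beta>) else 0) has_integral I) UNIV"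
    by simp
  then have "integral {0<..} (\<lambda>t. heat t x / t powr (1 + \<beta>)) = I"
    by (simp only: has_integral_restrict_UNIV integral_unique)
  \<comment> \<open>\<open>Gamma\<close> is set to 0 at its poles; \<open>- \<beta>\<close> is
    either positive or strictly between -1 and 0, hence not a pole.\<close>
  moreover have "Gamma (- \<beta>) \<noteq> 0"
  proof -
    have "- \<beta> \<notin> \<int>\<^sub>\<le>\<^sub>0"
      using \<beta> uminus_notin_nonpos_Ints[of \<beta>] by (auto dest: nonpos_Ints_nonpos)
    then show ?thesis by (simp add: Gamma_eq_zero_iff)
  qed
  ultimately have "\<bar>Gamma (- \<beta>)\<bar> * kappa \<beta> x = I" using \<beta> by (auto simp: kappa_def)
  then show ?thesis using I by simp
qed

section \<open>Convergence and divergence of heat potentials\<close>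

lemma nn_integral_powr_near_0:
  "a > -1 \<Longrightarrow> (\<integral>\<^sup>+t. ennreal (t powr a) * indicator {0..1} t \<partial>lborel) < top" for a :: real
  using nn_integral_has_integral_lebesgue'[OF _ has_integral_powr_from_0[of a 1]] by simp

lemma nn_integral_powr_near_inf:
  "a < -1 \<Longrightarrow> (\<integral>\<^sup>+t. ennreal (t powr a) * indicator {1..} t \<partial>lborel) < top" for a :: real
  using nn_integral_has_integral_lebesgue'[OF _ has_integral_powr_to_inf[of a 1]] by simp

lemma nn_integral_powr_near_inf_diverges:
  assumes "a \<ge> (-1 :: real)"
  shows "(\<integral>\<^sup>+t. ennreal (t powr a) * indicator {1..} t \<partial>lborel) = top"
proof (rule ccontr)
  let ?I = "\<integral>\<^sup>+t. ennreal (t powr a) * indicator {1..} t \<partial>lborel"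
  assume "?I \<noteq> top"
  then obtain r where r: "?I = ennreal r" "r \<ge> 0" by (cases ?I) auto
  \<comment> \<open>Up to this point the integral of \<open>1 / t\<close> from 1 is
    \<open>r + 1\<close>, which exceeds the supposed value \<open>r\<close>.\<close>
  let ?T = "exp (r + 1)"
  have T: "1 \<le> ?T" using r by simp
  have "((\<lambda>t. 1 / t) has_integral ln ?T - ln 1) {1..?T}"
    using T by (intro fundamental_theorem_of_calculus)
      (auto intro!: derivative_eq_intros simp flip: has_real_derivative_iff_has_vector_derivative)
  then have "ennreal (r + 1) = (\<integral>\<^sup>+t. ennreal (1 / t) * indicator {1..?T} t \<partial>lborel)"
    by (subst nn_integral_has_integral_lebesgue'[where I = "r + 1"]) auto
  also have "\<dots> \<le> ?I"
  proof (rule nn_integral_mono)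
    fix t :: real
    have "1 / t \<le> t powr a" if "t \<ge> 1"
      using powr_mono[OF assms that] that by (simp add: powr_minus_divide)
    then show "ennreal (1 / t) * indicator {1..?T} t \<le> ennreal (t powr a) * indicator {1..} t"
      by (auto simp: indicator_def intro: ennreal_leI)
  qed
  finally show False using r by simp
qed

text \<open>Small times converge because \<open>heat\<close> is at most 1 and \<open>a > 0\<close>;
  large times converge by the on-diagonal decay because \<open>a\<close> is below half the
  dimension.\<close>

lemma heat_potential_finite:
  fixes x :: "int ^ 'd::finite"
  assumes "0 < a" "a < real CARD('d) / 2"
  shows "heat_potential a x < top"
proof -
  obtain C where C: "C > 0" "\<And>t. t > 0 \<Longrightarrow> heat t (0 :: int ^ 'd) \<le> C * t powr (- (real CARD('d) / 2))"
    using heat_0_upper by blast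
  let ?b = "a - 1 - real CARD('d) / 2"
  have "heat_potential a x \<le> (\<integral>\<^sup>+t. ennreal (t powr (a - 1)) * indicator {0..1} t
      + ennreal C * (ennreal (t powr ?b) * indicator {1..} t) \<partial>lborel)"
    unfolding heat_potential_def
  proof (rule nn_integral_mono)
    fix t :: real
    consider "t \<le> 0" | "0 < t" "t \<le> 1" | "t > 1" by linarith
    then show "ennreal (rpowr (a - 1) t * heat t x) \<le> ennreal (t powr (a - 1)) * indicator {0..1} t
        + ennreal C * (ennreal (t powr ?b) * indicator {1..} t)"
    proof cases
      case 2
      have "t powr (a - 1) * heat t x \<le> t powr (a - 1) * 1"
        using 2 by (intro mult_left_mono heat_le_1) auto
      with 2 show ?thesis by (auto simp: rpowr_def intro!: add_increasing2 ennreal_leI)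
    next
      case 3
      have "t powr (a - 1) * heat t x \<le> t powr (a - 1) * (C * t powr (- (real CARD('d) / 2)))"
        using 3 C(2)[of t] heat_le_heat_0[of t x] by (intro mult_left_mono) auto
      also have "\<dots> = C * t powr ?b" using 3 by (simp add: powr_add[symmetric] mult.left_commute)
      finally show ?thesis using 3 C(1) by (auto simp: rpowr_def intro!: ennreal_leI simp flip: ennreal_mult)
    qed (simp add: rpowr_def)
  qed
  also have "\<dots> = (\<integral>\<^sup>+t. ennreal (t powr (a - 1)) * indicator {0..1} t \<partial>lborel)
      + ennreal C * (\<integral>\<^sup>+t. ennreal (t powr ?b) * indicator {1..} t \<partial>lborel)"
    by (subst nn_integral_add) (auto simp: nn_integral_cmult)
  also have "\<dots> < top"
    using nn_integral_powr_near_0[of "a - 1"] nn_integral_powr_near_inf[of ?b] assms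
    by (simp add: ennreal_mult_less_top)
  finally show ?thesis .
qed

text \<open>At large times the integrand is bounded below by a multiple of \<open>t\<close> to a
  power at least -1. In the borderline case the divergence is logarithmic, which is why the
  inequality in the theorem is strict.\<close>

lemma heat_potential_0_infinite:
  assumes "a \<ge> real CARD('d) / 2"
  shows "heat_potential a (0 :: int ^ 'd::finite) = top"
proof -
  obtain c where c: "c > 0" "\<And>t. t \<ge> 1 \<Longrightarrow> heat t (0 :: int ^ 'd) \<ge> c * t powr (- (real CARD('d) / 2))"
    using heat_0_lower by blast
  let ?b = "a - 1 - real CARD('d) / 2"
  have "top = ennreal c * (\<integral>\<^sup>+t. ennreal (t powr ?b) * indicator {1..} t \<partial>lborel)"
    using assms c(1) by (subst nn_integral_powr_near_inf_diverges) (auto simp: ennreal_mult_top)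
  also have "\<dots> = (\<integral>\<^sup>+t. ennreal c * (ennreal (t powr ?b) * indicator {1..} t) \<partial>lborel)"
    by (simp add: nn_integral_cmult)
  also have "\<dots> \<le> heat_potential a (0 :: int ^ 'd)"
    unfolding heat_potential_def
  proof (rule nn_integral_mono)
    fix t :: real
    show "ennreal c * (ennreal (t powr ?b) * indicator {1..} t) \<le> ennreal (rpowr (a - 1) t * heat t (0 :: int ^ 'd))"
    proof (cases "t \<ge> 1")
      case True
      have "c * t powr ?b = t powr (a - 1) * (c * t powr (- (real CARD('d) / 2)))"
        using True by (simp add: powr_add[symmetric] mult.left_commute)
      also have "\<dots> \<le> t powr (a - 1) * heat t (0 :: int ^ 'd)"
        using c(2)[OF True] by (intro mult_left_mono) auto
      finally show ?thesis
        using True c(1) by (auto simp: rpowr_def intro!: ennreal_leI simp flip: ennreal_mult)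
    qed simp
  qed
  finally show ?thesis by (simp add: top.extremum_unique)
qed

lemma heat_potential_pos: "heat_potential a x > 0"
proof -
  have "(\<integral>\<^sup>+t. ennreal (rpowr (a - 1) t * heat t x) \<partial>lborel) \<noteq> 0"
  proof
    assume "(\<integral>\<^sup>+t. ennreal (rpowr (a - 1) t * heat t x) \<partial>lborel) = 0"
    then have "AE t in lborel. ennreal (rpowr (a - 1) t * heat t x) = 0"
      by (subst (asm) nn_integral_0_iff_AE) auto
    then have "AE t in lborel. (t :: real) \<notin> {0<..}"
      by (rule eventually_mono) (auto simp: rpowr_def ennreal_eq_0_iff mult_le_0_iff dest: heat_pos[of _ x])
    then have "{0<..} \<in> null_sets (lborel :: real measure)"
      by (simp add: AE_iff_null_sets)
    moreover have "emeasure lborel {0<..1 :: real} \<le> emeasure lborel {0 :: real<..}"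
      by (intro emeasure_mono) auto
    ultimately show False by (simp add: null_sets_def)
  qed
  then show ?thesis by (simp add: heat_potential_def zero_less_iff_neq_zero)
qed

section \<open>Products of potentials and decay at infinity\<close>

lemma nn_integral_Beta:
  assumes "a > 0" "b > (0 :: real)"
  shows "(\<integral>\<^sup>+s. ennreal (rpowr (a - 1) s * rpowr (b - 1) (1 - s)) \<partial>lborel) = ennreal (Beta a b)"
proof -
  have "ennreal (Beta a b) = (\<integral>\<^sup>+s. ennreal (s powr (a - 1) * (1 - s) powr (b - 1)) * indicator {0..1} s \<partial>lborel)"
    using nn_integral_has_integral_lebesgue'[OF _ has_integral_Beta_real[OF assms]] by simp
  also have "\<dots> = (\<integral>\<^sup>+s. ennreal (rpowr (a - 1) s * rpowr (b - 1) (1 - s)) \<partial>lborel)"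
    by (intro nn_integral_cong) (auto simp: rpowr_def indicator_def)
  finally show ?thesis ..
qed

text \<open>Substituting \<open>r * s\<close> for \<open>s\<close> reduces the convolution to the
  Beta integral by homogeneity.\<close>

lemma nn_integral_rpowr_convolution:
  assumes "a > 0" "b > 0"
  shows "(\<integral>\<^sup>+s. ennreal (rpowr (a - 1) s * rpowr (b - 1) (r - s)) \<partial>lborel)
    = ennreal (Beta a b) * ennreal (rpowr (a + b - 1) r)"
proof (cases "r > 0")
  case True
  have "(\<integral>\<^sup>+s. ennreal (rpowr (a - 1) s * rpowr (b - 1) (r - s)) \<partial>lborel)
    = ennreal r * (\<integral>\<^sup>+s. ennreal (rpowr (a - 1) (r * s) * rpowr (b - 1) (r - r * s)) \<partial>lborel)"
    using True by (subst nn_integral_real_affine[where c = r and t = 0]) auto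
  also have "\<dots> = ennreal r * (\<integral>\<^sup>+s. ennreal (r powr (a - 1) * r powr (b - 1)) *
      ennreal (rpowr (a - 1) s * rpowr (b - 1) (1 - s)) \<partial>lborel)"
  proof -
    have "rpowr (a - 1) (r * s) * rpowr (b - 1) (r - r * s)
       = r powr (a - 1) * r powr (b - 1) * (rpowr (a - 1) s * rpowr (b - 1) (1 - s))" for s
      using rpowr_mult_left[OF True, of "b - 1" "1 - s"]
      by (simp add: rpowr_mult_left[OF True] right_diff_distrib)
    then show ?thesis by (simp add: ennreal_mult)
  qed
  also have "\<dots> = ennreal r * (ennreal (r powr (a - 1) * r powr (b - 1)) * ennreal (Beta a b))"
    by (subst nn_integral_cmult) (auto simp: nn_integral_Beta[OF assms])
  also have "\<dots> = ennreal (Beta a b) * ennreal (r * (r powr (a - 1) * r powr (b - 1)))"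
    using True by (simp add: ennreal_mult ac_simps)
  also have "r * (r powr (a - 1) * r powr (b - 1)) = rpowr (a + b - 1) r"
    using True powr_add[of r 1 "(a - 1) + (b - 1)"] by (simp add: rpowr_def powr_add[symmetric])
  finally show ?thesis .
next
  case False
  then have zero: "ennreal (rpowr (a - 1) s * rpowr (b - 1) (r - s)) = 0" for s
    by (auto simp: rpowr_def)
  show ?thesis unfolding zero using False by (simp add: rpowr_def)
qed

text \<open>Tonelli applies because the counting measure of a countable type is
  sigma-finite.\<close>

lemma nn_integral_count_space_lborel_swap:
  fixes f :: "'a::countable \<Rightarrow> real \<Rightarrow> ennreal"
  assumes "\<And>x. f x \<in> borel_measurable borel"
  shows "(\<integral>\<^sup>+x. \<integral>\<^sup>+t. f x t \<partial>lborel \<partial>count_space UNIV) = (\<integral>\<^sup>+t. \<integral>\<^sup>+x. f x t \<partial>count_space UNIV \<partial>lborel)"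
proof -
  interpret count: sigma_finite_measure "count_space (UNIV :: 'a set)"
    by (rule sigma_finite_measure_count_space_countable) simp
  interpret pair_sigma_finite "count_space (UNIV :: 'a set)" "lborel :: real measure" ..
  have m: "case_prod f \<in> borel_measurable (count_space UNIV \<Otimes>\<^sub>M lborel)"
    using assms by (intro measurable_pair_measure_countable1) auto
  show "(\<integral>\<^sup>+x. \<integral>\<^sup>+t. f x t \<partial>lborel \<partial>count_space UNIV) = (\<integral>\<^sup>+t. \<integral>\<^sup>+x. f x t \<partial>count_space UNIV \<partial>lborel)"
    using Fubini'[OF m] by simp
qed

lemma heat_measurable2 [measurable]:
  assumes [measurable]: "f \<in> borel_measurable M"
  shows "(\<lambda>z. heat (f z) x) \<in> borel_measurable M"
  by (rule measurable_compose[OF assms heat_measurable])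

text \<open>The sum over \<open>x\<close> of \<open>heat s x * heat t x\<close> is
  \<open>heat (s + t) 0\<close>. With \<open>r = s + t\<close> fixed, the two powers of time
  convolve to a Beta multiple of one power. All integrands are nonnegative, so the identity also
  holds when both sides are infinite.\<close>

lemma nn_integral_heat_potential_mult:
  fixes a b :: real
  assumes "a > 0" "b > 0"
  shows "(\<integral>\<^sup>+x. heat_potential a x * heat_potential b (x :: int ^ 'd::finite) \<partial>count_space UNIV)
    = ennreal (Beta a b) * heat_potential (a + b) (0 :: int ^ 'd)"
proof -
  let ?p = "\<lambda>t x. ennreal (heat t (x :: int ^ 'd))"
  let ?r = "\<lambda>a t. ennreal (rpowr (a - 1) t)"
  have split: "ennreal (rpowr c t * heat t x) = ennreal (rpowr c t) * ?p t x" for c t x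
    by (cases "t > 0") (auto simp: rpowr_def ennreal_mult)
  have conv: "?r a s * (?r b t * (\<integral>\<^sup>+x. ?p s x * ?p t x \<partial>count_space UNIV))
      = ?r a s * (?r b t * ?p (s + t) 0)" for s t
  proof (cases "s > 0 \<and> t > 0")
    case True
    then show ?thesis using heat_semigroup[of s t "0 :: int ^ 'd"] by simp
  qed (auto simp: rpowr_def)
  have "(\<integral>\<^sup>+x. heat_potential a x * heat_potential b (x :: int ^ 'd) \<partial>count_space UNIV)
      = (\<integral>\<^sup>+x. \<integral>\<^sup>+s. \<integral>\<^sup>+t. ?r a s * (?r b t * (?p s x * ?p t x)) \<partial>lborel \<partial>lborel \<partial>count_space UNIV)"
  proof (intro nn_integral_cong)
    fix x :: "int ^ 'd"
    have "heat_potential a x * heat_potential b x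
        = (\<integral>\<^sup>+s. (?r a s * ?p s x) * heat_potential b x \<partial>lborel)"
      unfolding heat_potential_def[of a] split by (rule nn_integral_multc[symmetric]) measurable
    also have "\<dots> = (\<integral>\<^sup>+s. \<integral>\<^sup>+t. (?r a s * ?p s x) * (?r b t * ?p t x) \<partial>lborel \<partial>lborel)"
      unfolding heat_potential_def split
      by (intro nn_integral_cong nn_integral_cmult[symmetric]) measurable
    finally show "heat_potential a x * heat_potential b x
        = (\<integral>\<^sup>+s. \<integral>\<^sup>+t. ?r a s * (?r b t * (?p s x * ?p t x)) \<partial>lborel \<partial>lborel)"
      by (simp add: mult_ac)
  qed
  also have "\<dots> = (\<integral>\<^sup>+s. \<integral>\<^sup>+x. \<integral>\<^sup>+t. ?r a s * (?r b t * (?p s x * ?p t x)) \<partial>lborel \<partial>count_space UNIV \<partial>lborel)"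
    by (rule nn_integral_count_space_lborel_swap) measurable
  also have "\<dots> = (\<integral>\<^sup>+s. \<integral>\<^sup>+t. \<integral>\<^sup>+x. ?r a s * (?r b t * (?p s x * ?p t x)) \<partial>count_space UNIV \<partial>lborel \<partial>lborel)"
    by (intro nn_integral_cong nn_integral_count_space_lborel_swap) measurable
  also have "\<dots> = (\<integral>\<^sup>+s. \<integral>\<^sup>+t. ?r a s * (?r b t * ?p (s + t) 0) \<partial>lborel \<partial>lborel)"
    by (simp add: nn_integral_cmult conv)
  also have "\<dots> = (\<integral>\<^sup>+s. \<integral>\<^sup>+r. ?r a s * (?r b (r - s) * ?p r 0) \<partial>lborel \<partial>lborel)"
  proof (rule nn_integral_cong)
    fix s :: real
    show "(\<integral>\<^sup>+t. ?r a s * (?r b t * ?p (s + t) 0) \<partial>lborel) = (\<integral>\<^sup>+r. ?r a s * (?r b (r - s) * ?p r 0) \<partial>lborel)"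
      by (subst nn_integral_real_affine[where c = 1 and t = s and f = "\<lambda>r. ?r a s * (?r b (r - s) * ?p r 0)"]) auto
  qed
  also have "\<dots> = (\<integral>\<^sup>+r. \<integral>\<^sup>+s. ?r a s * (?r b (r - s) * ?p r 0) \<partial>lborel \<partial>lborel)"
    by (intro lborel_pair.Fubini') measurable
  also have "\<dots> = (\<integral>\<^sup>+r. ennreal (Beta a b) * ennreal (rpowr (a + b - 1) r * heat r (0 :: int ^ 'd)) \<partial>lborel)"
  proof (rule nn_integral_cong)
    fix r :: real
    have "(\<integral>\<^sup>+s. ?r a s * (?r b (r - s) * ?p r 0) \<partial>lborel)
       = (\<integral>\<^sup>+s. ennreal (rpowr (a - 1) s * rpowr (b - 1) (r - s)) * ?p r 0 \<partial>lborel)"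
      by (simp add: ennreal_mult mult.assoc)
    also have "\<dots> = (\<integral>\<^sup>+s. ennreal (rpowr (a - 1) s * rpowr (b - 1) (r - s)) \<partial>lborel) * ?p r 0"
      by (rule nn_integral_multc) measurable
    finally show "(\<integral>\<^sup>+s. ?r a s * (?r b (r - s) * ?p r 0) \<partial>lborel)
        = ennreal (Beta a b) * ennreal (rpowr (a + b - 1) r * heat r (0 :: int ^ 'd))"
      by (simp add: nn_integral_rpowr_convolution[OF assms] split mult.assoc)
  qed
  also have "\<dots> = ennreal (Beta a b) * heat_potential (a + b) (0 :: int ^ 'd)"
    unfolding heat_potential_def by (rule nn_integral_cmult) measurable
  finally show ?thesis .
qed

text \<open>An infinite superlevel set contains an injective sequence. Along it
  \<open>heat t\<close> tends to zero for each \<open>t\<close>, being summable over the lattice,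
  and \<open>heat t 0\<close> dominates, so the potential tends to zero along the sequence as
  well.\<close>

lemma heat_potential_superlevel_finite:
  fixes \<epsilon> :: ennreal
  assumes a: "0 < a" "a < real CARD('d) / 2" and \<epsilon>: "\<epsilon> > 0"
  shows "finite {x :: int ^ 'd::finite. heat_potential a x > \<epsilon>}"
proof (rule ccontr)
  assume "infinite {x :: int ^ 'd. heat_potential a x > \<epsilon>}"
  then obtain f :: "nat \<Rightarrow> int ^ 'd" where f: "inj f" "range f \<subseteq> {x. heat_potential a x > \<epsilon>}"
    using infinite_countable_subset by blast
  have "(\<lambda>n. heat_potential a (f n)) \<longlonglongrightarrow> (\<integral>\<^sup>+t. 0 \<partial>(lborel :: real measure))"
    unfolding heat_potential_def
  proof (rule nn_integral_dominated_convergence[where w = "\<lambda>t. ennreal (rpowr (a - 1) t * heat t (0 :: int ^ 'd))"])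
    show "(\<integral>\<^sup>+t. ennreal (rpowr (a - 1) t * heat t (0 :: int ^ 'd)) \<partial>lborel) < \<infinity>"
      using heat_potential_finite[OF a, of 0] by (simp add: heat_potential_def)
    show "AE t in lborel. ennreal (rpowr (a - 1) t * heat t (f n)) \<le> ennreal (rpowr (a - 1) t * heat t (0 :: int ^ 'd))" for n
      by (intro always_eventually allI ennreal_leI)
         (auto simp: rpowr_def intro!: mult_left_mono heat_le_heat_0)
    show "AE t in lborel. (\<lambda>n. ennreal (rpowr (a - 1) t * heat t (f n))) \<longlonglongrightarrow> 0"
    proof (intro always_eventually allI)
      fix t :: real
      show "(\<lambda>n. ennreal (rpowr (a - 1) t * heat t (f n))) \<longlonglongrightarrow> 0"
      proof (cases "t > 0")
        case True
        have "(\<Sum>n. ennreal (heat t (f n))) = (\<integral>\<^sup>+x. ennreal (heat t x) \<partial>count_space (range f))"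
          using nn_integral_bij_count_space[OF inj_on_imp_bij_betw[OF f(1)], of "\<lambda>x. ennreal (heat t x)"]
          by (simp add: nn_integral_count_space_nat)
        also have "\<dots> \<le> (\<integral>\<^sup>+x. ennreal (heat t (x :: int ^ 'd)) \<partial>count_space UNIV)"
          by (subst nn_integral_count_space_indicator) (auto intro!: nn_integral_mono simp: indicator_def)
        also have "\<dots> = 1" using True by (intro nn_integral_heat) simp
        finally have "(\<Sum>n. ennreal (heat t (f n))) \<noteq> top" by (auto simp: top_unique)
        then have "summable (\<lambda>n. heat t (f n))" using True by (intro summable_suminf_not_top) auto
        then have "(\<lambda>n. heat t (f n)) \<longlonglongrightarrow> 0" by (rule summable_LIMSEQ_zero)
        then have "(\<lambda>n. rpowr (a - 1) t * heat t (f n)) \<longlonglongrightarrow> rpowr (a - 1) t * 0"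
          by (intro tendsto_intros)
        then show ?thesis by (subst ennreal_0[symmetric], intro tendsto_ennrealI) simp
      qed (simp add: rpowr_def)
    qed
  qed measurable
  then have "(\<lambda>n. heat_potential a (f n)) \<longlonglongrightarrow> 0" by simp
  from order_tendstoD(2)[OF this \<epsilon>] obtain n where "heat_potential a (f n) < \<epsilon>"
    using eventually_happens'[OF sequentially_bot] by blast
  moreover have "heat_potential a (f n) > \<epsilon>" using f(2) by auto
  ultimately show False by simp
qed

section \<open>The fractional difference kernel\<close>

lemma nn_integral_count_space_remove:
  fixes f :: "'a \<Rightarrow> ennreal"
  shows "(\<integral>\<^sup>+x. f x \<partial>count_space UNIV) = f a + (\<integral>\<^sup>+x. (if x = a then 0 else f x) \<partial>count_space UNIV)"
proof -
  have "(\<integral>\<^sup>+x. f x \<partial>count_space UNIV)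
      = (\<integral>\<^sup>+x. f a * indicator {a} x + (if x = a then 0 else f x) \<partial>count_space UNIV)"
    by (intro nn_integral_cong) (auto simp: indicator_def)
  then show ?thesis by (simp add: nn_integral_add one_ennreal_def[symmetric])
qed

lemma has_bochner_integral_nn:
  fixes f :: "real \<Rightarrow> real"
  assumes "f \<in> borel_measurable borel" "\<And>x. f x \<ge> 0" "c \<ge> 0" "(\<integral>\<^sup>+x. ennreal (f x) \<partial>lborel) = ennreal c"
  shows "has_bochner_integral lborel f c"
  by (rule has_bochner_integral_nn_integral) (use assms in auto)

text \<open>The bracket vanishes to first order at 0, which leaves a multiple of
  \<open>s powr (1 - \<sigma>)\<close>. This is the boundary term of the integration by parts
  below.\<close>

lemma tendsto_fractional_boundary:
  fixes \<sigma> \<alpha> :: real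
  assumes "\<sigma> < 1"
  shows "((\<lambda>s. s powr (- \<sigma>) * (1 - (1 - s) powr \<alpha>)) \<longlongrightarrow> 0) (at_right 0)"
proof -
  have "((\<lambda>s. (1 - s) powr \<alpha>) has_real_derivative - \<alpha>) (at 0)"
    by (auto intro!: derivative_eq_intros)
  then have "((\<lambda>s. ((1 - s) powr \<alpha> - 1) / s) \<longlongrightarrow> - \<alpha>) (at_right 0)"
    unfolding has_field_derivative_iff by (simp add: filterlim_at_split)
  moreover have "((\<lambda>s::real. s powr (1 - \<sigma>)) \<longlongrightarrow> 0) (at_right 0)"
    using assms by (intro tendsto_zero_powrI[where f = "\<lambda>s. s" and g = "\<lambda>_. 1 - \<sigma>", OF _ tendsto_const])
      (auto simp: eventually_at_filter)
  ultimately have "((\<lambda>s. - (s powr (1 - \<sigma>) * (((1 - s) powr \<alpha> - 1) / s))) \<longlongrightarrow> 0) (at_right 0)"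
    using tendsto_minus[OF tendsto_mult] by fastforce
  moreover have "\<forall>\<^sub>F s in at_right 0. - (s powr (1 - \<sigma>) * (((1 - s) powr \<alpha> - 1) / s))
      = s powr (- \<sigma>) * (1 - (1 - s) powr \<alpha>)"
    unfolding eventually_at_filter
  proof (intro always_eventually allI impI)
    fix s :: real assume "s \<noteq> 0" "s \<in> {0<..}"
    then show "- (s powr (1 - \<sigma>) * (((1 - s) powr \<alpha> - 1) / s)) = s powr (- \<sigma>) * (1 - (1 - s) powr \<alpha>)"
      by (simp add: powr_diff powr_minus_divide field_simps)
  qed
  ultimately show ?thesis by (rule Lim_transform_eventually)
qed

text \<open>Integration by parts: differentiating \<open>?F\<close> gives the wanted integrand minus
  \<open>\<alpha> / \<sigma>\<close> times the Beta integrand with parameters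
  \<open>1 - \<sigma>\<close> and \<alpha>. The boundary value at 1 contributes
  \<open>- 1 / \<sigma>\<close>, the one at 0 nothing.\<close>

lemma has_integral_fractional_remainder:
  fixes \<sigma> \<alpha> :: real
  assumes \<sigma>: "0 < \<sigma>" "\<sigma> < 1" and \<alpha>: "0 < \<alpha>"
  shows "((\<lambda>s. s powr (- 1 - \<sigma>) * (1 - (1 - s) powr \<alpha>)) has_integral
    \<alpha> / \<sigma> * Beta (1 - \<sigma>) \<alpha> - 1 / \<sigma>) {0..1}"
proof -
  let ?F = "\<lambda>s. - (s powr (- \<sigma>) * (1 - (1 - s) powr \<alpha>)) / \<sigma>"
  let ?f = "\<lambda>s. s powr (- 1 - \<sigma>) * (1 - (1 - s) powr \<alpha>)"
  let ?b = "\<lambda>s. s powr (1 - \<sigma> - 1) * (1 - s) powr (\<alpha> - 1)"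
  have "((\<lambda>s. ?f s - \<alpha> / \<sigma> * ?b s) has_integral ?F 1 - ?F 0) {0..1}"
  proof (rule fundamental_theorem_of_calculus_interior)
    show "continuous_on {0..1} ?F"
      unfolding continuous_on_eq_continuous_within
    proof
      fix s :: real assume s: "s \<in> {0..1}"
      show "continuous (at s within {0..1}) ?F"
      proof (cases "s = 0")
        case True
        have "(?F \<longlongrightarrow> - 0 / \<sigma>) (at_right 0)"
          by (intro tendsto_intros tendsto_fractional_boundary) (use \<sigma> in auto)
        moreover have "at 0 within {0..1} = at_right (0 :: real)"
          by (rule at_within_Icc_at_right) simp
        ultimately show ?thesis by (simp add: continuous_within True)
      next
        case False
        have "continuous_on {0<..1} ?F"
          using \<sigma> \<alpha> by (intro continuous_on_divide continuous_on_minus continuous_on_mult continuous_on_diff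
              continuous_on_powr' continuous_on_const continuous_on_id) auto
        then have "continuous (at s within {0<..1}) ?F"
          using s False by (simp add: continuous_on_eq_continuous_within)
        moreover have "at s within {0<..1} = at s within {0..1}"
          by (rule at_within_nhd[of s "{0<..}"]) (use s False in auto)
        ultimately show ?thesis by simp
      qed
    qed
    fix s :: real assume s: "s \<in> {0<..<1}"
    have "(?F has_real_derivative ?f s - \<alpha> / \<sigma> * ?b s) (at s)"
      using s \<sigma> by (auto intro!: derivative_eq_intros simp: field_simps powr_diff powr_minus)
    then show "(?F has_vector_derivative ?f s - \<alpha> / \<sigma> * ?b s) (at s)"
      by (simp add: has_real_derivative_iff_has_vector_derivative)
  qed simp
  from has_integral_add[OF this has_integral_mult_right[OF has_integral_Beta_real, of "1 - \<sigma>" \<alpha> "\<alpha> / \<sigma>"]]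
  show ?thesis using assms by simp
qed

text \<open>Integrated in \<open>t\<close> against \<open>heat t x\<close>, this gives
  \<open>rpowr (- \<sigma> - 1) s\<close> times the difference between the potential at
  \<open>x\<close> and its image under the heat semigroup at time \<open>s\<close>.\<close>

definition fractional_kernel :: "real \<Rightarrow> real \<Rightarrow> real \<Rightarrow> real \<Rightarrow> real" where
  "fractional_kernel \<sigma> \<alpha> t s = rpowr (- \<sigma> - 1) s * (rpowr (\<alpha> - 1) t - rpowr (\<alpha> - 1) (t - s))"

lemma fractional_kernel_measurable [measurable]:
  assumes [measurable]: "f \<in> borel_measurable M" "g \<in> borel_measurable M"
  shows "(\<lambda>x. fractional_kernel \<sigma> \<alpha> (f x) (g x)) \<in> borel_measurable M"
  unfolding fractional_kernel_def by measurable

lemma abs_Gamma_uminus: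
  assumes "0 < \<sigma>" "\<sigma> < (1 :: real)"
  shows "\<bar>Gamma (- \<sigma>)\<bar> = Gamma (1 - \<sigma>) / \<sigma>"
proof -
  have "Gamma (- \<sigma> + 1) = - \<sigma> * Gamma (- \<sigma>)"
    by (rule Gamma_plus1) (rule uminus_notin_nonpos_Ints[OF assms])
  moreover have "Gamma (1 - \<sigma>) > 0" using assms by simp
  ultimately have "\<bar>\<sigma> * Gamma (- \<sigma>)\<bar> = Gamma (1 - \<sigma>)" by (simp add: add.commute)
  then show ?thesis using assms by (simp add: abs_mult field_simps)
qed

text \<open>Splitting off \<open>s * (1 - s) powr (\<alpha> - 1)\<close> makes every piece of a fixed sign.\<close>
lemma has_bochner_integral_fractional_kernel_1:
  assumes \<sigma>: "0 < \<sigma>" "\<sigma> < 1" and \<alpha>: "\<sigma> < \<alpha>"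
  shows "has_bochner_integral lborel (fractional_kernel \<sigma> \<alpha> 1)
    (\<bar>Gamma (- \<sigma>)\<bar> * Gamma \<alpha> / Gamma (\<alpha> - \<sigma>))"
proof -
  define B where "B = Beta (1 - \<sigma>) \<alpha>"
  \<comment> \<open>The sign of \<open>1 - (1 - s) powr (\<alpha> - 1)\<close> depends on whether
    \<alpha> exceeds 1. With exponent \<alpha> the bracket in \<open>?A\<close> is nonnegative,
    \<open>?B\<close> is the correction, and \<open>?C\<close> is the tail beyond
    \<open>t = 1\<close>, where the shifted power has died out.\<close>
  let ?A = "\<lambda>s. indicator {0..1} s * (s powr (- 1 - \<sigma>) * (1 - (1 - s) powr \<alpha>)) :: real"
  let ?B = "\<lambda>s. rpowr (1 - \<sigma> - 1) s * rpowr (\<alpha> - 1) (1 - s)"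
  let ?C = "\<lambda>s. indicator {1<..} s * s powr (- 1 - \<sigma>) :: real"
  have A0: "s powr (- 1 - \<sigma>) * (1 - (1 - s) powr \<alpha>) \<ge> 0" if "s \<in> {0..1}" for s
    using that \<sigma> \<alpha> by (auto intro!: mult_nonneg_nonneg powr_le1)
  have "has_bochner_integral lborel ?A (\<alpha> / \<sigma> * B - 1 / \<sigma>)"
  proof (rule has_bochner_integral_nn)
    show "?A s \<ge> 0" for s using A0[of s] by (simp add: indicator_def)
    have int: "((\<lambda>s. s powr (- 1 - \<sigma>) * (1 - (1 - s) powr \<alpha>)) has_integral \<alpha> / \<sigma> * B - 1 / \<sigma>) {0..1}"
      unfolding B_def using \<sigma> \<alpha> by (intro has_integral_fractional_remainder) auto
    then show "\<alpha> / \<sigma> * B - 1 / \<sigma> \<ge> 0" by (rule has_integral_nonneg) (rule A0)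
    show "(\<integral>\<^sup>+s. ennreal (?A s) \<partial>lborel) = ennreal (\<alpha> / \<sigma> * B - 1 / \<sigma>)"
      using nn_integral_has_integral_lebesgue[OF A0 int] by simp
  qed measurable
  moreover have "has_bochner_integral lborel ?B B"
  proof (rule has_bochner_integral_nn)
    show "(\<integral>\<^sup>+s. ennreal (?B s) \<partial>lborel) = ennreal B"
      unfolding B_def using \<sigma> \<alpha> by (intro nn_integral_Beta) auto
    show "B \<ge> 0" using \<sigma> \<alpha> by (auto simp: B_def Beta_def intro!: divide_nonneg_nonneg mult_nonneg_nonneg Gamma_real_nonneg)
  qed auto
  moreover have "has_bochner_integral lborel ?C (1 / \<sigma>)"
  proof (rule has_bochner_integral_nn)
    have "((\<lambda>s::real. s powr (- 1 - \<sigma>)) has_integral 1 / \<sigma>) {1..}"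
      using has_integral_powr_to_inf[of "- 1 - \<sigma>" 1] \<sigma> by simp
    then have "(\<integral>\<^sup>+s. ennreal (indicator {1..} s * s powr (- 1 - \<sigma>)) \<partial>lborel) = ennreal (1 / \<sigma>)"
      using nn_integral_has_integral_lebesgue[of "{1..}" "\<lambda>s. s powr (- 1 - \<sigma>)"] by simp
    moreover have "(\<integral>\<^sup>+s. ennreal (indicator {1..} s * s powr (- 1 - \<sigma>)) \<partial>lborel)
        = (\<integral>\<^sup>+s. ennreal (?C s) \<partial>lborel)"
      by (intro nn_integral_cong_AE eventually_mono[OF AE_lborel_singleton[of 1]]) (auto simp: indicator_def)
    ultimately show "(\<integral>\<^sup>+s. ennreal (?C s) \<partial>lborel) = ennreal (1 / \<sigma>)" by simp
  qed (use \<sigma> in auto)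
  ultimately have "has_bochner_integral lborel (\<lambda>s. ?A s - ?B s + ?C s) (\<alpha> / \<sigma> * B - 1 / \<sigma> - B + 1 / \<sigma>)"
    by (intro has_bochner_integral_add has_bochner_integral_diff)
  moreover have "(\<lambda>s. ?A s - ?B s + ?C s) = fractional_kernel \<sigma> \<alpha> 1"
  proof
    fix s :: real
    have e: "- \<sigma> - 1 = - 1 - \<sigma>" by simp
    consider "s \<le> 0" | "0 < s" "s < 1" | "s = 1" | "s > 1" by linarith
    then show "?A s - ?B s + ?C s = fractional_kernel \<sigma> \<alpha> 1 s"
    proof cases
      case 2
      have "fractional_kernel \<sigma> \<alpha> 1 s = s powr (- 1 - \<sigma>) * (1 - (1 - s) powr (\<alpha> - 1))"
        unfolding fractional_kernel_def e using 2 by (simp add: rpowr_def)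
      moreover have "?A s - ?B s + ?C s
          = s powr (- 1 - \<sigma>) * (1 - (1 - s) powr \<alpha>) - s powr (- \<sigma>) * (1 - s) powr (\<alpha> - 1)"
        using 2 by (simp add: rpowr_def)
      moreover have "s powr (- \<sigma>) = s * s powr (- 1 - \<sigma>)"
        using powr_add[of s 1 "- 1 - \<sigma>"] 2 by simp
      moreover have "(1 - s) powr \<alpha> = (1 - s) * (1 - s) powr (\<alpha> - 1)"
        using powr_add[of "1 - s" 1 "\<alpha> - 1"] 2 by simp
      ultimately show ?thesis
        by (simp only:) (simp add: algebra_simps)
    qed (auto simp: fractional_kernel_def e rpowr_def indicator_def)
  qed
  \<comment> \<open>The tail cancels the boundary value of the integration by parts, leaving
    \<open>(\<alpha> - \<sigma>) / \<sigma> * B\<close>; the functional equation of Gamma absorbs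
    both factors.\<close>
  moreover have "\<alpha> / \<sigma> * B - 1 / \<sigma> - B + 1 / \<sigma> = \<bar>Gamma (- \<sigma>)\<bar> * Gamma \<alpha> / Gamma (\<alpha> - \<sigma>)"
  proof -
    have "Gamma (1 - \<sigma> + \<alpha>) = (\<alpha> - \<sigma>) * Gamma (\<alpha> - \<sigma>)"
      using Gamma_plus1[of "\<alpha> - \<sigma>"] \<alpha> by (fastforce simp: add.commute add_diff_eq dest: nonpos_Ints_nonpos)
    then have "B = Gamma (1 - \<sigma>) * Gamma \<alpha> / ((\<alpha> - \<sigma>) * Gamma (\<alpha> - \<sigma>))"
      by (simp add: B_def Beta_def)
    moreover have "\<alpha> / \<sigma> * B - 1 / \<sigma> - B + 1 / \<sigma> = (\<alpha> - \<sigma>) / \<sigma> * B"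
      using \<sigma> by (simp add: field_simps)
    moreover have "Gamma (\<alpha> - \<sigma>) \<noteq> 0" using \<alpha> by (intro less_imp_neq[THEN not_sym] Gamma_real_pos) simp
    ultimately show ?thesis
      using \<sigma> \<alpha> by (simp add: abs_Gamma_uminus field_simps)
  qed
  ultimately show ?thesis by simp
qed

text \<open>The kernel is homogeneous of degree \<open>\<alpha> - \<sigma> - 2\<close> in
  \<open>t\<close> and \<open>s\<close> jointly, and the substitution contributes one more power of
  \<open>t\<close>. The absolute version scales in the same way and supplies the integrability for
  Fubini.\<close>

lemma has_bochner_integral_fractional_kernel:
  assumes \<sigma>: "0 < \<sigma>" "\<sigma> < 1" and \<alpha>: "\<sigma> < \<alpha>"
  shows "has_bochner_integral lborel (fractional_kernel \<sigma> \<alpha> t)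
      (rpowr (\<alpha> - \<sigma> - 1) t * (\<bar>Gamma (- \<sigma>)\<bar> * Gamma \<alpha> / Gamma (\<alpha> - \<sigma>)))"
    and "has_bochner_integral lborel (\<lambda>s. \<bar>fractional_kernel \<sigma> \<alpha> t s\<bar>)
      (rpowr (\<alpha> - \<sigma> - 1) t * (\<integral>s. \<bar>fractional_kernel \<sigma> \<alpha> 1 s\<bar> \<partial>lborel))"
proof -
  define I where "I = \<bar>Gamma (- \<sigma>)\<bar> * Gamma \<alpha> / Gamma (\<alpha> - \<sigma>)"
  define J where "J = (\<integral>s. \<bar>fractional_kernel \<sigma> \<alpha> 1 s\<bar> \<partial>lborel)"
  have 1: "has_bochner_integral lborel (fractional_kernel \<sigma> \<alpha> 1) I"
    unfolding I_def by (rule has_bochner_integral_fractional_kernel_1) fact+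
  then have 2: "has_bochner_integral lborel (\<lambda>s. \<bar>fractional_kernel \<sigma> \<alpha> 1 s\<bar>) J"
    unfolding J_def by (intro has_bochner_integral_integrable integrable_abs) (auto simp: has_bochner_integral_iff)
  have "has_bochner_integral lborel (fractional_kernel \<sigma> \<alpha> t) (rpowr (\<alpha> - \<sigma> - 1) t * I) \<and>
      has_bochner_integral lborel (\<lambda>s. \<bar>fractional_kernel \<sigma> \<alpha> t s\<bar>) (rpowr (\<alpha> - \<sigma> - 1) t * J)"
  proof (cases "t > 0")
    case True
    have scale: "fractional_kernel \<sigma> \<alpha> t (t * s) = t powr (\<alpha> - \<sigma> - 2) * fractional_kernel \<sigma> \<alpha> 1 s" for s
    proof -
      have "rpowr (\<alpha> - 1) (t - t * s) = t powr (\<alpha> - 1) * rpowr (\<alpha> - 1) (1 - s)"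
        using rpowr_mult_left[OF True, of "\<alpha> - 1" "1 - s"] by (simp add: right_diff_distrib)
      moreover have "t powr (\<alpha> - \<sigma> - 2) = t powr (- \<sigma> - 1) * t powr (\<alpha> - 1)"
        by (simp add: powr_add[symmetric])
      moreover have "rpowr (\<alpha> - 1) t = t powr (\<alpha> - 1) * rpowr (\<alpha> - 1) 1"
        using rpowr_mult_left[OF True, of "\<alpha> - 1" 1] by simp
      ultimately show ?thesis
        unfolding fractional_kernel_def rpowr_mult_left[OF True] by (simp add: algebra_simps)
    qed
    have eq: "t powr (\<alpha> - \<sigma> - 2) * c = (rpowr (\<alpha> - \<sigma> - 1) t * c) /\<^sub>R \<bar>t\<bar>" for c
    proof -
      have "t powr (\<alpha> - \<sigma> - 1) = t * t powr (\<alpha> - \<sigma> - 2)"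
        using powr_add[of t 1 "\<alpha> - \<sigma> - 2"] True by simp
      then show ?thesis using True by (simp add: rpowr_def)
    qed
    have "has_bochner_integral lborel (fractional_kernel \<sigma> \<alpha> t) (rpowr (\<alpha> - \<sigma> - 1) t * I)"
      using has_bochner_integral_mult_right[of "t powr (\<alpha> - \<sigma> - 2)", OF 1] True
      by (subst lborel_has_bochner_integral_real_affine_iff[where c = t and t = 0]) (auto simp: scale eq)
    moreover have "has_bochner_integral lborel (\<lambda>s. \<bar>fractional_kernel \<sigma> \<alpha> t s\<bar>) (rpowr (\<alpha> - \<sigma> - 1) t * J)"
      using has_bochner_integral_mult_right[of "t powr (\<alpha> - \<sigma> - 2)", OF 2] True
      by (subst lborel_has_bochner_integral_real_affine_iff[where c = t and t = 0]) (auto simp: scale eq abs_mult)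
    ultimately show ?thesis ..
  next
    case False
    then have "fractional_kernel \<sigma> \<alpha> t = (\<lambda>_. 0)"
      by (auto simp: fractional_kernel_def rpowr_def fun_eq_iff)
    then show ?thesis using False by (simp add: rpowr_def has_bochner_integral_zero)
  qed
  then show "has_bochner_integral lborel (fractional_kernel \<sigma> \<alpha> t)
      (rpowr (\<alpha> - \<sigma> - 1) t * (\<bar>Gamma (- \<sigma>)\<bar> * Gamma \<alpha> / Gamma (\<alpha> - \<sigma>)))"
    and "has_bochner_integral lborel (\<lambda>s. \<bar>fractional_kernel \<sigma> \<alpha> t s\<bar>)
      (rpowr (\<alpha> - \<sigma> - 1) t * (\<integral>s. \<bar>fractional_kernel \<sigma> \<alpha> 1 s\<bar> \<partial>lborel))"
    by (simp_all add: I_def J_def)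
qed

section \<open>The fractional Laplacian of a potential\<close>

text \<open>A multiple of \<open>kappa \<sigma>\<close>. The origin is cut out because the time
  integral diverges there.\<close>

definition jump_kernel :: "real \<Rightarrow> int ^ 'd::finite \<Rightarrow> ennreal" where
  "jump_kernel \<sigma> z = (if z = 0 then 0 else heat_potential (- \<sigma>) z)"

lemma nn_integral_heat_off_origin:
  assumes "s > 0"
  shows "(\<integral>\<^sup>+z. (if z = 0 then 0 else ennreal (heat s (z :: int ^ 'd::finite))) \<partial>count_space UNIV)
    = ennreal (1 - heat s (0 :: int ^ 'd))"
proof -
  let ?S = "\<integral>\<^sup>+z. (if z = 0 then 0 else ennreal (heat s (z :: int ^ 'd))) \<partial>count_space UNIV"
  have h: "0 \<le> heat s (0 :: int ^ 'd)" "heat s (0 :: int ^ 'd) \<le> 1"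
    using assms heat_le_1[of s "0 :: int ^ 'd"] by simp_all
  have "ennreal (heat s (0 :: int ^ 'd)) + ?S = 1"
    using nn_integral_count_space_remove[of "\<lambda>z. ennreal (heat s (z :: int ^ 'd))" 0]
      nn_integral_heat[of s, where 'd = 'd] assms
    by simp
  also have "\<dots> = ennreal (heat s (0 :: int ^ 'd)) + ennreal (1 - heat s (0 :: int ^ 'd))"
    using h by (simp flip: ennreal_plus)
  finally show ?thesis by (simp add: ennreal_add_left_cancel)
qed

lemma nn_integral_jump_kernel:
  "(\<integral>\<^sup>+z. jump_kernel \<sigma> (z :: int ^ 'd::finite) \<partial>count_space UNIV)
    = (\<integral>\<^sup>+s. ennreal (rpowr (- \<sigma> - 1) s * (1 - heat s (0 :: int ^ 'd))) \<partial>lborel)"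
proof -
  have "(\<integral>\<^sup>+z. jump_kernel \<sigma> (z :: int ^ 'd) \<partial>count_space UNIV)
    = (\<integral>\<^sup>+z. \<integral>\<^sup>+s. (if z = 0 then 0 else ennreal (rpowr (- \<sigma> - 1) s * heat s (z :: int ^ 'd))) \<partial>lborel \<partial>count_space UNIV)"
    by (intro nn_integral_cong) (auto simp: jump_kernel_def heat_potential_def)
  also have "\<dots> = (\<integral>\<^sup>+s. \<integral>\<^sup>+z. (if z = 0 then 0 else ennreal (rpowr (- \<sigma> - 1) s * heat s (z :: int ^ 'd))) \<partial>count_space UNIV \<partial>lborel)"
    by (rule nn_integral_count_space_lborel_swap) measurable
  also have "\<dots> = (\<integral>\<^sup>+s. ennreal (rpowr (- \<sigma> - 1) s * (1 - heat s (0 :: int ^ 'd))) \<partial>lborel)"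
  proof (rule nn_integral_cong)
    fix s :: real
    show "(\<integral>\<^sup>+z. (if z = 0 then 0 else ennreal (rpowr (- \<sigma> - 1) s * heat s (z :: int ^ 'd))) \<partial>count_space UNIV)
      = ennreal (rpowr (- \<sigma> - 1) s * (1 - heat s (0 :: int ^ 'd)))"
    proof (cases "s > 0")
      case True
      have "(\<integral>\<^sup>+z. (if z = 0 then 0 else ennreal (rpowr (- \<sigma> - 1) s * heat s (z :: int ^ 'd))) \<partial>count_space UNIV)
        = (\<integral>\<^sup>+z. ennreal (rpowr (- \<sigma> - 1) s) * (if z = 0 then 0 else ennreal (heat s (z :: int ^ 'd))) \<partial>count_space UNIV)"
        using True by (intro nn_integral_cong) (auto simp: ennreal_mult)
      also have "\<dots> = ennreal (rpowr (- \<sigma> - 1) s) * ennreal (1 - heat s (0 :: int ^ 'd))"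
        using True by (subst nn_integral_cmult) (simp_all add: nn_integral_heat_off_origin)
      finally show ?thesis using True heat_le_1[of s "0 :: int ^ 'd"] by (simp add: ennreal_mult)
    qed (simp add: rpowr_def cong: if_cong)
  qed
  finally show ?thesis .
qed

text \<open>At small times \<open>1 - heat s 0\<close> is at most the number of neighbours times
  \<open>s\<close>, which suffices for \<sigma> < 1; at large times it is at most 1, which suffices
  for \<sigma> > 0.\<close>

lemma nn_integral_jump_kernel_finite:
  assumes \<sigma>: "0 < \<sigma>" "\<sigma> < 1"
  shows "(\<integral>\<^sup>+z. jump_kernel \<sigma> (z :: int ^ 'd::finite) \<partial>count_space UNIV) < top"
proof -
  let ?N = "real (card (uvec :: (int ^ 'd) set))"
  have "(\<integral>\<^sup>+s. ennreal (rpowr (- \<sigma> - 1) s * (1 - heat s (0 :: int ^ 'd))) \<partial>lborel)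
    \<le> (\<integral>\<^sup>+s. ennreal ?N * (ennreal (s powr (- \<sigma>)) * indicator {0..1} s)
        + ennreal (s powr (- \<sigma> - 1)) * indicator {1..} s \<partial>lborel)"
  proof (rule nn_integral_mono)
    fix s :: real
    consider "s \<le> 0" | "0 < s" "s \<le> 1" | "s > 1" by linarith
    then show "ennreal (rpowr (- \<sigma> - 1) s * (1 - heat s (0 :: int ^ 'd)))
      \<le> ennreal ?N * (ennreal (s powr (- \<sigma>)) * indicator {0..1} s)
        + ennreal (s powr (- \<sigma> - 1)) * indicator {1..} s"
    proof cases
      case 2
      have "1 - heat s (0 :: int ^ 'd) \<le> ?N * s"
        using exp_le_heat_0[where 'd = 'd, of s] exp_ge_add_one_self[of "- ?N * s"] 2 by simp
      then have "s powr (- \<sigma> - 1) * (1 - heat s (0 :: int ^ 'd)) \<le> s powr (- \<sigma> - 1) * (?N * s)"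
        by (intro mult_left_mono) auto
      also have "\<dots> = ?N * s powr (- \<sigma>)"
        using powr_add[of s 1 "- \<sigma> - 1"] 2 by simp
      finally have "ennreal (s powr (- \<sigma> - 1) * (1 - heat s (0 :: int ^ 'd))) \<le> ennreal ?N * ennreal (s powr (- \<sigma>))"
        by (simp add: ennreal_leI flip: ennreal_mult)
      with 2 show ?thesis by (auto simp: rpowr_def intro: add_increasing2)
    next
      case 3
      have "s powr (- \<sigma> - 1) * (1 - heat s (0 :: int ^ 'd)) \<le> s powr (- \<sigma> - 1) * 1"
        using 3 heat_nonneg[of s "0 :: int ^ 'd"] by (intro mult_left_mono) auto
      with 3 show ?thesis by (auto simp: rpowr_def intro!: ennreal_leI)
    qed (simp add: rpowr_def)
  qed
  also have "\<dots> = ennreal ?N * (\<integral>\<^sup>+s. ennreal (s powr (- \<sigma>)) * indicator {0..1} s \<partial>lborel)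
      + (\<integral>\<^sup>+s. ennreal (s powr (- \<sigma> - 1)) * indicator {1..} s \<partial>lborel)"
    by (subst nn_integral_add) (auto simp: nn_integral_cmult)
  also have "\<dots> < top"
    using nn_integral_powr_near_0[of "- \<sigma>"] nn_integral_powr_near_inf[of "- \<sigma> - 1"] \<sigma>
    by (simp add: ennreal_mult_less_top)
  finally show ?thesis by (simp add: nn_integral_jump_kernel)
qed

text \<open>The semigroup adds \<open>s\<close> to every time in the potential; renaming the total
  time moves the shift from \<open>heat\<close> to the power.\<close>

lemma heat_potential_shift:
  fixes x :: "int ^ 'd::finite"
  assumes "s > 0"
  shows "(\<integral>\<^sup>+t. ennreal (rpowr (a - 1) (t - s) * heat t x) \<partial>lborel)
    = (\<integral>\<^sup>+y. ennreal (heat s (x - y)) * heat_potential a y \<partial>count_space UNIV)"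
proof -
  have "(\<integral>\<^sup>+t. ennreal (rpowr (a - 1) (t - s) * heat t x) \<partial>lborel)
      = (\<integral>\<^sup>+t. ennreal (rpowr (a - 1) t * heat (s + t) x) \<partial>lborel)"
    by (subst nn_integral_real_affine[where c = 1 and t = s]) auto
  also have "\<dots> = (\<integral>\<^sup>+t. \<integral>\<^sup>+y. ennreal (heat s (x - y)) * ennreal (rpowr (a - 1) t * heat t y) \<partial>count_space UNIV \<partial>lborel)"
  proof (rule nn_integral_cong)
    fix t :: real
    show "ennreal (rpowr (a - 1) t * heat (s + t) x)
      = (\<integral>\<^sup>+y. ennreal (heat s (x - y)) * ennreal (rpowr (a - 1) t * heat t y) \<partial>count_space UNIV)"
    proof (cases "t > 0")
      case True
      then have "(\<integral>\<^sup>+y. ennreal (heat s (x - y)) * ennreal (rpowr (a - 1) t * heat t y) \<partial>count_space UNIV)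
        = (\<integral>\<^sup>+y. ennreal (rpowr (a - 1) t) * (ennreal (heat s (x - y)) * ennreal (heat t y)) \<partial>count_space UNIV)"
        by (intro nn_integral_cong) (simp add: ennreal_mult mult_ac)
      also have "\<dots> = ennreal (rpowr (a - 1) t) * ennreal (heat (s + t) x)"
        using True assms by (subst nn_integral_cmult) (simp_all add: heat_semigroup)
      finally show ?thesis using True assms by (simp add: ennreal_mult)
    qed (simp add: rpowr_def)
  qed
  also have "\<dots> = (\<integral>\<^sup>+y. \<integral>\<^sup>+t. ennreal (heat s (x - y)) * ennreal (rpowr (a - 1) t * heat t y) \<partial>lborel \<partial>count_space UNIV)"
    by (rule nn_integral_count_space_lborel_swap[symmetric]) measurable
  also have "\<dots> = (\<integral>\<^sup>+y. ennreal (heat s (x - y)) * heat_potential a y \<partial>count_space UNIV)"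
    unfolding heat_potential_def by (intro nn_integral_cong nn_integral_cmult) measurable
  finally show ?thesis .
qed

lemma heat_potential_le_origin: "heat_potential a (x :: int ^ 'd::finite) \<le> heat_potential a (0 :: int ^ 'd)"
  unfolding heat_potential_def
  by (intro nn_integral_mono ennreal_leI) (auto simp: rpowr_def intro!: mult_left_mono heat_le_heat_0)

text \<open>The two sides compare the two orders of integration of \<open>fractional_kernel \<sigma> \<alpha> t s * heat t x\<close>.\<close>
lemma jump_kernel_potential:
  fixes x :: "int ^ 'd::finite"
  assumes \<sigma>: "0 < \<sigma>" "\<sigma> < 1" and \<alpha>: "\<sigma> < \<alpha>" "\<alpha> < real CARD('d) / 2"
  shows "(\<integral>\<^sup>+y. jump_kernel \<sigma> (x - y) * heat_potential \<alpha> y \<partial>count_space UNIV)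
      + ennreal (\<bar>Gamma (- \<sigma>)\<bar> * Gamma \<alpha> / Gamma (\<alpha> - \<sigma>)) * heat_potential (\<alpha> - \<sigma>) x
    = (\<integral>\<^sup>+z. jump_kernel \<sigma> (z :: int ^ 'd) \<partial>count_space UNIV) * heat_potential \<alpha> x"
proof -
  define I where "I = \<bar>Gamma (- \<sigma>)\<bar> * Gamma \<alpha> / Gamma (\<alpha> - \<sigma>)"
  define J where "J = (\<integral>s. \<bar>fractional_kernel \<sigma> \<alpha> 1 s\<bar> \<partial>lborel)"
  define E where "E = rpowr (- \<sigma> - 1)"
  define V where "V s t = rpowr (\<alpha> - 1) (t - s) * heat t x" for s t
  \<comment> \<open>The potential after heat flow for time \<open>s\<close>, without its diagonal
    term, because the jump kernel has no diagonal.\<close>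
  define X where "X s = (\<integral>\<^sup>+y. (if y = x then 0 else ennreal (heat s (x - y)) * heat_potential \<alpha> y) \<partial>count_space UNIV)" for s
  have I: "I \<ge> 0" using \<sigma> \<alpha> by (auto simp: I_def intro!: divide_nonneg_nonneg Gamma_real_nonneg mult_nonneg_nonneg)
  have fin: "heat_potential \<alpha> (y :: int ^ 'd) < top" for y
    using \<sigma> \<alpha> by (intro heat_potential_finite) auto
  have fin': "heat_potential (\<alpha> - \<sigma>) x < top"
    using \<sigma> \<alpha> by (intro heat_potential_finite) auto
  obtain U where U: "heat_potential \<alpha> x = ennreal U" "U \<ge> 0"
    using fin[of x] by (cases "heat_potential \<alpha> x") auto
  obtain U' where U': "heat_potential (\<alpha> - \<sigma>) x = ennreal U'" "U' \<ge> 0"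
    using fin' by (cases "heat_potential (\<alpha> - \<sigma>) x") auto
  obtain K where K: "(\<integral>\<^sup>+z. jump_kernel \<sigma> (z :: int ^ 'd) \<partial>count_space UNIV) = ennreal K" "K \<ge> 0"
    using nn_integral_jump_kernel_finite[OF \<sigma>, where 'd = 'd]
    by (cases "\<integral>\<^sup>+z. jump_kernel \<sigma> (z :: int ^ 'd) \<partial>count_space UNIV") auto
  have V_meas [measurable]: "V s \<in> borel_measurable borel" for s
    unfolding V_def by measurable
  have V_nonneg: "V s t \<ge> 0" if "s \<ge> 0" for s t
    using that by (auto simp: V_def rpowr_def)
  have E_nonneg: "E s \<ge> 0" for s by (simp add: E_def)
  have E_meas [measurable]: "E \<in> borel_measurable borel" by (simp add: E_def)
  have V0: "has_bochner_integral lborel (V 0) U"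
    by (rule has_bochner_integral_nn) (use U V_nonneg in \<open>auto simp: V_def heat_potential_def\<close>)
  have X: "X s + ennreal (heat s (0 :: int ^ 'd)) * ennreal U = (\<integral>\<^sup>+t. ennreal (V s t) \<partial>lborel)" if "s > 0" for s
    using heat_potential_shift[OF that, of \<alpha> x]
      nn_integral_count_space_remove[of "\<lambda>y. ennreal (heat s (x - y)) * heat_potential \<alpha> y" x]
    by (simp add: V_def X_def U add.commute)
  have X_fin: "X s < top" if "s > 0" for s
  proof -
    have "X s \<le> (\<integral>\<^sup>+y. ennreal (heat s (x - y)) * heat_potential \<alpha> (0 :: int ^ 'd) \<partial>count_space UNIV)"
      unfolding X_def by (intro nn_integral_mono) (auto intro!: mult_left_mono heat_potential_le_origin)
    also have "\<dots> = heat_potential \<alpha> (0 :: int ^ 'd)"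
      using nn_integral_heat[of s, where 'd = 'd] that nn_integral_count_space_reflect[of "\<lambda>y. ennreal (heat s y)" x]
      by (simp add: nn_integral_multc)
    finally show ?thesis using fin[of 0] by simp
  qed
  define X' where "X' s = enn2real (X s)" for s
  have X': "X s = ennreal (X' s)" "X' s \<ge> 0" if "s > 0" for s
    using X_fin[OF that] by (auto simp: X'_def)
  have Vs: "has_bochner_integral lborel (V s) (X' s + heat s (0 :: int ^ 'd) * U)" if "s > 0" for s
  proof (rule has_bochner_integral_nn)
    show "(\<integral>\<^sup>+t. ennreal (V s t) \<partial>lborel) = ennreal (X' s + heat s (0 :: int ^ 'd) * U)"
      using X[OF that, symmetric] X'[OF that] U(2) that by (simp add: ennreal_mult)
  qed (use that V_nonneg X' U in auto)
  let ?F = "\<lambda>t s. fractional_kernel \<sigma> \<alpha> t s * heat t x"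
  have F_s: "has_bochner_integral lborel (?F t) (rpowr (\<alpha> - \<sigma> - 1) t * heat t x * I)" for t
    using has_bochner_integral_mult_left[of "heat t x", OF has_bochner_integral_fractional_kernel(1)[OF \<sigma> \<alpha>(1), of t]]
    by (simp add: I_def mult_ac)
  have F_abs: "(\<integral>s. norm (?F t s) \<partial>lborel) = rpowr (\<alpha> - \<sigma> - 1) t * heat t x * J" for t
  proof -
    have "norm (?F t s) = \<bar>fractional_kernel \<sigma> \<alpha> t s\<bar> * heat t x" for s
    proof (cases "t > 0")
      case False
      then have "fractional_kernel \<sigma> \<alpha> t s = 0" by (auto simp: fractional_kernel_def rpowr_def)
      then show ?thesis by simp
    qed (simp add: abs_mult)
    then show ?thesis
      using has_bochner_integral_mult_left[of "heat t x", OF has_bochner_integral_fractional_kernel(2)[OF \<sigma> \<alpha>(1), of t]]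
      by (simp add: J_def has_bochner_integral_iff mult_ac)
  qed
  have U'_int: "has_bochner_integral lborel (\<lambda>t. rpowr (\<alpha> - \<sigma> - 1) t * heat t x) U'"
    by (rule has_bochner_integral_nn) (use U' in \<open>auto simp: heat_potential_def\<close>)
  \<comment> \<open>Separating the diagonal from the heat flow of the potential splits the integral
    into a part that will sum to the total mass times \<open>U\<close> and the off-diagonal part
    \<open>X'\<close>.\<close>
  have F_t: "has_bochner_integral lborel (\<lambda>t. ?F t s) (E s * ((1 - heat s (0 :: int ^ 'd)) * U) - E s * X' s)" for s
  proof (cases "s > 0")
    case True
    have "(\<lambda>t. ?F t s) = (\<lambda>t. E s * (V 0 t - V s t))"
      by (simp add: fractional_kernel_def E_def V_def algebra_simps)
    moreover have "has_bochner_integral lborel (\<lambda>t. E s * (V 0 t - V s t)) (E s * (U - (X' s + heat s (0 :: int ^ 'd) * U)))"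
      using V0 Vs[OF True] by (intro has_bochner_integral_mult_right has_bochner_integral_diff)
    moreover have "E s * (U - (X' s + heat s (0 :: int ^ 'd) * U)) = E s * ((1 - heat s (0 :: int ^ 'd)) * U) - E s * X' s"
      by (simp add: algebra_simps)
    ultimately show ?thesis by (simp only:)
  qed (simp add: fractional_kernel_def rpowr_def E_def has_bochner_integral_zero)
  have F_meas: "(\<lambda>(t, s). ?F t s) \<in> borel_measurable (lborel \<Otimes>\<^sub>M lborel)"
    by measurable
  \<comment> \<open>Integrating the absolute value in \<open>s\<close> first leaves \<open>J\<close>
    times the integrand of the potential of exponent \<open>\<alpha> - \<sigma>\<close>, which is
    finite.\<close>
  have F_int: "integrable (lborel \<Otimes>\<^sub>M lborel) (\<lambda>(t, s). ?F t s)"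
  proof (rule lborel_pair.Fubini_integrable[OF F_meas])
    show "integrable lborel (\<lambda>t. \<integral>s. norm (case (t, s) of (t, s) \<Rightarrow> ?F t s) \<partial>lborel)"
      using U'_int by (simp add: F_abs[simplified] has_bochner_integral_iff)
    show "AE t in lborel. integrable lborel (\<lambda>s. case (t, s) of (t, s) \<Rightarrow> ?F t s)"
      using F_s by (auto simp: has_bochner_integral_iff)
  qed
  have diff: "has_bochner_integral lborel (\<lambda>s. E s * ((1 - heat s (0 :: int ^ 'd)) * U) - E s * X' s) (I * U')"
  proof -
    have Ft: "(\<integral>t. ?F t s \<partial>lborel) = E s * ((1 - heat s (0 :: int ^ 'd)) * U) - E s * X' s" for s
      using F_t[of s] by (simp add: has_bochner_integral_iff)
    have "integrable lborel (\<lambda>s. \<integral>t. ?F t s \<partial>lborel)"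
      using lborel_pair.integrable_snd[OF F_int] by simp
    moreover have "(\<integral>s. \<integral>t. ?F t s \<partial>lborel \<partial>lborel) = (\<integral>t. \<integral>s. ?F t s \<partial>lborel \<partial>lborel)"
      by (rule lborel_pair.Fubini_integral[OF F_int])
    moreover have "(\<integral>t. \<integral>s. ?F t s \<partial>lborel \<partial>lborel) = (\<integral>t. rpowr (\<alpha> - \<sigma> - 1) t * heat t x * I \<partial>lborel)"
      by (simp only: has_bochner_integral_integral_eq[OF F_s])
    ultimately show ?thesis
      using U'_int by (simp add: Ft has_bochner_integral_iff)
  qed
  \<comment> \<open>Since the mass part is integrable by itself, the off-diagonal part is integrable
    as the difference of two integrable functions.\<close>
  have "has_bochner_integral lborel (\<lambda>s. E s * (1 - heat s (0 :: int ^ 'd))) K"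
  proof (rule has_bochner_integral_nn)
    show "E s * (1 - heat s (0 :: int ^ 'd)) \<ge> 0" for s
      using heat_le_1[of s "0 :: int ^ 'd"] by (simp add: E_def rpowr_def)
  qed (use K in \<open>auto simp: nn_integral_jump_kernel E_def\<close>)
  from has_bochner_integral_diff[OF has_bochner_integral_mult_left[of U, OF this] diff]
  have EX: "has_bochner_integral lborel (\<lambda>s. E s * X' s) (K * U - I * U')"
    by (simp add: mult.assoc)
  have EX_nonneg: "E s * X' s \<ge> 0" for s
    by (cases "s > 0") (auto simp: X' E_nonneg, simp add: E_def rpowr_def)
  have "(\<integral>\<^sup>+y. jump_kernel \<sigma> (x - y) * heat_potential \<alpha> y \<partial>count_space UNIV)
    = (\<integral>\<^sup>+y. \<integral>\<^sup>+s. ennreal (E s) * (if y = x then 0 else ennreal (heat s (x - y)) * heat_potential \<alpha> y) \<partial>lborel \<partial>count_space UNIV)"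
  proof (rule nn_integral_cong)
    fix y
    have "heat_potential (- \<sigma>) (x - y) * heat_potential \<alpha> y
        = (\<integral>\<^sup>+s. ennreal (E s * heat s (x - y)) * heat_potential \<alpha> y \<partial>lborel)"
      unfolding heat_potential_def[of "- \<sigma>"] E_def by (rule nn_integral_multc[symmetric]) measurable
    also have "\<dots> = (\<integral>\<^sup>+s. ennreal (E s) * (ennreal (heat s (x - y)) * heat_potential \<alpha> y) \<partial>lborel)"
      by (intro nn_integral_cong) (auto simp: E_def rpowr_def ennreal_mult mult.assoc)
    finally show "jump_kernel \<sigma> (x - y) * heat_potential \<alpha> y
      = (\<integral>\<^sup>+s. ennreal (E s) * (if y = x then 0 else ennreal (heat s (x - y)) * heat_potential \<alpha> y) \<partial>lborel)"
      by (simp add: jump_kernel_def)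
  qed
  also have "\<dots> = (\<integral>\<^sup>+s. \<integral>\<^sup>+y. ennreal (E s) * (if y = x then 0 else ennreal (heat s (x - y)) * heat_potential \<alpha> y) \<partial>count_space UNIV \<partial>lborel)"
    by (rule nn_integral_count_space_lborel_swap) measurable
  also have "\<dots> = (\<integral>\<^sup>+s. ennreal (E s * X' s) \<partial>lborel)"
  proof (rule nn_integral_cong)
    fix s :: real
    show "(\<integral>\<^sup>+y. ennreal (E s) * (if y = x then 0 else ennreal (heat s (x - y)) * heat_potential \<alpha> y) \<partial>count_space UNIV)
      = ennreal (E s * X' s)"
    proof (cases "s > 0")
      case True
      then show ?thesis
        using X'[OF True] by (simp add: nn_integral_cmult X_def[symmetric] ennreal_mult E_nonneg)
    qed (simp add: E_def rpowr_def)
  qed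
  also have "\<dots> = ennreal (K * U - I * U')"
    using EX EX_nonneg by (subst nn_integral_eq_integral) (auto simp: has_bochner_integral_iff)
  finally have *: "(\<integral>\<^sup>+y. jump_kernel \<sigma> (x - y) * heat_potential \<alpha> y \<partial>count_space UNIV) = ennreal (K * U - I * U')" .
  \<comment> \<open>\<open>ennreal\<close> sends negative numbers to 0, so the sign must be known
    before \<open>I * U'\<close> is added back.\<close>
  have "K * U - I * U' \<ge> 0"
    using EX EX_nonneg integral_nonneg_AE[of "\<lambda>s. E s * X' s" lborel] by (simp add: has_bochner_integral_iff)
  then have "ennreal (K * U - I * U') + ennreal I * ennreal U' = ennreal K * ennreal U"
    using I U' K U by (simp flip: ennreal_mult ennreal_plus)
  then show ?thesis unfolding * K U U' I_def[symmetric] .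
qed

section \<open>Riesz weights\<close>

text \<open>The time derivative of \<open>t powr (\<alpha> - 1) * heat t x\<close> integrates to
  zero over the half-line: the boundary value at 0 vanishes because \<alpha> > 1, the one at
  infinity by the on-diagonal decay. By the heat equation the derivative is the sum of the
  integrands of the identity.\<close>

lemma lap_potential:
  fixes x :: "int ^ 'd::finite"
  assumes \<alpha>: "1 < \<alpha>" "\<alpha> < real CARD('d) / 2"
  shows "(\<Sum>e\<in>uvec. heat_potential \<alpha> (x + e)) + ennreal (\<alpha> - 1) * heat_potential (\<alpha> - 1) x
    = ennreal (real (card (uvec :: (int ^ 'd) set))) * heat_potential \<alpha> x"
proof -
  define U where "U a y = enn2real (heat_potential a (y :: int ^ 'd))" for a y
  have U: "heat_potential a y = ennreal (U a y)" "U a y \<ge> 0" if "a \<in> {\<alpha>, \<alpha> - 1}" for a y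
    using heat_potential_finite[of a y] \<alpha> that by (auto simp: U_def)
  have int: "has_bochner_integral lborel (\<lambda>t. rpowr (a - 1) t * heat t y) (U a y)" if "a \<in> {\<alpha>, \<alpha> - 1}" for a y
    by (rule has_bochner_integral_nn) (use U[OF that] in \<open>auto simp: heat_potential_def\<close>)
  define F where "F t = t powr (\<alpha> - 1) * heat t x" for t
  define f where "f t = (\<alpha> - 1) * (t powr (\<alpha> - 1 - 1) * heat t x)
      + (\<Sum>e\<in>uvec. t powr (\<alpha> - 1) * heat t (x + e) - t powr (\<alpha> - 1) * heat t x)" for t
  have "has_bochner_integral lborel (\<lambda>t. (\<alpha> - 1) * (rpowr (\<alpha> - 1 - 1) t * heat t x)
      + (\<Sum>e\<in>uvec. rpowr (\<alpha> - 1) t * heat t (x + e) - rpowr (\<alpha> - 1) t * heat t x))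
      ((\<alpha> - 1) * U (\<alpha> - 1) x + (\<Sum>e\<in>uvec. U \<alpha> (x + e) - U \<alpha> x))"
    by (intro has_bochner_integral_add has_bochner_integral_mult_right has_bochner_integral_sum
        has_bochner_integral_diff int) auto
  moreover have "(\<lambda>t. (\<alpha> - 1) * (rpowr (\<alpha> - 1 - 1) t * heat t x)
      + (\<Sum>e\<in>uvec. rpowr (\<alpha> - 1) t * heat t (x + e) - rpowr (\<alpha> - 1) t * heat t x))
      = (\<lambda>t. indicator {0<..} t *\<^sub>R f t)"
    by (auto simp: f_def rpowr_def indicator_def fun_eq_iff)
  ultimately have f_int: "has_bochner_integral lborel (\<lambda>t. indicator {0<..} t *\<^sub>R f t)
      ((\<alpha> - 1) * U (\<alpha> - 1) x + (\<Sum>e\<in>uvec. U \<alpha> (x + e) - U \<alpha> x))"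
    by simp
  have einterval: "einterval 0 \<infinity> = {0<..}" by (auto simp: einterval_def)
  have "(LBINT t=0..\<infinity>. f t) = 0 - 0"
  proof (rule interval_integral_FTC_integrable)
    fix t assume "0 < ereal t"
    then have t: "t > 0" by simp
    have "(F has_real_derivative f t) (at t)"
    proof -
      have "((\<lambda>t. t powr (\<alpha> - 1) * heat t x) has_real_derivative
          (\<alpha> - 1) * t powr (\<alpha> - 1 - 1) * heat t x
          + (\<Sum>e\<in>uvec. heat t (x + e) - heat t x) * t powr (\<alpha> - 1)) (at t)"
        by (intro DERIV_mult has_real_derivative_heat has_real_derivative_powr t)
      then show ?thesis
        unfolding F_def f_def by (simp add: sum_distrib_left right_diff_distrib mult_ac)
    qed
    then show "(F has_vector_derivative f t) (at t)"
      by (simp add: has_real_derivative_iff_has_vector_derivative)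
    have "isCont (\<lambda>t. heat t y) t" for y :: "int ^ 'd"
      by (rule DERIV_isCont[OF has_real_derivative_heat])
    then show "isCont f t"
      unfolding f_def using t by (intro continuous_intros) auto
  next
    show "set_integrable lborel (einterval 0 \<infinity>) f"
      using f_int by (simp add: set_integrable_def einterval has_bochner_integral_iff)
    have "((\<lambda>t. t powr (\<alpha> - 1) * heat t x) \<longlongrightarrow> 0 * heat 0 x) (at_right 0)"
    proof (rule tendsto_mult)
      show "((\<lambda>t::real. t powr (\<alpha> - 1)) \<longlongrightarrow> 0) (at_right 0)"
        using \<alpha> by (intro tendsto_zero_powrI[where f = "\<lambda>t. t" and g = "\<lambda>_. \<alpha> - 1", OF _ tendsto_const])
          (auto simp: eventually_at_filter)
      have "isCont (\<lambda>t. heat t x) 0" by (rule DERIV_isCont[OF has_real_derivative_heat])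
      then show "((\<lambda>t. heat t x) \<longlongrightarrow> heat 0 x) (at_right 0)"
        unfolding isCont_def by (rule filterlim_mono[OF _ order_refl at_le]) auto
    qed
    then show "((F \<circ> real_of_ereal) \<longlongrightarrow> 0) (at_right 0)"
      unfolding zero_ereal_def ereal_tendsto_simps by (simp add: F_def[abs_def])
    obtain C where C: "C > 0" "\<And>t. t > 0 \<Longrightarrow> heat t (0 :: int ^ 'd) \<le> C * t powr (- (real CARD('d) / 2))"
      using heat_0_upper by blast
    have "(F \<longlongrightarrow> 0) at_top"
    proof (rule tendsto_sandwich)
      show "\<forall>\<^sub>F t in at_top. 0 \<le> F t"
        using eventually_ge_at_top[of 0] by eventually_elim (simp add: F_def)
      show "\<forall>\<^sub>F t in at_top. F t \<le> C * t powr (- (real CARD('d) / 2 - (\<alpha> - 1)))"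
        using eventually_gt_at_top[of 0]
      proof eventually_elim
        fix t :: real assume t: "0 < t"
        have "F t \<le> t powr (\<alpha> - 1) * (C * t powr (- (real CARD('d) / 2)))"
          unfolding F_def using t C(2)[of t] heat_le_heat_0[of t x] by (intro mult_left_mono) auto
        also have "\<dots> = C * t powr (- (real CARD('d) / 2 - (\<alpha> - 1)))"
          by (simp add: powr_add[symmetric] mult.left_commute algebra_simps)
        finally show "F t \<le> C * t powr (- (real CARD('d) / 2 - (\<alpha> - 1)))" .
      qed
      have "((\<lambda>t. t powr (- (real CARD('d) / 2 - (\<alpha> - 1)))) \<longlongrightarrow> 0) at_top"
        using \<alpha> by (intro tendsto_neg_powr filterlim_ident) auto
      from tendsto_mult_right_zero[OF this]
      show "((\<lambda>t. C * t powr (- (real CARD('d) / 2 - (\<alpha> - 1)))) \<longlongrightarrow> 0) at_top" .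
    qed auto
    then show "((F \<circ> real_of_ereal) \<longlongrightarrow> 0) (at_left \<infinity>)"
      unfolding ereal_tendsto_simps .
  qed auto
  then have "(\<integral>t. indicator {0<..} t *\<^sub>R f t \<partial>lborel) = 0"
    by (simp add: interval_lebesgue_integral_def einterval set_lebesgue_integral_def)
  then have "(\<alpha> - 1) * U (\<alpha> - 1) x + (\<Sum>e\<in>uvec. U \<alpha> (x + e) - U \<alpha> x) = 0"
    using f_int by (simp add: has_bochner_integral_iff)
  then have "(\<Sum>e\<in>uvec. U \<alpha> (x + e)) + (\<alpha> - 1) * U (\<alpha> - 1) x = real (card (uvec :: (int ^ 'd) set)) * U \<alpha> x"
    by (simp add: sum_subtractf)
  then have eq: "ennreal ((\<Sum>e\<in>uvec. U \<alpha> (x + e)) + (\<alpha> - 1) * U (\<alpha> - 1) x)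
      = ennreal (real (card (uvec :: (int ^ 'd) set)) * U \<alpha> x)" by simp
  have nn: "0 \<le> U \<alpha> y" "0 \<le> U (\<alpha> - 1) y" "0 \<le> \<alpha> - 1" for y using U(2) \<alpha> by simp_all
  have "(\<Sum>e\<in>uvec. heat_potential \<alpha> (x + e)) + ennreal (\<alpha> - 1) * heat_potential (\<alpha> - 1) x
      = (\<Sum>e\<in>uvec. ennreal (U \<alpha> (x + e))) + ennreal (\<alpha> - 1) * ennreal (U (\<alpha> - 1) x)"
    by (simp add: U(1))
  also have "\<dots> = ennreal ((\<Sum>e\<in>uvec. U \<alpha> (x + e)) + (\<alpha> - 1) * U (\<alpha> - 1) x)"
  proof -
    have "(\<Sum>e\<in>uvec. ennreal (U \<alpha> (x + e))) = ennreal (\<Sum>e\<in>uvec. U \<alpha> (x + e))"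
      by (intro sum_ennreal nn)
    moreover have "0 \<le> (\<Sum>e\<in>uvec. U \<alpha> (x + e))" by (intro sum_nonneg nn)
    ultimately show ?thesis using nn by (simp only: ennreal_plus ennreal_mult mult_nonneg_nonneg)
  qed
  also have "\<dots> = ennreal (real (card (uvec :: (int ^ 'd) set))) * heat_potential \<alpha> x"
    unfolding eq by (subst ennreal_mult) (simp_all add: nn U(1))
  finally show ?thesis .
qed

section \<open>Gamma factors and the ground state built from Riesz kernels\<close>

lemma nn_integral_uvec:
  "(\<integral>\<^sup>+z. ennreal (kappa 1 (z :: int ^ 'd::finite)) * f z \<partial>count_space UNIV) = (\<Sum>e\<in>uvec. f e)"
proof -
  have "kappa 1 z = (if z \<in> uvec then 1 else 0)" for z :: "int ^ 'd"
    by (simp add: kappa_def uvec_def)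
  then show ?thesis by (subst nn_integral_count_space'[of uvec]) auto
qed

lemma abs_Gamma_uminus_pos:
  assumes "0 < \<sigma>" "\<sigma> < (1 :: real)"
  shows "\<bar>Gamma (- \<sigma>)\<bar> > 0"
  using assms by (simp add: abs_Gamma_uminus)

text \<open>Finiteness off the origin is inherited from the total mass of the kernel.\<close>

lemma kappa_eq_jump_kernel:
  assumes "0 < \<sigma>" "\<sigma> < 1"
  shows "ennreal (\<bar>Gamma (- \<sigma>)\<bar> * kappa \<sigma> (z :: int ^ 'd::finite)) = jump_kernel \<sigma> z"
proof (cases "z = 0")
  case False
  have "jump_kernel \<sigma> z \<le> (\<integral>\<^sup>+z. jump_kernel \<sigma> (z :: int ^ 'd) \<partial>count_space UNIV)"
    by (rule nn_integral_count_space_ge)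
  also have "\<dots> < top" by (rule nn_integral_jump_kernel_finite[OF assms])
  finally have "heat_potential (- \<sigma>) z < top" using False by (simp add: jump_kernel_def)
  then show ?thesis using False assms by (simp add: kappa_eq_heat_potential jump_kernel_def)
qed (use assms in \<open>simp add: kappa_def jump_kernel_def\<close>)

lemma kappa_minus: "\<sigma> \<noteq> 0 \<Longrightarrow> kappa \<sigma> (- z) = kappa \<sigma> (z :: int ^ 'd::finite)"
  by (simp add: kappa_def)

lemma kappa_neg_eq_heat_potential:
  assumes "0 < a" "a < real CARD('d) / 2"
  shows "ennreal (Gamma a) * ennreal (kappa (- a) (x :: int ^ 'd::finite)) = heat_potential a x"
    and "kappa (- a) x > 0"
proof -
  have G: "Gamma a > 0" using assms by simp
  have *: "ennreal (Gamma a * kappa (- a) x) = heat_potential a x"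
    using kappa_eq_heat_potential[of "- a" x] heat_potential_finite[OF assms, of x] assms G by simp
  then show "ennreal (Gamma a) * ennreal (kappa (- a) x) = heat_potential a x"
    using G by (simp add: ennreal_mult')
  have "ennreal (Gamma a * kappa (- a) x) > 0" using * heat_potential_pos by simp
  then have "Gamma a * kappa (- a) x > 0" by (simp add: ennreal_less_zero_iff)
  then show "kappa (- a) x > 0" using G by (simp add: zero_less_mult_iff)
qed

text \<open>The potential equations are free of normalisation. So \<open>potential_eq\<close> is
  multiplied by the Gamma factors of the kernels involved, which are positive and finite and can be
  cancelled at the end.\<close>

lemma ground_state_kappa:
  fixes \<sigma> \<alpha> :: real
  assumes \<sigma>: "0 < \<sigma>" "\<sigma> \<le> 1" and \<alpha>: "\<sigma> < \<alpha>" "\<alpha> < real CARD('d) / 2"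
  shows "\<exists>K. ground_state \<sigma> (kappa (- \<alpha>) :: int ^ 'd::finite \<Rightarrow> real) (kappa (\<sigma> - \<alpha>)) K"
proof -
  let ?u = "kappa (- \<alpha>) :: int ^ 'd \<Rightarrow> real" and ?m = "kappa (\<sigma> - \<alpha>) :: int ^ 'd \<Rightarrow> real"
  have a: "0 < \<alpha>" using \<sigma> \<alpha> by simp
  have b: "0 < \<alpha> - \<sigma>" "\<alpha> - \<sigma> < real CARD('d) / 2" using \<sigma> \<alpha> by simp_all
  have G: "Gamma \<alpha> > 0" "Gamma (\<alpha> - \<sigma>) > 0" using a b by simp_all
  note u = kappa_neg_eq_heat_potential[OF a \<alpha>(2)]
  have m: "ennreal (Gamma (\<alpha> - \<sigma>)) * ennreal (?m x) = heat_potential (\<alpha> - \<sigma>) x" "?m x > 0" for x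
    using kappa_neg_eq_heat_potential[OF b, of x] by simp_all
  have level: "finite {x. ?u x > \<epsilon>}" if "\<epsilon> > 0" for \<epsilon>
  proof (rule finite_subset)
    show "{x. ?u x > \<epsilon>} \<subseteq> {x. heat_potential \<alpha> x > ennreal (Gamma \<alpha> * \<epsilon>)}"
      using that G u(2) by (auto simp flip: u(1) ennreal_mult intro!: ennreal_lessI mult_strict_left_mono mult_pos_pos
          simp: ennreal_mult'[symmetric] less_imp_le)
    show "finite {x :: int ^ 'd. heat_potential \<alpha> x > ennreal (Gamma \<alpha> * \<epsilon>)}"
      using that G by (intro heat_potential_superlevel_finite a \<alpha>) simp
  qed
  show ?thesis
  proof (cases "\<sigma> = 1")
    case True
    let ?N = "real (card (uvec :: (int ^ 'd) set))"
    have "ground_state 1 ?u ?m ?N"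
    proof
      show "kappa 1 z \<ge> 0" "kappa 1 (- z) = kappa 1 z" for z :: "int ^ 'd"
        by (simp_all add: kappa_def)
      show "(\<integral>\<^sup>+z. ennreal (kappa 1 (z :: int ^ 'd)) \<partial>count_space UNIV) = ennreal ?N"
        using nn_integral_uvec[of "\<lambda>_. 1"] by (simp add: ennreal_of_nat_eq_real_of_nat)
      show "kappa 1 e > 0" if "e \<in> uvec" for e :: "int ^ 'd"
        using that by (simp add: kappa_def uvec_def)
      fix x :: "int ^ 'd"
      let ?S = "\<integral>\<^sup>+y. ennreal (kappa 1 (x - y)) * ennreal (?u y) \<partial>count_space UNIV"
      have "?S = (\<integral>\<^sup>+z. ennreal (kappa 1 z) * ennreal (?u (x - z)) \<partial>count_space UNIV)"
        using nn_integral_count_space_reflect[of "\<lambda>z. ennreal (kappa 1 z) * ennreal (?u (x - z))" x] by simp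
      also have "\<dots> = (\<Sum>e\<in>uvec. ennreal (?u (x - e)))" by (rule nn_integral_uvec)
      also have "\<dots> = (\<Sum>e\<in>uvec. ennreal (?u (x + e)))"
        using sum_uvec_uminus[of "\<lambda>e. ennreal (?u (x + e))"] by simp
      finally have S: "ennreal (Gamma \<alpha>) * ?S = (\<Sum>e\<in>uvec. heat_potential \<alpha> (x + e))"
        by (simp add: sum_distrib_left u)
      \<comment> \<open>The functional equation turns the normalisation of \<open>?m\<close>, which
        is \<open>Gamma (\<alpha> - 1)\<close>, into the coefficient \<open>\<alpha> - 1\<close> of
        \<open>lap_potential\<close>.\<close>
      have "Gamma \<alpha> = (\<alpha> - 1) * Gamma (\<alpha> - 1)"
        using Gamma_plus1[of "\<alpha> - 1"] \<alpha> True by (fastforce dest: nonpos_Ints_nonpos)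
      then have M: "ennreal (Gamma \<alpha>) * ennreal (?m x) = ennreal (\<alpha> - 1) * heat_potential (\<alpha> - 1) x"
        using m(1)[of x] G \<alpha> True by (simp add: ennreal_mult mult.assoc)
      have "ennreal (Gamma \<alpha>) * (?S + ennreal (?m x)) = ennreal (Gamma \<alpha>) * (ennreal ?N * ennreal (?u x))"
        unfolding distrib_left S M mult.left_commute[of "ennreal (Gamma \<alpha>)" "ennreal ?N"] u
        by (rule lap_potential) (use \<alpha> True in auto)
      then show "?S + ennreal (?m x) = ennreal ?N * ennreal (?u x)"
        using G by (simp add: ennreal_mult_cancel_left)
    qed (use u(2) m(2) level in auto)
    then show ?thesis using True by blast
  next
    case False
    with \<sigma> have \<sigma>1: "\<sigma> < 1" by simp
    let ?c = "\<bar>Gamma (- \<sigma>)\<bar>"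
    have c: "?c > 0" by (rule abs_Gamma_uminus_pos[OF \<sigma>(1) \<sigma>1])
    have k: "ennreal ?c * ennreal (kappa \<sigma> z) = jump_kernel \<sigma> z" for z :: "int ^ 'd"
      using kappa_eq_jump_kernel[OF \<sigma>(1) \<sigma>1, of z] by (simp add: ennreal_mult')
    have k_pos: "kappa \<sigma> z > 0" if "z \<noteq> 0" for z :: "int ^ 'd"
    proof -
      have "ennreal (?c * kappa \<sigma> z) > 0"
        using that heat_potential_pos[of "- \<sigma>" z] kappa_eq_jump_kernel[OF \<sigma>(1) \<sigma>1, of z]
        by (simp add: jump_kernel_def)
      then have "?c * kappa \<sigma> z > 0" by (simp add: ennreal_less_zero_iff)
      then show ?thesis using c by (simp add: zero_less_mult_iff)
    qed
    let ?S = "\<integral>\<^sup>+z. ennreal (kappa \<sigma> (z :: int ^ 'd)) \<partial>count_space UNIV"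
    have S: "ennreal ?c * ?S = (\<integral>\<^sup>+z. jump_kernel \<sigma> (z :: int ^ 'd) \<partial>count_space UNIV)"
      by (simp add: k flip: nn_integral_cmult)
    then have "ennreal ?c * ?S < top"
      using nn_integral_jump_kernel_finite[OF \<sigma>(1) \<sigma>1, where 'd = 'd] by simp
    then have "?S < top" using c by (auto simp: ennreal_mult_less_top)
    then obtain K where K: "?S = ennreal K" by (cases ?S) auto
    have "ground_state \<sigma> ?u ?m K"
    proof
      show "kappa \<sigma> z \<ge> 0" for z :: "int ^ 'd"
      proof (cases "z = 0")
        case False
        then show ?thesis by (intro less_imp_le k_pos)
      qed (use \<sigma> \<sigma>1 in \<open>simp add: kappa_def\<close>)
      show "kappa \<sigma> (- z) = kappa \<sigma> z" for z :: "int ^ 'd" using \<sigma> by (simp add: kappa_minus)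
      show "kappa \<sigma> e > 0" if "e \<in> uvec" for e :: "int ^ 'd"
        using that by (intro k_pos) (auto simp: uvec_def sqnorm_def)
      fix x :: "int ^ 'd"
      let ?T = "\<integral>\<^sup>+y. ennreal (kappa \<sigma> (x - y)) * ennreal (?u y) \<partial>count_space UNIV"
      have "ennreal ?c * ennreal (Gamma \<alpha>) * ?T
          = (\<integral>\<^sup>+y. ennreal ?c * ennreal (Gamma \<alpha>) * (ennreal (kappa \<sigma> (x - y)) * ennreal (?u y)) \<partial>count_space UNIV)"
        by (simp add: nn_integral_cmult)
      also have "\<dots> = (\<integral>\<^sup>+y. (ennreal ?c * ennreal (kappa \<sigma> (x - y))) * (ennreal (Gamma \<alpha>) * ennreal (?u y)) \<partial>count_space UNIV)"
        by (simp only: mult_ac)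
      also have "\<dots> = (\<integral>\<^sup>+y. jump_kernel \<sigma> (x - y) * heat_potential \<alpha> y \<partial>count_space UNIV)"
        by (simp only: k u)
      finally have T: "ennreal ?c * ennreal (Gamma \<alpha>) * ?T = \<dots>" .
      have "ennreal (?c * Gamma \<alpha> / Gamma (\<alpha> - \<sigma>)) * ennreal (Gamma (\<alpha> - \<sigma>)) = ennreal ?c * ennreal (Gamma \<alpha>)"
        using G c by (simp flip: ennreal_mult)
      then have M: "ennreal ?c * ennreal (Gamma \<alpha>) * ennreal (?m x)
          = ennreal (?c * Gamma \<alpha> / Gamma (\<alpha> - \<sigma>)) * heat_potential (\<alpha> - \<sigma>) x"
        by (simp only: m(1)[symmetric] mult.assoc[symmetric])
      have "ennreal ?c * ennreal (Gamma \<alpha>) * (?T + ennreal (?m x))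
          = (ennreal ?c * ?S) * (ennreal (Gamma \<alpha>) * ennreal (?u x))"
        unfolding distrib_left T M S u by (rule jump_kernel_potential[OF \<sigma>(1) \<sigma>1 \<alpha>])
      also have "\<dots> = ennreal ?c * ennreal (Gamma \<alpha>) * (ennreal K * ennreal (?u x))"
        by (simp only: K mult_ac)
      finally show "?T + ennreal (?m x) = ennreal K * ennreal (?u x)"
        using G c by (subst (asm) ennreal_mult_cancel_left) (auto simp: ennreal_mult_eq_top_iff)
    qed (use u(2) m(2) level K in auto)
    then show ?thesis by blast
  qed
qed

theorem theorem3p2:
  fixes \<sigma> \<alpha> :: real
  defines "d \<equiv> real CARD('d)"
  assumes "0 < \<sigma>" and "\<sigma> \<le> 1"
    and "CARD('d) \<in> {1, 2} \<longrightarrow> \<sigma> < d / 2"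
    and "\<sigma> < \<alpha>" and "\<alpha> < d / 2"
  shows "positive_critical \<sigma> (\<lambda>x :: int ^ 'd. kappa (\<sigma> - \<alpha>) x / kappa (- \<alpha>) x)
         \<longleftrightarrow> \<alpha> < (d / 2 + \<sigma>) / 2"
proof -
  note \<sigma> = assms(2,3) and \<alpha> = assms(5) assms(6)[unfolded d_def]
  let ?u = "kappa (- \<alpha>) :: int ^ 'd \<Rightarrow> real" and ?m = "kappa (\<sigma> - \<alpha>) :: int ^ 'd \<Rightarrow> real"
  obtain K where "ground_state \<sigma> ?u ?m K" using ground_state_kappa[OF \<sigma> \<alpha>] by blast
  then interpret ground_state \<sigma> ?u ?m K .
  have a: "0 < \<alpha>" "0 < \<alpha> - \<sigma>" "\<alpha> - \<sigma> < real CARD('d) / 2" using \<sigma> \<alpha> by simp_all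
  have G: "Gamma \<alpha> > 0" "Gamma (\<alpha> - \<sigma>) > 0" using a by simp_all
  have u: "ennreal (Gamma \<alpha>) * ennreal (?u x) = heat_potential \<alpha> x" for x
    by (rule kappa_neg_eq_heat_potential[OF a(1) \<alpha>(2)])
  have m: "ennreal (Gamma (\<alpha> - \<sigma>)) * ennreal (?m x) = heat_potential (\<alpha> - \<sigma>) x" for x
    using kappa_neg_eq_heat_potential(1)[OF a(2,3), of x] by simp
  let ?E = "\<integral>\<^sup>+x. ennreal (?m x * ?u x) \<partial>count_space UNIV"
  have "ennreal (Gamma (\<alpha> - \<sigma>) * Gamma \<alpha>) * ?E
      = (\<integral>\<^sup>+x. ennreal (Gamma (\<alpha> - \<sigma>) * Gamma \<alpha>) * ennreal (?m x * ?u x) \<partial>count_space UNIV)"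
    by (simp add: nn_integral_cmult)
  also have "\<dots> = (\<integral>\<^sup>+x. heat_potential (\<alpha> - \<sigma>) x * heat_potential \<alpha> (x :: int ^ 'd) \<partial>count_space UNIV)"
    using G u_pos m_pos
    by (intro nn_integral_cong) (simp add: u[symmetric] m[symmetric] ennreal_mult less_imp_le mult_ac)
  also have "\<dots> = ennreal (Beta (\<alpha> - \<sigma>) \<alpha>) * heat_potential (2 * \<alpha> - \<sigma>) (0 :: int ^ 'd)"
    using nn_integral_heat_potential_mult[OF a(2,1), where 'd = 'd] by (simp add: algebra_simps)
  finally have E: "ennreal (Gamma (\<alpha> - \<sigma>) * Gamma \<alpha>) * ?E = \<dots>" .
  \<comment> \<open>With a positive finite factor on each side, finiteness of the energy is
    equivalent to finiteness of the single potential at the origin.\<close>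
  have "Beta (\<alpha> - \<sigma>) \<alpha> > 0"
    using a G by (auto simp: Beta_def intro!: divide_pos_pos mult_pos_pos)
  then have "heat_potential (2 * \<alpha> - \<sigma>) (0 :: int ^ 'd) < top \<longleftrightarrow> ?E < top"
    using arg_cong[OF E, of "\<lambda>c. c < top"] G by (auto simp: ennreal_mult_less_top)
  \<comment> \<open>The exponent \<open>2 * \<alpha> - \<sigma>\<close> is positive, so small times
    never obstruct and the dimension alone decides. Solving
    \<open>2 * \<alpha> - \<sigma> < d / 2\<close> for \<alpha> gives the threshold.\<close>
  moreover have "heat_potential (2 * \<alpha> - \<sigma>) (0 :: int ^ 'd) < top \<longleftrightarrow> 2 * \<alpha> - \<sigma> < d / 2"
    using heat_potential_finite[of "2 * \<alpha> - \<sigma>" "0 :: int ^ 'd"] heat_potential_0_infinite[where 'd = 'd, of "2 * \<alpha> - \<sigma>"] \<sigma> \<alpha>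
    unfolding d_def by (cases "2 * \<alpha> - \<sigma> < real CARD('d) / 2") auto
  ultimately show ?thesis
    unfolding positive_critical_iff by auto
qed

end
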